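(* There is a multithreaded algorithm that, given a batch of $b$ batches of items with $n$ items in total, returns a single batch consisting of the concatenation of these batches in order, within $O(b+n)$ work and $O(\log b+\log n)$ span.
   Context: Computation model: asynchronous dynamic multithreading on a parallel pointer machine with queued read-modify-write (QRMW) contention. Memory consists of nodes each with a fixed number of cells holding an integer or a pointer; pointers can only be stored, followed and tested for equality (no pointer arithmetic). Threads can fork threads, join (wait for termination of) a thread, suspend themselves, resume a suspended thread, terminate, create memory nodes, perform integer arithmetic, and perform read-modify-write operations (read, write, test-and-set, fetch-and-add, compare-and-swap) on memory cells, each in $O(1)$ time, except that RMW operations on the same memory cell are FIFO-queued and serviced one per time step, the issuing thread being blocked until its request is serviced. An execution is described by its execution DAG whose nodes are the executed primitive instructions, weighted by the time taken to execute them, and whose edges are the dependencies (program order within a thread, fork, join, resume). Work is the total weight of the DAG and span is the maximum total weight of a directed path. The bounds are required to hold for every execution schedule, asymptotically as the parameters grow. A batch (of items, or of batches) is stored as a BBT: a full binary tree with its elements only at its leaves (the batch order is the left-to-right leaf order) in which at every internal node the heights of the two subtrees differ by at most $1$; each node stores its children, its subtree height and number of leaves, and the first and last element in its subtree; empty batches are allowed. *)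

theory Defs
  imports Complex_Main "HOL-Library.Landau_Symbols"
begin

section \<open>A multithreaded pointer machine with queued read-modify-write contention\<close>

type_synonym addr = nat
type_synonym tid = nat
type_synonym reg = nat
type_synonym label = nat

text \<open>
  Integers and pointers. Pointers to nodes and handles of threads are opaque: the instruction set
  below offers no operation that inspects or computes the number inside \<open>Ptr\<close> or \<open>Thr\<close>.
\<close>

datatype val =
    is_Num: Num (the_num: int)
  | Null
  | is_Ptr: Ptr (the_addr: addr)
  | is_Thr: Thr (the_tid: tid)

text \<open>
  Read-modify-write operations; the parameter is \<open>reg\<close> in programs and \<open>val\<close> once the operands have
  been fetched. Each operation yields the previous content of the cell, so a compare-and-swap has
  succeeded iff its result equals the expected value, its first operand.
\<close>

datatype 'a rmw = Read | Write 'a | TestAndSet | FetchAdd 'a | CompareSwap 'a 'a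

fun rmw_update :: "val rmw \<Rightarrow> val \<Rightarrow> val" where
  "rmw_update Read v = v"
| "rmw_update (Write x) v = x"
| "rmw_update TestAndSet v = Num 1"
| "rmw_update (FetchAdd x) v = (case (x, v) of (Num i, Num j) \<Rightarrow> Num (j + i) | _ \<Rightarrow> v)"
| "rmw_update (CompareSwap x y) v = (if v = x then y else v)"

datatype arith = Add | Sub | Mul | Div | Mod

fun arith_eval :: "arith \<Rightarrow> int \<Rightarrow> int \<Rightarrow> int" where
  "arith_eval Add i j = i + j"
| "arith_eval Sub i j = i - j"
| "arith_eval Mul i j = i * j"
| "arith_eval Div i j = i div j"
| "arith_eval Mod i j = i mod j"

text \<open>
  The destination register, if any, comes first. A program mentions finitely many registers, so
  every thread has constant-size local state (which a forked thread inherits as a copy); all other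
  storage is in memory nodes. The cell of a node is a literal in \<open>Rmw\<close>, so a program uses a fixed
  number of cells per node.
\<close>

datatype instr =
    Const reg int
  | SetNull reg
  | Move reg reg
  | Arith arith reg reg reg
  | Jump label
  | JumpEq reg reg label
  | JumpLess reg reg label
  | New reg
  | Rmw reg "reg rmw" reg nat   \<comment> \<open>\<open>Rmw d op r f\<close>: operate on cell \<open>f\<close> of the node that \<open>r\<close> points to\<close>
  | Fork reg label
  | Self reg
  | Join reg
  | Suspend
  | Resume reg
  | Terminate

type_synonym program = "instr list"

type_synonym heap = "(nat \<Rightarrow> val) list"   \<comment> \<open>node at an address, then cell of that node\<close>

datatype status = Running | Waiting | Suspended | Terminated

text \<open>
  \<open>deps\<close> contains the instructions (nodes of the execution DAG) on which the next instruction of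
  the thread depends; for a terminated thread it is its last instruction.
\<close>

record thread =
  status :: status
  pc :: label
  regs :: "reg \<Rightarrow> val"
  deps :: "nat set"

record request =
  req_thread :: tid
  req_dest :: reg
  req_op :: "val rmw"
  req_cell :: "addr \<times> nat"
  req_node :: nat

text \<open>A DAG is the list of its nodes, identified with their positions in the list.\<close>

record dag_node =
  weight :: nat
  preds :: "nat set"

type_synonym dag = "dag_node list"

text \<open>
  \<open>pending\<close> holds all unserviced requests in order of arrival; the FIFO queue of a cell is the
  sublist of the requests for that cell.
\<close>

record config =
  heap :: heap
  threads :: "thread list"
  pending :: "request list"
  dag :: dag

definition emit :: "dag_node \<Rightarrow> config \<Rightarrow> config" where
  "emit d c = c\<lparr>dag := dag c @ [d]\<rparr>"

definition set_thread :: "tid \<Rightarrow> thread \<Rightarrow> config \<Rightarrow> config" where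
  "set_thread t th c = c\<lparr>threads := (threads c)[t := th]\<rparr>"

definition set_reg :: "reg \<Rightarrow> val \<Rightarrow> thread \<Rightarrow> thread" where
  "set_reg r v th = th\<lparr>regs := (regs th)(r := v)\<rparr>"

text \<open>
  Whether a thread can execute its next instruction. A running thread for which this fails is
  waiting in a \<open>Join\<close>, or stuck for good on an ill-typed operand or a label outside the program.
\<close>

definition ready :: "program \<Rightarrow> config \<Rightarrow> tid \<Rightarrow> bool" where
  "ready P c t \<longleftrightarrow> t < length (threads c) \<and>
    (let th = threads c ! t; R = regs th in
      status th = Running \<and> pc th < length P \<and>
      (case P ! pc th of
         Arith _ _ r1 r2 \<Rightarrow> is_Num (R r1) \<and> is_Num (R r2)
       | JumpLess r1 r2 _ \<Rightarrow> is_Num (R r1) \<and> is_Num (R r2)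
       | Rmw _ _ r _ \<Rightarrow> is_Ptr (R r) \<and> the_addr (R r) < length (heap c)
       | Join r \<Rightarrow>
           is_Thr (R r) \<and> the_tid (R r) < length (threads c) \<and>
           status (threads c ! the_tid (R r)) = Terminated
       | Resume r \<Rightarrow> is_Thr (R r) \<and> the_tid (R r) < length (threads c)
       | _ \<Rightarrow> True))"

text \<open>
  Execution of the next instruction of a ready thread. Every instruction has weight 1, except that
  a read-modify-write instruction starts with weight 0 and gains 1 in every time step in which it
  is in the queue (see \<open>serve\<close>). Resuming a thread that is not suspended has no effect.
\<close>

definition exec :: "program \<Rightarrow> tid \<Rightarrow> config \<Rightarrow> config" where
  "exec P t c =
    (let th = threads c ! t;
         R = regs th;
         k = length (dag c);
         c1 = emit \<lparr>weight = 1, preds = deps th\<rparr> c;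
         th1 = th\<lparr>pc := Suc (pc th), deps := {k}\<rparr>
     in case P ! pc th of
       Const d i \<Rightarrow> set_thread t (set_reg d (Num i) th1) c1
     | SetNull d \<Rightarrow> set_thread t (set_reg d Null th1) c1
     | Move d r \<Rightarrow> set_thread t (set_reg d (R r) th1) c1
     | Arith f d r1 r2 \<Rightarrow>
         set_thread t (set_reg d (Num (arith_eval f (the_num (R r1)) (the_num (R r2)))) th1) c1
     | Jump l \<Rightarrow> set_thread t (th1\<lparr>pc := l\<rparr>) c1
     | JumpEq r1 r2 l \<Rightarrow>
         set_thread t (if R r1 = R r2 then th1\<lparr>pc := l\<rparr> else th1) c1
     | JumpLess r1 r2 l \<Rightarrow>
         set_thread t (if the_num (R r1) < the_num (R r2) then th1\<lparr>pc := l\<rparr> else th1) c1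
     | New d \<Rightarrow>
         set_thread t (set_reg d (Ptr (length (heap c))) th1)
           (c1\<lparr>heap := heap c @ [\<lambda>_. Num 0]\<rparr>)
     | Rmw d f r i \<Rightarrow>
         set_thread t (th1\<lparr>status := Waiting\<rparr>)
           ((emit \<lparr>weight = 0, preds = deps th\<rparr> c)
             \<lparr>pending := pending c @
               [\<lparr>req_thread = t, req_dest = d, req_op = map_rmw R f,
                 req_cell = (the_addr (R r), i), req_node = k\<rparr>]\<rparr>)
     | Fork d l \<Rightarrow>
         c1\<lparr>threads := (threads c)[t := set_reg d (Thr (length (threads c))) th1] @
              [\<lparr>status = Running, pc = l, regs = R, deps = {k}\<rparr>]\<rparr>
     | Self d \<Rightarrow> set_thread t (set_reg d (Thr t) th1) c1
     | Join r \<Rightarrow>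
         set_thread t th1
           (emit \<lparr>weight = 1, preds = deps th \<union> deps (threads c ! the_tid (R r))\<rparr> c)
     | Suspend \<Rightarrow> set_thread t (th1\<lparr>status := Suspended\<rparr>) c1
     | Resume r \<Rightarrow>
         (let u = the_tid (R r); thu = threads c ! u; c2 = set_thread t th1 c1 in
            if status thu = Suspended
            then set_thread u (thu\<lparr>status := Running, deps := insert k (deps thu)\<rparr>) c2
            else c2)
     | Terminate \<Rightarrow> set_thread t (th1\<lparr>status := Terminated\<rparr>) c1)"

definition queue_heads :: "request list \<Rightarrow> request list" where
  "queue_heads rs = [r \<leftarrow> rs. r = hd [q \<leftarrow> rs. req_cell q = req_cell r]]"

definition perform :: "request \<Rightarrow> config \<Rightarrow> config" where
  "perform r c =
    (let (a, i) = req_cell r; old = (heap c ! a) i; t = req_thread r in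
      set_thread t (set_reg (req_dest r) old ((threads c ! t)\<lparr>status := Running\<rparr>))
        (c\<lparr>heap := (heap c)[a := (heap c ! a)(i := rmw_update (req_op r) old)]\<rparr>))"

definition tick :: "request \<Rightarrow> config \<Rightarrow> config" where
  "tick r c =
    (let k = req_node r; d = dag c ! k in c\<lparr>dag := (dag c)[k := d\<lparr>weight := Suc (weight d)\<rparr>]\<rparr>)"

text \<open>The effect of one time step on the queues: every nonempty queue services its first request.\<close>

definition serve :: "config \<Rightarrow> config" where
  "serve c =
    (let rs = pending c; hs = queue_heads rs in
      fold perform hs (fold tick rs (c\<lparr>pending := [r \<leftarrow> rs. r \<notin> set hs]\<rparr>)))"

text \<open>
  One time step of an asynchronous schedule: an arbitrary set of threads, all of them ready at the
  beginning of the step, execute one instruction each, in an arbitrary order; then the queues are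
  served. The second condition excludes time steps in which nothing happens.
\<close>

definition step :: "program \<Rightarrow> config \<Rightarrow> config \<Rightarrow> bool" where
  "step P c c' \<longleftrightarrow>
    (\<exists>ts. distinct ts \<and> (\<forall>t \<in> set ts. ready P c t) \<and> (ts \<noteq> [] \<or> pending c \<noteq> []) \<and>
          c' = serve (fold (exec P) ts c))"

text \<open>Execution starts with a single thread, which has the argument in register 0.\<close>

definition init :: "heap \<Rightarrow> val \<Rightarrow> config" where
  "init h v =
    \<lparr>heap = h,
     threads = [\<lparr>status = Running, pc = 0, regs = (\<lambda>_. Null)(0 := v), deps = {}\<rparr>],
     pending = [], dag = []\<rparr>"

definition reachable :: "program \<Rightarrow> heap \<Rightarrow> val \<Rightarrow> config \<Rightarrow> bool" where
  "reachable P h v c \<longleftrightarrow> (step P)\<^sup>*\<^sup>* (init h v) c"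

definition final :: "program \<Rightarrow> config \<Rightarrow> bool" where
  "final P c \<longleftrightarrow> (\<nexists>c'. step P c c')"

text \<open>The algorithm returns when its initial thread terminates, with the result in register 0.\<close>

definition returned :: "config \<Rightarrow> bool" where
  "returned c \<longleftrightarrow> status (threads c ! 0) = Terminated"

definition result :: "config \<Rightarrow> val" where
  "result c = regs (threads c ! 0) 0"

definition work :: "dag \<Rightarrow> nat" where
  "work D = (\<Sum>d\<leftarrow>D. weight d)"

definition dag_path :: "dag \<Rightarrow> nat list \<Rightarrow> bool" where
  "dag_path D p \<longleftrightarrow> set p \<subseteq> {..<length D} \<and> successively (\<lambda>i j. i \<in> preds (D ! j)) p"

text \<open>In the DAG of an execution, edges lead to larger positions, so there are finitely many paths.\<close>

definition span :: "dag \<Rightarrow> nat" where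
  "span D = Max {\<Sum>i\<leftarrow>p. weight (D ! i) | p. dag_path D p}"

text \<open>
  Every execution schedule on the given input ends, after which the initial thread has terminated
  and the bounds hold; and the postcondition holds from the moment at which the algorithm returns.
\<close>

definition runs_within ::
    "program \<Rightarrow> heap \<Rightarrow> val \<Rightarrow> (heap \<Rightarrow> val \<Rightarrow> bool) \<Rightarrow> real \<Rightarrow> real \<Rightarrow> bool" where
  "runs_within P h v post W S \<longleftrightarrow>
    (\<nexists>e. e 0 = init h v \<and> (\<forall>i. step P (e i) (e (Suc i)))) \<and>
    (\<forall>c. reachable P h v c \<longrightarrow>
      (returned c \<longrightarrow> post (heap c) (result c)) \<and>
      (final P c \<longrightarrow> returned c \<and> real (work (dag c)) \<le> W \<and> real (span (dag c)) \<le> S))"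


section \<open>Batches\<close>

abbreviation (input) "left_cell \<equiv> 0 :: nat"
abbreviation (input) "right_cell \<equiv> 1 :: nat"
abbreviation (input) "height_cell \<equiv> 2 :: nat"
abbreviation (input) "size_cell \<equiv> 3 :: nat"
abbreviation (input) "first_cell \<equiv> 4 :: nat"
abbreviation (input) "last_cell \<equiv> 5 :: nat"

text \<open>
  \<open>bbt h a k xs A\<close>: in heap \<open>h\<close>, the node \<open>a\<close> is the root of a BBT of height \<open>k\<close> with the elements
  \<open>xs\<close> at its leaves from left to right; \<open>A\<close> is the set of the nodes of the tree. A leaf stores its
  element as both the first and the last element of its subtree.
\<close>

inductive bbt :: "heap \<Rightarrow> addr \<Rightarrow> nat \<Rightarrow> val list \<Rightarrow> addr set \<Rightarrow> bool" for h where
  leaf: "\<lbrakk>a < length h;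
          (h ! a) left_cell = Null; (h ! a) right_cell = Null;
          (h ! a) height_cell = Num 0; (h ! a) size_cell = Num 1;
          (h ! a) first_cell = x; (h ! a) last_cell = x\<rbrakk>
         \<Longrightarrow> bbt h a 0 [x] {a}"
| node: "\<lbrakk>bbt h l m xs A; bbt h r n ys B; A \<inter> B = {};
          m \<le> n + 1; n \<le> m + 1;
          a < length h; a \<notin> A \<union> B;
          (h ! a) left_cell = Ptr l; (h ! a) right_cell = Ptr r;
          (h ! a) height_cell = Num (int (Suc (max m n)));
          (h ! a) size_cell = Num (int (length (xs @ ys)));
          (h ! a) first_cell = hd xs; (h ! a) last_cell = last ys\<rbrakk>
         \<Longrightarrow> bbt h a (Suc (max m n)) (xs @ ys) ({a} \<union> A \<union> B)"

inductive batch :: "heap \<Rightarrow> val \<Rightarrow> val list \<Rightarrow> addr set \<Rightarrow> bool" for h where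
  empty: "batch h Null [] {}"
| nonempty: "bbt h a k xs A \<Longrightarrow> batch h (Ptr a) xs A"

text \<open>
  A batch whose elements \<open>vs\<close> represent batches. All trees involved are disjoint in memory; the
  items, however, are arbitrary values and may coincide.
\<close>

definition batch_of_batches :: "heap \<Rightarrow> val \<Rightarrow> val list list \<Rightarrow> bool" where
  "batch_of_batches h v xss \<longleftrightarrow>
    (\<exists>vs A B. batch h v vs A \<and> length vs = length xss \<and>
      (\<forall>i < length xss. batch h (vs ! i) (xss ! i) (B i) \<and> A \<inter> B i = {}) \<and>
      (\<forall>i < length xss. \<forall>j < i. B i \<inter> B j = {}))"

end

theory Submission
  imports Defs
begin

text \<open>
  The program only forks and joins, allocates nothing, and no memory cell is ever accessed by two
  threads without a fork or join in between, so that no request waits for another one.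

  A first recursion over the batch of batches discards empty batches and splices the others, in
  place, into one full binary tree of depth \<open>O(log b + log n)\<close> with the items at its leaves. It
  remains to rebalance this tree. Let \<open>2^Q0\<close> be the power of two in \<open>{n<..2n}\<close>. Leaf \<open>i\<close> gets the
  position \<open>i\<close> if \<open>i < m\<close> and \<open>2 i - m\<close> otherwise, where \<open>m = 2 n - 2^Q0\<close>; so the positions form an
  interval \<open>{0..<2^Q0}\<close> in which each of the later leaves occupies two places. Merging aligned blocks of
  positions of equal size \<open>2^l\<close> gives trees of height \<open>l - 1\<close> or \<open>l\<close>, hence a BBT.

  The difficulty is how a block finds its partner. A thread that descends to an inner node \<open>x\<close> forks
  a thread for the right subtree, leaves the handle of that thread in \<open>x\<close>, and continues to the left.
  Thus every thread is the thread of the leaf at which it arrives, and \<open>x\<close> is the gap in front of the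
  leaf of the forked thread. A thread then grows the block that begins at its leaf: as long as this is
  an even block, its partner is the final block of the thread whose handle is in the gap to the right,
  so it joins that thread and merges at the gap; an odd block is final and is left in the gap to the
  left. A thread whose final block has size \<open>2^l\<close> only joins threads with smaller final blocks, which
  bounds the depth of the joins by \<open>Q0\<close>; each merge takes constant time.
\<close>

section \<open>Verification of fork-join programs with exclusive access\<close>

text \<open>Static deadlines are possible because the level \<open>l\<close> of the final block of a
  forked thread is the 2-adic valuation of the position of its leaf: blocks are aligned, and the
  first odd one ends the growth. The level is thus known at the fork. The partner of an even block
  of level \<open>l\<close> begins at an odd multiple of \<open>2 ^ l\<close>, so its own growth
  ends at exactly level \<open>l\<close>; the even block begins at a multiple of
  \<open>2 ^ Suc l\<close>, so the joining thread has a larger valuation, unless it is the thread of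
  position 0, which never meets an odd block and stops at \<open>2 ^ Q0\<close>.

  All schedules are covered at once by ownership. Threads own disjoint sets of cells, so within a
  time step each instruction commutes with the servicing of the other threads' requests, no queue is
  longer than one, and every instruction weighs exactly 1. Work becomes a budget that is split at
  forks and merged at joins; span becomes a clock carried by each thread and compared with the
  deadlines.\<close>

type_synonym store = "addr \<times> nat \<rightharpoonup> val"
type_synonym lstate = "label \<times> (reg \<Rightarrow> val) \<times> store"

text \<open>\<open>None\<close> covers an ill-typed operand, a cell that is not owned, and every
  instruction that is not certified here; forks, joins and termination have rules of their own in
  \<open>ok\<close>.\<close>

fun local_step :: "instr \<Rightarrow> lstate \<Rightarrow> lstate option" where
  "local_step (Const d i) (p, R, s) = Some (Suc p, R(d := Num i), s)"
| "local_step (Move d r) (p, R, s) = Some (Suc p, R(d := R r), s)"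
| "local_step (Arith f d a b) (p, R, s) =
    (case (R a, R b) of (Num i, Num j) \<Rightarrow> Some (Suc p, R(d := Num (arith_eval f i j)), s) | _ \<Rightarrow> None)"
| "local_step (Jump l) (p, R, s) = Some (l, R, s)"
| "local_step (JumpEq a b l) (p, R, s) = Some (if R a = R b then l else Suc p, R, s)"
| "local_step (JumpLess a b l) (p, R, s) =
    (case (R a, R b) of (Num i, Num j) \<Rightarrow> Some (if i < j then l else Suc p, R, s) | _ \<Rightarrow> None)"
| "local_step (Rmw d Read r f) (p, R, s) =
    (case R r of Ptr a \<Rightarrow> map_option (\<lambda>v. (Suc p, R(d := v), s)) (s (a, f)) | _ \<Rightarrow> None)"
| "local_step (Rmw d (Write x) r f) (p, R, s) =
    (case R r of Ptr a \<Rightarrow> map_option (\<lambda>v. (Suc p, R(d := v), s((a, f) \<mapsto> R x))) (s (a, f)) | _ \<Rightarrow> None)"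
| "local_step _ _ = None"

text \<open>
  \<open>ok P \<Psi> D S k p R s T w d\<close>: a thread in role \<open>k\<close>, at label \<open>p\<close> with registers \<open>R\<close>, that owns the cells
  \<open>s\<close>, the right to join the threads in \<open>dom T\<close> (with their roles), and \<open>w\<close> units of work, and whose
  instructions so far end at depth at most \<open>d\<close> of the DAG, terminates by the deadline \<open>D k\<close> with
  resources in \<open>\<Psi> k\<close>, which then belong to the thread that joins it. Joins only wait for
  earlier deadlines; this excludes deadlock.
\<close>

inductive ok :: "program \<Rightarrow> ('k \<Rightarrow> (reg \<Rightarrow> val) \<Rightarrow> store \<Rightarrow> (tid \<rightharpoonup> 'k) \<Rightarrow> nat \<Rightarrow> bool) \<Rightarrow> ('k \<Rightarrow> nat) \<Rightarrow> nat \<Rightarrow>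
    'k \<Rightarrow> label \<Rightarrow> (reg \<Rightarrow> val) \<Rightarrow> store \<Rightarrow> (tid \<rightharpoonup> 'k) \<Rightarrow> nat \<Rightarrow> nat \<Rightarrow> bool"
  for P \<Psi> D S where
  local: "\<lbrakk>p < length P; 0 < w; local_step (P ! p) (p, R, s) = Some (p', R', s');
    ok P \<Psi> D S k p' R' s' T (w - 1) (d + 1)\<rbrakk> \<Longrightarrow> ok P \<Psi> D S k p R s T w d"
| fork: "\<lbrakk>p < length P; P ! p = Fork r l; w1 + w2 < w; D k' \<le> S;
    ok P \<Psi> D S k' l R (s |` X) (T |` Y) w1 (d + 1);
    \<And>u. u \<notin> dom T \<Longrightarrow> ok P \<Psi> D S k (Suc p) (R(r := Thr u)) (s |` (- X)) ((T |` (- Y))(u \<mapsto> k')) w2 (d + 1)\<rbrakk>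
    \<Longrightarrow> ok P \<Psi> D S k p R s T w d"
| join: "\<lbrakk>p < length P; P ! p = Join r; 0 < w; R r = Thr u; T u = Some k'; D k' < D k;
    \<And>R' s' T' w'. \<lbrakk>\<Psi> k' R' s' T' w'; dom s \<inter> dom s' = {}; dom T \<inter> dom T' = {}\<rbrakk> \<Longrightarrow>
      ok P \<Psi> D S k (Suc p) R (s ++ s') (T(u := None) ++ T') (w - 1 + w') (max d (D k') + 1)\<rbrakk>
    \<Longrightarrow> ok P \<Psi> D S k p R s T w d"
| terminate: "\<lbrakk>p < length P; P ! p = Terminate; 0 < w; \<Psi> k R s T (w - 1); d + 1 \<le> D k\<rbrakk>
    \<Longrightarrow> ok P \<Psi> D S k p R s T w d"

text \<open>\<open>flush\<close> serves all requests at once, which is what \<open>serve\<close> does in the absence of contention.\<close>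

definition flush :: "config \<Rightarrow> config" where
  "flush c = fold perform (pending c) (fold tick (pending c) (c\<lparr>pending := []\<rparr>))"

section \<open>Servicing without contention, and its commutation with execution\<close>

lemma queue_heads_distinct: "distinct (map req_cell rs) \<Longrightarrow> queue_heads rs = rs"
proof -
  assume d: "distinct (map req_cell rs)"
  have "[q \<leftarrow> rs. req_cell q = req_cell r] = [r]" if "r \<in> set rs" for r
    using d that by (induction rs) (auto simp: filter_empty_conv image_iff filter_False)
  then show ?thesis unfolding queue_heads_def by (intro filter_True) auto
qed

lemma serve_eq_flush: "distinct (map req_cell (pending c)) \<Longrightarrow> serve c = flush c"
  by (simp add: serve_def flush_def queue_heads_distinct Let_def)

lemma heap_length_perform[simp]: "length (heap (perform r c)) = length (heap c)"
  by (simp add: perform_def set_thread_def Let_def split_beta)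
lemma threads_length_perform[simp]: "length (threads (perform r c)) = length (threads c)"
  by (simp add: perform_def set_thread_def Let_def split_beta)
lemma dag_perform[simp]: "dag (perform r c) = dag c"
  by (simp add: perform_def set_thread_def Let_def split_beta)
lemma pending_perform[simp]: "pending (perform r c) = pending c"
  by (simp add: perform_def set_thread_def Let_def split_beta)
lemma tick_simps[simp]: "heap (tick r c) = heap c" "threads (tick r c) = threads c" "pending (tick r c) = pending c"
  "length (dag (tick r c)) = length (dag c)"
  by (simp_all add: tick_def Let_def)

lemma threads_perform_other: "t \<noteq> req_thread r \<Longrightarrow> threads (perform r c) ! t = threads c ! t"
  by (simp add: perform_def set_thread_def Let_def split_beta)

text \<open>A \<open>Join\<close> reads the \<open>deps\<close> of another thread. Since servicing
  leaves them alone, a join commutes even with servicing a request of the thread it joins.\<close>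

lemma perform_thread: "deps (threads (perform r c) ! t) = deps (threads c ! t)"
proof (cases "t = req_thread r \<and> t < length (threads c)")
  case True
  then show ?thesis by (auto simp: perform_def set_thread_def Let_def split_beta set_reg_def)
next
  case False
  then show ?thesis
    by (cases "t = req_thread r") (auto simp: perform_def set_thread_def Let_def split_beta list_update_beyond)
qed

text \<open>\<open>Resume\<close> depends on the status of another thread, which servicing changes;
  \<open>New\<close> lengthens the heap, so commuting it with \<open>perform\<close> would require
  the serviced address to be in range.\<close>

definition simple_instr :: "instr \<Rightarrow> bool" where
  "simple_instr i \<longleftrightarrow> (case i of New _ \<Rightarrow> False | Resume _ \<Rightarrow> False | _ \<Rightarrow> True)"

text \<open>Execution never looks at the content of a cell: an \<open>Rmw\<close> only enqueues a
  request, and cells are accessed in \<open>perform\<close> alone. The bound on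
  \<open>req_thread r\<close> keeps the update by \<open>perform\<close> away from a thread that
  \<open>Fork\<close> appends.\<close>

lemma exec_perform:
  assumes "t \<noteq> req_thread r" "simple_instr (P ! pc (threads c ! t))" "req_thread r < length (threads c)" 
  shows "exec P t (perform r c) = perform r (exec P t c)"
proof -
  have 1: "threads (perform r c) ! t = threads c ! t" using assms(1) by (rule threads_perform_other)
  obtain a i where ai: "req_cell r = (a, i)" by force
  show ?thesis using assms
    by (cases "P ! pc (threads c ! t)")
       (simp_all add: exec_def 1 ai perform_thread[unfolded perform_def] simple_instr_def Let_def perform_def
         set_thread_def emit_def list_update_append nth_append list_update_swap[of t "req_thread r"]
         perform_thread[where r = r, unfolded perform_def ai set_thread_def Let_def, simplified])
qed

lemma exec_tick:
  assumes "simple_instr (P ! pc (threads c ! t))" "req_node r < length (dag c)"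
  shows "exec P t (tick r c) = tick r (exec P t c)"
  using assms by (cases "P ! pc (threads c ! t)")
    (simp_all add: exec_def simple_instr_def Let_def tick_def set_thread_def emit_def list_update_append nth_append)

definition reqs_ok :: "config \<Rightarrow> bool" where
  "reqs_ok c \<longleftrightarrow> (\<forall>r \<in> set (pending c). req_thread r < length (threads c) \<and> req_node r < length (dag c))"

lemma fold_perform_simps[simp]:
  "length (heap (fold perform rs c)) = length (heap c)"
  "length (threads (fold perform rs c)) = length (threads c)"
  "dag (fold perform rs c) = dag c" "pending (fold perform rs c) = pending c"
  by (induction rs arbitrary: c) auto
lemma fold_tick_simps[simp]:
  "heap (fold tick rs c) = heap c" "threads (fold tick rs c) = threads c" "pending (fold tick rs c) = pending c"
  "length (dag (fold tick rs c)) = length (dag c)"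
  by (induction rs arbitrary: c) auto

lemma flush_simps[simp]: "pending (flush c) = []" "length (dag (flush c)) = length (dag c)"
   "length (threads (flush c)) = length (threads c)" "length (heap (flush c)) = length (heap c)"
  by (auto simp: flush_def)

lemma flush_threads_other: "t \<notin> req_thread ` set (pending c) \<Longrightarrow> threads (flush c) ! t = threads c ! t"
proof -
  have "t \<notin> req_thread ` set rs \<Longrightarrow> threads (fold perform rs c) ! t = threads c ! t" for rs c
    by (induction rs arbitrary: c) (auto simp: threads_perform_other)
  from this[of "pending c" "fold tick (pending c) (c\<lparr>pending := []\<rparr>)"]
  show "t \<notin> req_thread ` set (pending c) \<Longrightarrow> ?thesis" by (simp add: flush_def)
qed

lemma flush_no_pending: "pending c = [] \<Longrightarrow> flush c = c"
  by (simp add: flush_def)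

lemma exec_fold_perform:
  assumes "t \<notin> req_thread ` set rs" "simple_instr (P ! pc (threads c ! t))" "\<forall>r\<in>set rs. req_thread r < length (threads c)"
  shows "exec P t (fold perform rs c) = fold perform rs (exec P t c)"
  using assms
proof (induction rs arbitrary: c)
  case (Cons r rs)
  have "exec P t (fold perform (r # rs) c) = exec P t (fold perform rs (perform r c))" by simp
  also have "\<dots> = fold perform rs (exec P t (perform r c))"
    using Cons.prems by (intro Cons.IH) (auto simp: threads_perform_other)
  also have "exec P t (perform r c) = perform r (exec P t c)"
    using Cons.prems by (intro exec_perform) auto
  finally show ?case by simp
qed simp

lemma exec_fold_tick:
  assumes "simple_instr (P ! pc (threads c ! t))" "\<forall>r\<in>set rs. req_node r < length (dag c)"
  shows "exec P t (fold tick rs c) = fold tick rs (exec P t c)"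
  using assms
proof (induction rs arbitrary: c)
  case (Cons r rs)
  have "exec P t (fold tick (r # rs) c) = exec P t (fold tick rs (tick r c))" by simp
  also have "\<dots> = fold tick rs (exec P t (tick r c))"
    using Cons.prems by (intro Cons.IH) auto
  also have "exec P t (tick r c) = tick r (exec P t c)"
    using Cons.prems by (intro exec_tick) auto
  finally show ?case by simp
qed simp

definition new_reqs :: "program \<Rightarrow> tid \<Rightarrow> config \<Rightarrow> request list" where
  "new_reqs P t c = pending (exec P t (c\<lparr>pending := []\<rparr>))"

lemma pending_exec: 
  assumes "simple_instr (P ! pc (threads c ! t))"
  shows "pending (exec P t c) = pending c @ new_reqs P t c"
    "(exec P t c)\<lparr>pending := []\<rparr> = (exec P t (c\<lparr>pending := []\<rparr>))\<lparr>pending := []\<rparr>"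
  using assms by (cases "P ! pc (threads c ! t)";
     auto simp: exec_def simple_instr_def Let_def set_thread_def emit_def new_reqs_def)+

lemma pending_exec_cong:
  assumes "threads c ! t = threads c' ! t" "length (dag c) = length (dag c')"
  shows "pending (exec P t (c\<lparr>pending := []\<rparr>)) = pending (exec P t (c'\<lparr>pending := []\<rparr>))"
  using assms by (cases "P ! pc (threads c ! t)") (simp_all add: exec_def Let_def set_thread_def emit_def)

lemma new_reqs_cases: "new_reqs P t c = [] \<or> (\<exists>d f r i. P ! pc (threads c ! t) = Rmw d f r i \<and> 
   new_reqs P t c = [\<lparr>req_thread = t, req_dest = d, req_op = map_rmw (regs (threads c ! t)) f,
                 req_cell = (the_addr (regs (threads c ! t) r), i), req_node = length (dag c)\<rparr>])"
  by (cases "P ! pc (threads c ! t)";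
     auto simp: exec_def simple_instr_def Let_def set_thread_def emit_def new_reqs_def)+

lemma perform_tick: "perform r (tick q c) = tick q (perform r c)"
  by (simp add: perform_def tick_def Let_def set_thread_def split_beta)

lemma fold_perform_tick: "fold perform rs (tick q c) = tick q (fold perform rs c)"
  by (induction rs arbitrary: c) (simp_all add: perform_tick)

lemma perform_pending: "perform r (c\<lparr>pending := x\<rparr>) = (perform r c)\<lparr>pending := x\<rparr>"
  by (simp add: perform_def Let_def set_thread_def split_beta)
lemma tick_pending: "tick r (c\<lparr>pending := x\<rparr>) = (tick r c)\<lparr>pending := x\<rparr>"
  by (simp add: tick_def Let_def)
lemma fold_perform_pending: "fold perform rs (c\<lparr>pending := x\<rparr>) = (fold perform rs c)\<lparr>pending := x\<rparr>"
  by (induction rs arbitrary: c) (simp_all add: perform_pending)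
lemma fold_tick_pending: "fold tick rs (c\<lparr>pending := x\<rparr>) = (fold tick rs c)\<lparr>pending := x\<rparr>"
  by (induction rs arbitrary: c) (simp_all add: tick_pending)

text \<open>Executing an instruction commutes with serving the requests of the other threads.\<close>

lemma flush_exec:
  assumes "t \<notin> req_thread ` set (pending c)" "simple_instr (P ! pc (threads c ! t))" "reqs_ok c"
  shows "flush (exec P t c) = flush (exec P t (flush c))"
proof -
  let ?rs = "pending c" and ?c0 = "c\<lparr>pending := []\<rparr>"
  let ?n = "new_reqs P t c"
  have fc: "flush c = fold perform ?rs (fold tick ?rs ?c0)" by (simp add: flush_def)
  have th: "threads (fold tick ?rs ?c0) ! t = threads c ! t" by simp
  have e: "exec P t (flush c) = fold perform ?rs (fold tick ?rs (exec P t ?c0))"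
    unfolding fc using assms by (subst exec_fold_perform) (auto simp: reqs_ok_def exec_fold_tick)
  have n: "pending (exec P t ?c0) = ?n" by (simp add: new_reqs_def)
  have "flush (exec P t c) = fold perform ?n (fold perform ?rs (fold tick ?n (fold tick ?rs ((exec P t ?c0)\<lparr>pending := []\<rparr>))))"
    unfolding flush_def pending_exec[OF assms(2)] by simp
  also have "fold perform ?rs (fold tick ?n x) = fold tick ?n (fold perform ?rs x)" for x
    using new_reqs_cases[of P t c] by (auto simp: fold_perform_tick)
  also have "fold perform ?n (fold tick ?n (fold perform ?rs (fold tick ?rs ((exec P t ?c0)\<lparr>pending := []\<rparr>)))) = flush (exec P t (flush c))"
    unfolding e unfolding flush_def by (simp add: n fold_perform_pending fold_tick_pending)
  finally show ?thesis .
qed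

section \<open>Effect of one instruction on owned cells and on the DAG\<close>

definition sat :: "store \<Rightarrow> heap \<Rightarrow> bool" where
  "sat s h \<longleftrightarrow> (\<forall>a i v. s (a, i) = Some v \<longrightarrow> a < length h \<and> (h ! a) i = v)"

text \<open>An \<open>Rmw\<close> is emitted with weight 0, but with no other request around it is
  ticked once and serviced in the same step. After \<open>flush\<close> it looks like any other
  instruction: weight 1, and the thread is running.\<close>

lemma exec_local:
  assumes p: "pending c = []" and t: "t < length (threads c)" and th: "threads c ! t = th"
    and run: "status th = Running" and sat: "sat s (heap c)"
    and st: "local_step (P ! pc th) (pc th, regs th, s) = Some (p', R', s')"
  shows "\<exists>H. flush (exec P t c) =
        c\<lparr>heap := H, threads := (threads c)[t := th\<lparr>pc := p', regs := R', deps := {length (dag c)}\<rparr>],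
          dag := dag c @ [\<lparr>weight = 1, preds = deps th\<rparr>]\<rparr> \<and>
      length H = length (heap c) \<and> dom s' = dom s \<and> sat s' H \<and>
      (\<forall>a i. (a, i) \<notin> dom s \<longrightarrow> (H ! a) i = (heap c ! a) i) \<and>
      (\<forall>r \<in> set (pending (exec P t c)). req_cell r \<in> dom s)"
proof (cases "\<exists>d f r i. P ! pc th = Rmw d f r i")
  case False
  have "\<not> (\<exists>d f r i. P ! pc th = Rmw d f r i) \<Longrightarrow> s' = s \<and> flush (exec P t c) =
        c\<lparr>threads := (threads c)[t := th\<lparr>pc := p', regs := R', deps := {length (dag c)}\<rparr>],
          dag := dag c @ [\<lparr>weight = 1, preds = deps th\<rparr>]\<rparr> \<and> pending (exec P t c) = []"
    using st p th run
    by (cases "P ! pc th"; cases th)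
       (auto simp: exec_def Let_def set_thread_def emit_def set_reg_def flush_no_pending split: val.splits if_splits)
  with False sat show ?thesis by (intro exI[of _ "heap c"]) auto
next
  case True
  then obtain d f r i where I: "P ! pc th = Rmw d f r i" by blast
  show ?thesis
  proof (cases f)
    case Read
    then obtain a v where a: "regs th r = Ptr a" "s (a, i) = Some v" "p' = Suc (pc th)" "R' = (regs th)(d := v)" "s' = s"
      using st I by (auto split: val.splits)
    from sat a have h: "a < length (heap c)" "(heap c ! a) i = v" by (auto simp: sat_def)
    have e: "(heap c)[a := (heap c ! a)(i := v)] = heap c" using h by (metis fun_upd_triv list_update_id)
    show ?thesis using I Read a h th run p t sat
      by (intro exI[of _ "heap c"], cases th)
       (auto simp: exec_def Let_def set_thread_def emit_def set_reg_def flush_def perform_def tick_def nth_append list_update_append e)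
  next
    case (Write x)
    then obtain a v where a: "regs th r = Ptr a" "s (a, i) = Some v" "p' = Suc (pc th)" "R' = (regs th)(d := v)"
        "s' = s((a, i) \<mapsto> regs th x)"
      using st I by (auto split: val.splits)
    from sat a have h: "a < length (heap c)" "(heap c ! a) i = v" by (auto simp: sat_def)
    have dm: "dom s' = dom s" using a by auto
    have st': "sat s' ((heap c)[a := (heap c ! a)(i := regs th x)])"
      using sat a h by (auto simp: sat_def nth_list_update)
    have o: "(b, j) \<notin> dom s \<longrightarrow> ((heap c)[a := (heap c ! a)(i := regs th x)] ! b) j = (heap c ! b) j" for b j
      using a h by (auto simp: nth_list_update)
    show ?thesis using I Write a h th run p t
      by (intro exI[of _ "(heap c)[a := (heap c ! a)(i := regs th x)]"] conjI dm st' allI o; cases th)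
       (auto simp: exec_def Let_def set_thread_def emit_def set_reg_def flush_def perform_def tick_def nth_append list_update_append)
  qed (use st I in auto)
qed

lemma local_step_simple: "local_step i x = Some y \<Longrightarrow> simple_instr i"
  by (cases i; cases x) (auto simp: simple_instr_def)

text \<open>\<open>\<delta>\<close> increases strictly along edges, so with unit weights it bounds
  the weight of paths by their last node. The last conjunct ties it to the clocks \<open>d\<close>:
  when all threads have terminated, these are below the deadlines, hence so is every
  \<open>\<delta> j\<close>.\<close>

definition dag_ok :: "dag \<Rightarrow> (nat \<Rightarrow> nat) \<Rightarrow> (tid \<Rightarrow> nat) \<Rightarrow> nat \<Rightarrow> bool" where
  "dag_ok G \<delta> d N \<longleftrightarrow> (\<forall>j < length G. weight (G ! j) = 1 \<and> (\<forall>i \<in> preds (G ! j). i < j \<and> \<delta> i < \<delta> j) \<and>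
    1 \<le> \<delta> j \<and> (\<exists>t < N. \<delta> j \<le> d t))"

lemma dag_ok_emit:
  assumes "dag_ok G \<delta> d N" "\<forall>i \<in> A. i < length G \<and> \<delta> i < e" "t < N" "N \<le> N'" "d' t = e" "1 \<le> e"
    "\<forall>u < N. d u \<le> d' u"
  shows "dag_ok (G @ [\<lparr>weight = 1, preds = A\<rparr>]) (\<delta>(length G := e)) d' N'"
  unfolding dag_ok_def
proof (intro allI impI)
  fix j assume j: "j < length (G @ [\<lparr>weight = 1, preds = A\<rparr>])"
  show "weight ((G @ [\<lparr>weight = 1, preds = A\<rparr>]) ! j) = 1 \<and>
    (\<forall>i \<in> preds ((G @ [\<lparr>weight = 1, preds = A\<rparr>]) ! j). i < j \<and> (\<delta>(length G := e)) i < (\<delta>(length G := e)) j) \<and>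
    1 \<le> (\<delta>(length G := e)) j \<and> (\<exists>t < N'. (\<delta>(length G := e)) j \<le> d' t)"
  proof (cases "j = length G")
    case True
    then show ?thesis using assms by (auto intro!: exI[of _ t])
  next
    case False
    with j have j': "j < length G" by simp
    with assms(1) obtain u where u: "u < N" "\<delta> j \<le> d u" unfolding dag_ok_def by blast
    have "\<exists>t < N'. \<delta> j \<le> d' t" using u assms(4,7) by (intro exI[of _ u]) (auto intro: order_trans)
    moreover have "length G \<notin> preds (G ! j)" using j' assms(1) by (force simp: dag_ok_def)
    ultimately show ?thesis using j' assms(1) by (auto simp: dag_ok_def nth_append)
  qed
qed

text \<open>Resource transfer at a join: \<open>t\<close> takes over at most what \<open>v\<close>
  owned, and \<open>v\<close> keeps nothing. It is used for cells and for join rights.\<close>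

lemma disjoint_move:
  fixes f g :: "nat \<Rightarrow> 'a set"
  assumes dj: "\<And>x y. x < N \<Longrightarrow> y < N \<Longrightarrow> x \<noteq> y \<Longrightarrow> f x \<inter> f y = {}" and t: "t < N" and v: "v < N" and vt: "v \<noteq> t"
    and g: "\<And>z. g z \<subseteq> (if z = t then f t \<union> f v else if z = v then {} else f z)"
    and xy: "x < N" "y < N" "x \<noteq> y"
  shows "g x \<inter> g y = {}"
proof (rule ccontr)
  assume "g x \<inter> g y \<noteq> {}"
  then obtain e where e: "e \<in> g x" "e \<in> g y" by blast
  have own: "\<exists>p < N. e \<in> f p \<and> z \<noteq> v \<and> (p = z \<or> z = t \<and> p = v)" if "e \<in> g z" "z < N" for z
    using g[of z] that t v vt by (auto split: if_splits)
  from own[OF e(1) xy(1)] own[OF e(2) xy(2)] obtain p q where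
    "p < N" "q < N" "e \<in> f p" "e \<in> f q" "p \<noteq> q" using xy(3) by metis
  with dj[of p q] show False by blast
qed

section \<open>The invariant and its preservation by single instructions\<close>

locale certified =
  fixes P :: program and \<Psi> :: "'k \<Rightarrow> (reg \<Rightarrow> val) \<Rightarrow> store \<Rightarrow> (tid \<rightharpoonup> 'k) \<Rightarrow> nat \<Rightarrow> bool"
    and D :: "'k \<Rightarrow> nat" and S W :: nat and k0 :: 'k
begin

text \<open>
  The ghost state assigns to each thread a role \<open>K\<close>, cells \<open>s\<close>, join rights \<open>T\<close>, work units \<open>w\<close> and a
  depth \<open>d\<close>, and to each node of the DAG a bound \<open>\<delta>\<close> on the weight of the paths that end there.
\<close>

definition thread_inv where
  "thread_inv c K s T w d \<delta> t \<longleftrightarrow>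
    (let th = threads c ! t; N = length (threads c) in
      status th \<in> {Running, Terminated} \<and>
      (status th = Running \<longrightarrow> ok P \<Psi> D S (K t) (pc th) (regs th) (s t) (T t) (w t) (d t)) \<and>
      (status th = Terminated \<longrightarrow> d t \<le> D (K t)) \<and>
      D (K t) \<le> S \<and>
      sat (s t) (heap c) \<and>
      (\<forall>u k. T t u = Some k \<longrightarrow> u < N \<and> u \<noteq> 0 \<and> K u = k) \<and>
      (\<forall>j \<in> deps th. j < length (dag c) \<and> \<delta> j \<le> d t))"

text \<open>The postcondition is kept only for thread 0 and for terminated threads that somebody may
  still join, because a join takes the resources away from the joined thread. The last conjunct is
  an amortization: instructions executed so far plus unspent budget.\<close>

definition config_inv where
  "config_inv c K s T w d \<delta> \<longleftrightarrow>
    (let N = length (threads c) in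
      pending c = [] \<and> 0 < N \<and> K 0 = k0 \<and>
      (\<forall>t < N. thread_inv c K s T w d \<delta> t) \<and>
      (\<forall>t < N. status (threads c ! t) = Terminated \<longrightarrow> (t = 0 \<or> (\<exists>u < N. t \<in> dom (T u))) \<longrightarrow>
         \<Psi> (K t) (regs (threads c ! t)) (s t) (T t) (w t)) \<and>
      (\<forall>t < N. \<forall>u < N. t \<noteq> u \<longrightarrow> dom (s t) \<inter> dom (s u) = {} \<and> dom (T t) \<inter> dom (T u) = {}) \<and>
      dag_ok (dag c) \<delta> d N \<and>
      length (dag c) + (\<Sum>t<N. w t) \<le> W)"

lemma thread_inv_frame:
  assumes "thread_inv c K s T w d \<delta> u" "u < length (threads c)"
    "threads c' ! u = threads c ! u" "length (threads c) \<le> length (threads c')"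
    "\<forall>i < length (threads c). K' i = K i" "s' u = s u" "T' u = T u" "w' u = w u" "d' u = d u"
    "\<forall>j < length (dag c). \<delta>' j = \<delta> j" "length (dag c) \<le> length (dag c')"
    "sat (s u) (heap c')"
  shows "thread_inv c' K' s' T' w' d' \<delta>' u"
  proof -
  have "\<forall>v k. T u v = Some k \<longrightarrow> v < length (threads c')"
    using assms(1,4) by (auto simp: thread_inv_def Let_def dest: order_less_le_trans)
  then show ?thesis using assms unfolding thread_inv_def Let_def by auto
qed

text \<open>What the other threads chosen in the same time step rely on. Cells are guaranteed only
  to running threads, since a join removes those of a terminated one.\<close>

definition preserved where
  "preserved c c' s s' t \<longleftrightarrow>
     length (dag c') = Suc (length (dag c)) \<and> length (heap c') = length (heap c) \<and> length (threads c) \<le> length (threads c') \<and>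
     (\<forall>u < length (threads c). u \<noteq> t \<longrightarrow> threads c' ! u = threads c ! u \<and> 
        (status (threads c ! u) = Running \<longrightarrow> dom (s u :: store) \<subseteq> dom (s' u :: store)))"

text \<open>The conjunct about \<open>pending\<close> is vacuous unless the instruction is an
  \<open>Rmw\<close>. It keeps the requested cell in the ownership of its issuer until the step is
  over, so that all requests of a step concern different cells.\<close>

lemma config_inv_local:
  assumes g: "config_inv c K s T w d \<delta>" and t: "t < length (threads c)" and run: "status (threads c ! t) = Running"
    and w: "0 < w t" and pc: "pc (threads c ! t) < length P"
    and st: "local_step (P ! pc (threads c ! t)) (pc (threads c ! t), regs (threads c ! t), s t) = Some (p', R', s')"
    and ok: "ok P \<Psi> D S (K t) p' R' s' (T t) (w t - 1) (d t + 1)"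
  shows "\<exists>K' s' T' w' d' \<delta>'. config_inv (flush (exec P t c)) K' s' T' w' d' \<delta>' \<and>
     (\<forall>r \<in> set (pending (exec P t c)). req_cell r \<in> dom (s t) \<and> dom (s t) \<subseteq> dom (s' t) \<and> status (threads (flush (exec P t c)) ! t) = Running) \<and>
     preserved c (flush (exec P t c)) s s' t"
proof -
  let ?N = "length (threads c)"
  from g have p: "pending c = []" and ti: "\<And>u. u < ?N \<Longrightarrow> thread_inv c K s T w d \<delta> u"
    and dj: "\<And>u v. u < ?N \<Longrightarrow> v < ?N \<Longrightarrow> u \<noteq> v \<Longrightarrow> dom (s u) \<inter> dom (s v) = {} \<and> dom (T u) \<inter> dom (T v) = {}"
    and dg: "dag_ok (dag c) \<delta> d ?N" and W: "length (dag c) + (\<Sum>t<?N. w t) \<le> W"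
    and ps: "\<And>u. u < ?N \<Longrightarrow> status (threads c ! u) = Terminated \<Longrightarrow> (u = 0 \<or> (\<exists>v < ?N. u \<in> dom (T v))) \<Longrightarrow>
         \<Psi> (K u) (regs (threads c ! u)) (s u) (T u) (w u)"
    and k0: "K 0 = k0" "0 < ?N"
    by (auto simp: config_inv_def Let_def)
  from ti[OF t] have sat: "sat (s t) (heap c)" by (simp add: thread_inv_def Let_def)
  let ?c = "flush (exec P t c)"
  from exec_local[OF p t refl run sat st] obtain H where
    c: "?c = c\<lparr>heap := H, threads := (threads c)[t := (threads c ! t)\<lparr>pc := p', regs := R', deps := {length (dag c)}\<rparr>],
          dag := dag c @ [\<lparr>weight = 1, preds = deps (threads c ! t)\<rparr>]\<rparr>"
    and H: "length H = length (heap c)" "dom s' = dom (s t)" "sat s' H"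
      "\<And>a i. (a, i) \<notin> dom (s t) \<Longrightarrow> (H ! a) i = (heap c ! a) i"
      "\<forall>r \<in> set (pending (exec P t c)). req_cell r \<in> dom (s t)" by blast
  let ?\<delta> = "\<delta>(length (dag c) := d t + 1)"
  have oth: "thread_inv ?c K (s(t := s')) T (w(t := w t - 1)) (d(t := d t + 1)) ?\<delta> u" if u: "u < ?N" "u \<noteq> t" for u
  proof (rule thread_inv_frame[OF ti[OF u(1)] u(1)])
    show "sat (s u) (heap ?c)" unfolding sat_def
    proof (intro allI impI)
      fix a i v assume su: "s u (a, i) = Some v"
      with ti[OF u(1)] have "a < length (heap c) \<and> (heap c ! a) i = v" by (auto simp: thread_inv_def Let_def sat_def)
      moreover have "(a, i) \<notin> dom (s t)" using dj[OF u(1) t u(2)] su by auto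
      ultimately show "a < length (heap ?c) \<and> (heap ?c ! a) i = v" using H unfolding c by auto
    qed
  qed (use u in \<open>auto simp: c\<close>)
  have self: "thread_inv ?c K (s(t := s')) T (w(t := w t - 1)) (d(t := d t + 1)) ?\<delta> t"
    using ti[OF t] t run ok H(3) unfolding thread_inv_def Let_def c by auto
  have dk: "dag_ok (dag ?c) ?\<delta> (d(t := d t + 1)) ?N"
  proof -
    have "dag_ok (dag c @ [\<lparr>weight = 1, preds = deps (threads c ! t)\<rparr>]) ?\<delta> (d(t := d t + 1)) ?N"
      by (rule dag_ok_emit[OF dg, where t = t]) (use ti[OF t] t in \<open>auto simp: thread_inv_def Let_def less_Suc_eq_le\<close>)
    then show ?thesis by (simp add: c)
  qed
  have "(\<Sum>u<?N. (w(t := w t - 1)) u) + 1 = (\<Sum>u<?N. w u)"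
    using t w by (simp add: sum.remove[of "{..<?N}" t])
  then have WW: "length (dag ?c) + (\<Sum>u<?N. (w(t := w t - 1)) u) \<le> W" using W unfolding c by simp
  have N: "length (threads ?c) = ?N" by (simp add: c)
  have "config_inv ?c K (s(t := s')) T (w(t := w t - 1)) (d(t := d t + 1)) ?\<delta>"
    unfolding config_inv_def Let_def N
  proof (intro conjI allI impI)
    fix u assume "u < ?N"
    then show "thread_inv ?c K (s(t := s')) T (w(t := w t - 1)) (d(t := d t + 1)) ?\<delta> u" using oth self by (cases "u = t") auto
  next
    fix u assume u: "u < ?N" "status (threads ?c ! u) = Terminated" "u = 0 \<or> (\<exists>v < ?N. u \<in> dom (T v))"
    have "u \<noteq> t" using u(2) t run by (auto simp: c)
    then show "\<Psi> (K u) (regs (threads ?c ! u)) ((s(t := s')) u) (T u) ((w(t := w t - 1)) u)"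
      using u ps[of u] by (auto simp: c)
  next
    show "dag_ok (dag ?c) ?\<delta> (d(t := d t + 1)) ?N" using dk by simp
  next
    show "length (dag ?c) + (\<Sum>u<?N. (w(t := w t - 1)) u) \<le> W" using WW by simp
  qed (use dj H(2) k0 in \<open>auto\<close>)
  moreover have "preserved c ?c s (s(t := s')) t" unfolding preserved_def by (auto simp: c H)
  moreover have "status (threads ?c ! t) = Running" using run t by (simp add: c)
  ultimately show ?thesis using H(2,5) by (intro exI conjI; (assumption)?) auto
qed

lemma config_inv_terminate:
  assumes g: "config_inv c K s T w d \<delta>" and t: "t < length (threads c)" and run: "status (threads c ! t) = Running"
    and w: "0 < w t" 
    and st: "P ! pc (threads c ! t) = Terminate"
    and ok: "\<Psi> (K t) (regs (threads c ! t)) (s t) (T t) (w t - 1)" and dl: "d t + 1 \<le> D (K t)"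
  shows "\<exists>K' s' T' w' d' \<delta>'. config_inv (flush (exec P t c)) K' s' T' w' d' \<delta>' \<and>
     (\<forall>r \<in> set (pending (exec P t c)). req_cell r \<in> dom (s t) \<and> dom (s t) \<subseteq> dom (s' t) \<and> status (threads (flush (exec P t c)) ! t) = Running) \<and>
     preserved c (flush (exec P t c)) s s' t"
proof -
  let ?N = "length (threads c)"
  from g have p: "pending c = []" and ti: "\<And>u. u < ?N \<Longrightarrow> thread_inv c K s T w d \<delta> u"
    and dj: "\<And>u v. u < ?N \<Longrightarrow> v < ?N \<Longrightarrow> u \<noteq> v \<Longrightarrow> dom (s u) \<inter> dom (s v) = {} \<and> dom (T u) \<inter> dom (T v) = {}"
    and dg: "dag_ok (dag c) \<delta> d ?N" and W: "length (dag c) + (\<Sum>t<?N. w t) \<le> W"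
    and ps: "\<And>u. u < ?N \<Longrightarrow> status (threads c ! u) = Terminated \<Longrightarrow> (u = 0 \<or> (\<exists>v < ?N. u \<in> dom (T v))) \<Longrightarrow>
         \<Psi> (K u) (regs (threads c ! u)) (s u) (T u) (w u)"
    and k0: "K 0 = k0" "0 < ?N"
    by (auto simp: config_inv_def Let_def)
  let ?c = "flush (exec P t c)"
  have pe: "pending (exec P t c) = []" using st p by (simp add: exec_def Let_def set_thread_def emit_def)
  have c: "?c = c\<lparr>threads := (threads c)[t := (threads c ! t)\<lparr>pc := Suc (pc (threads c ! t)), deps := {length (dag c)}, status := Terminated\<rparr>],
          dag := dag c @ [\<lparr>weight = 1, preds = deps (threads c ! t)\<rparr>]\<rparr>"
    using st p pe by (simp add: flush_no_pending) (simp add: exec_def Let_def set_thread_def emit_def)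
  let ?\<delta> = "\<delta>(length (dag c) := d t + 1)"
  have oth: "thread_inv ?c K s T (w(t := w t - 1)) (d(t := d t + 1)) ?\<delta> u" if u: "u < ?N" "u \<noteq> t" for u
    by (rule thread_inv_frame[OF ti[OF u(1)] u(1)]) (use u ti[OF u(1)] in \<open>auto simp: c thread_inv_def Let_def\<close>)
  have self: "thread_inv ?c K s T (w(t := w t - 1)) (d(t := d t + 1)) ?\<delta> t"
    using ti[OF t] t run dl unfolding thread_inv_def Let_def c by auto
  have dk: "dag_ok (dag ?c) ?\<delta> (d(t := d t + 1)) ?N"
  proof -
    have "dag_ok (dag c @ [\<lparr>weight = 1, preds = deps (threads c ! t)\<rparr>]) ?\<delta> (d(t := d t + 1)) ?N"
      by (rule dag_ok_emit[OF dg, where t = t]) (use ti[OF t] t in \<open>auto simp: thread_inv_def Let_def less_Suc_eq_le\<close>)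
    then show ?thesis by (simp add: c)
  qed
  have "(\<Sum>u<?N. (w(t := w t - 1)) u) + 1 = (\<Sum>u<?N. w u)"
    using t w by (simp add: sum.remove[of "{..<?N}" t])
  then have WW: "length (dag ?c) + (\<Sum>u<?N. (w(t := w t - 1)) u) \<le> W" using W unfolding c by simp
  have N: "length (threads ?c) = ?N" by (simp add: c)
  have "config_inv ?c K s T (w(t := w t - 1)) (d(t := d t + 1)) ?\<delta>"
    unfolding config_inv_def Let_def N
  proof (intro conjI allI impI)
    fix u assume "u < ?N"
    then show "thread_inv ?c K s T (w(t := w t - 1)) (d(t := d t + 1)) ?\<delta> u" using oth self by (cases "u = t") auto
  next
    fix u assume u: "u < ?N" "status (threads ?c ! u) = Terminated" "u = 0 \<or> (\<exists>v < ?N. u \<in> dom (T v))"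
    then show "\<Psi> (K u) (regs (threads ?c ! u)) (s u) (T u) ((w(t := w t - 1)) u)"
      using u ps[of u] ok t by (cases "u = t") (auto simp: c)
  next
    show "dag_ok (dag ?c) ?\<delta> (d(t := d t + 1)) ?N" using dk by simp
  next
    show "length (dag ?c) + (\<Sum>u<?N. (w(t := w t - 1)) u) \<le> W" using WW by simp
  qed (use dj k0 in \<open>auto\<close>)
  moreover have "preserved c ?c s s t" unfolding preserved_def by (auto simp: c)
  ultimately show ?thesis using pe by (intro exI conjI; (assumption)?) auto
qed

lemma config_inv_fork:
  assumes g: "config_inv c K s T w d \<delta>" and t: "t < length (threads c)" and run: "status (threads c ! t) = Running"
    and st: "P ! pc (threads c ! t) = Fork r l" and w: "w1 + w2 < w t" and dk': "D k' \<le> S"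
    and ok1: "ok P \<Psi> D S k' l (regs (threads c ! t)) (s t |` X) (T t |` Y) w1 (d t + 1)"
    and ok2: "\<And>u. u \<notin> dom (T t) \<Longrightarrow> ok P \<Psi> D S (K t) (Suc (pc (threads c ! t))) ((regs (threads c ! t))(r := Thr u))
       (s t |` (- X)) ((T t |` (- Y))(u \<mapsto> k')) w2 (d t + 1)"
  shows "\<exists>K' s' T' w' d' \<delta>'. config_inv (flush (exec P t c)) K' s' T' w' d' \<delta>' \<and>
     (\<forall>r \<in> set (pending (exec P t c)). req_cell r \<in> dom (s t) \<and> dom (s t) \<subseteq> dom (s' t) \<and> status (threads (flush (exec P t c)) ! t) = Running) \<and>
     preserved c (flush (exec P t c)) s s' t"
proof -
  let ?N = "length (threads c)"
  from g have p: "pending c = []" and ti: "\<And>u. u < ?N \<Longrightarrow> thread_inv c K s T w d \<delta> u"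
    and dj: "\<And>u v. u < ?N \<Longrightarrow> v < ?N \<Longrightarrow> u \<noteq> v \<Longrightarrow> dom (s u) \<inter> dom (s v) = {} \<and> dom (T u) \<inter> dom (T v) = {}"
    and dg: "dag_ok (dag c) \<delta> d ?N" and W: "length (dag c) + (\<Sum>t<?N. w t) \<le> W"
    and ps: "\<And>u. u < ?N \<Longrightarrow> status (threads c ! u) = Terminated \<Longrightarrow> (u = 0 \<or> (\<exists>v < ?N. u \<in> dom (T v))) \<Longrightarrow>
         \<Psi> (K u) (regs (threads c ! u)) (s u) (T u) (w u)"
    and k0: "K 0 = k0" "0 < ?N"
    by (auto simp: config_inv_def Let_def)
  let ?c = "flush (exec P t c)"
  have pe: "pending (exec P t c) = []" using st p by (simp add: exec_def Let_def set_thread_def emit_def)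
  have c: "?c = c\<lparr>threads := (threads c)[t := (threads c ! t)\<lparr>pc := Suc (pc (threads c ! t)),
            deps := {length (dag c)}, regs := (regs (threads c ! t))(r := Thr ?N)\<rparr>] @
             [\<lparr>status = Running, pc = l, regs = regs (threads c ! t), deps = {length (dag c)}\<rparr>],
          dag := dag c @ [\<lparr>weight = 1, preds = deps (threads c ! t)\<rparr>]\<rparr>"
    using st p pe by (simp add: flush_no_pending) (cases "threads c ! t"; simp add: exec_def Let_def set_thread_def emit_def set_reg_def)
  define \<delta>' where "\<delta>' = \<delta>(length (dag c) := d t + 1)"
  define K' where "K' = K(?N := k')"
  define s' where "s' = s(t := s t |` (- X), ?N := s t |` X)"
  define T' where "T' = T(t := (T t |` (- Y))(?N \<mapsto> k'), ?N := T t |` Y)"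
  define w' where "w' = w(t := w2, ?N := w1)"
  define d' where "d' = d(t := d t + 1, ?N := d t + 1)"
  note defs = \<delta>'_def K'_def s'_def T'_def w'_def d'_def
  have Tlt: "v < ?N \<and> v \<noteq> 0 \<and> K v = k" if "u < ?N" "T u v = Some k" for u v k
    using ti[OF that(1)] that by (auto simp: thread_inv_def Let_def)
  have notdom: "?N \<notin> dom (T u)" if "u < ?N" for u using Tlt[OF that] by force
  have oth: "thread_inv ?c K' s' T' w' d' \<delta>' u" if u: "u < ?N" "u \<noteq> t" for u
    by (rule thread_inv_frame[OF ti[OF u(1)] u(1)])
       (use u ti[OF u(1)] in \<open>auto simp: c nth_append thread_inv_def Let_def defs\<close>)
  have self: "thread_inv ?c K' s' T' w' d' \<delta>' t"
    using ti[OF t] t run ok2[OF notdom[OF t]] Tlt[OF t] unfolding thread_inv_def Let_def c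
    by (auto simp: defs nth_append sat_def restrict_map_def less_Suc_eq split: if_splits)
  have new: "thread_inv ?c K' s' T' w' d' \<delta>' ?N"
    using ti[OF t] t run ok1 dk' Tlt[OF t] unfolding thread_inv_def Let_def c
    by (auto simp: defs nth_append sat_def restrict_map_def less_Suc_eq split: if_splits)
  have dk: "dag_ok (dag ?c) \<delta>' d' (Suc ?N)"
  proof -
    have "dag_ok (dag c @ [\<lparr>weight = 1, preds = deps (threads c ! t)\<rparr>]) \<delta>' d' (Suc ?N)"
      unfolding \<delta>'_def
      by (rule dag_ok_emit[OF dg, where t = t]) (use ti[OF t] t in \<open>auto simp: thread_inv_def Let_def less_Suc_eq_le d'_def\<close>)
    then show ?thesis by (simp add: c)
  qed
  have "(\<Sum>u<Suc ?N. w' u) = (\<Sum>u<?N. (w(t := w2)) u) + w1" by (simp add: w'_def)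
  also have "(\<Sum>u<?N. (w(t := w2)) u) + w t = (\<Sum>u<?N. w u) + w2"
    using t by (simp add: sum.remove[of "{..<?N}" t])
  then have "(\<Sum>u<?N. (w(t := w2)) u) + w1 + 1 \<le> (\<Sum>u<?N. w u)" using w by linarith
  finally have WW: "length (dag ?c) + (\<Sum>u<Suc ?N. w' u) \<le> W" using W unfolding c by simp
  have N: "length (threads ?c) = Suc ?N" by (simp add: c)
  have "config_inv ?c K' s' T' w' d' \<delta>'"
    unfolding config_inv_def Let_def N
  proof (intro conjI allI impI)
    fix u assume "u < Suc ?N"
    then show "thread_inv ?c K' s' T' w' d' \<delta>' u" using oth self new less_SucE by metis
  next
    fix u assume u: "u < Suc ?N" "status (threads ?c ! u) = Terminated" "u = 0 \<or> (\<exists>v < Suc ?N. u \<in> dom (T' v))"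
    have ut: "u \<noteq> t" "u \<noteq> ?N" using u(2) t run by (auto simp: c nth_append)
    then have "u = 0 \<or> (\<exists>v < ?N. u \<in> dom (T v))" using u(3) t
      by (auto simp: T'_def restrict_map_def less_Suc_eq split: if_splits)
    then show "\<Psi> (K' u) (regs (threads ?c ! u)) (s' u) (T' u) (w' u)"
      using u ps[of u] ut by (auto simp: c nth_append defs)
  next
    fix u v assume uv: "u < Suc ?N" "v < Suc ?N" "u \<noteq> v"
    have A: "z < Suc ?N \<Longrightarrow> z \<noteq> t \<Longrightarrow> z \<noteq> ?N \<Longrightarrow> dom (s' z) = dom (s z) \<and> dom (T' z) = dom (T z) \<and> ?N \<notin> dom (T z) \<and>
        dom (s t) \<inter> dom (s z) = {} \<and> dom (T t) \<inter> dom (T z) = {}"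
      "dom (s' t) = dom (s t) - X" "dom (s' ?N) = dom (s t) \<inter> X"
      "dom (T' t) = insert ?N (dom (T t) - Y)" "dom (T' ?N) = dom (T t) \<inter> Y" "?N \<notin> dom (T t)" for z
      using t notdom[of z] notdom[OF t] dj[OF t, of z] by (auto simp: s'_def T'_def)
    consider "u = t" "v = ?N" | "u = ?N" "v = t" | "u = t" "v \<noteq> t" "v \<noteq> ?N" | "u = ?N" "v \<noteq> t" "v \<noteq> ?N"
      | "v = t" "u \<noteq> t" "u \<noteq> ?N" | "v = ?N" "u \<noteq> t" "u \<noteq> ?N" | "u \<noteq> t" "u \<noteq> ?N" "v \<noteq> t" "v \<noteq> ?N" "u < ?N" "v < ?N"
      using uv by linarith
    then have "dom (s' u) \<inter> dom (s' v) = {} \<and> dom (T' u) \<inter> dom (T' v) = {}"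
    proof cases
      case 7
      then show ?thesis using A(1)[OF uv(1)] A(1)[OF uv(2)] dj[of u v] uv by simp
    qed (use A(1)[OF uv(1)] A(1)[OF uv(2)] A(2-6) in \<open>(simp, blast)+\<close>)
    then show "dom (s' u) \<inter> dom (s' v) = {}" "dom (T' u) \<inter> dom (T' v) = {}" by blast+
  next
    show "dag_ok (dag ?c) \<delta>' d' (Suc ?N)" using dk by simp
  next
    show "length (dag ?c) + (\<Sum>u<Suc ?N. w' u) \<le> W" using WW by simp
  qed (use k0 in \<open>auto simp: K'_def\<close>)
  moreover have "preserved c ?c s s' t" unfolding preserved_def by (auto simp: c nth_append s'_def)
  ultimately show ?thesis using pe by (intro exI conjI; (assumption)?) auto
qed

lemma config_inv_join:
  assumes g: "config_inv c K s T w d \<delta>" and t: "t < length (threads c)" and run: "status (threads c ! t) = Running"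
    and st: "P ! pc (threads c ! t) = Join r" and w: "0 < w t" 
    and v: "regs (threads c ! t) r = Thr v" "T t v = Some k'" and tmd: "status (threads c ! v) = Terminated"
    and ok: "\<And>R' s' T' w'. \<lbrakk>\<Psi> k' R' s' T' w'; dom (s t) \<inter> dom s' = {}; dom (T t) \<inter> dom T' = {}\<rbrakk> \<Longrightarrow>
      ok P \<Psi> D S (K t) (Suc (pc (threads c ! t))) (regs (threads c ! t)) (s t ++ s') ((T t)(v := None) ++ T')
        (w t - 1 + w') (max (d t) (D k') + 1)"
  shows "\<exists>K' s' T' w' d' \<delta>'. config_inv (flush (exec P t c)) K' s' T' w' d' \<delta>' \<and>
     (\<forall>r \<in> set (pending (exec P t c)). req_cell r \<in> dom (s t) \<and> dom (s t) \<subseteq> dom (s' t) \<and> status (threads (flush (exec P t c)) ! t) = Running) \<and>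
     preserved c (flush (exec P t c)) s s' t"
proof -
  let ?N = "length (threads c)"
  from g have p: "pending c = []" and ti: "\<And>u. u < ?N \<Longrightarrow> thread_inv c K s T w d \<delta> u"
    and dj: "\<And>u v. u < ?N \<Longrightarrow> v < ?N \<Longrightarrow> u \<noteq> v \<Longrightarrow> dom (s u) \<inter> dom (s v) = {} \<and> dom (T u) \<inter> dom (T v) = {}"
    and dg: "dag_ok (dag c) \<delta> d ?N" and W: "length (dag c) + (\<Sum>t<?N. w t) \<le> W"
    and ps: "\<And>u. u < ?N \<Longrightarrow> status (threads c ! u) = Terminated \<Longrightarrow> (u = 0 \<or> (\<exists>v < ?N. u \<in> dom (T v))) \<Longrightarrow>
         \<Psi> (K u) (regs (threads c ! u)) (s u) (T u) (w u)"
    and k0: "K 0 = k0" "0 < ?N"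
    by (auto simp: config_inv_def Let_def)
  have Tlt: "v < ?N \<and> v \<noteq> 0 \<and> K v = k" if "u < ?N" "T u v = Some k" for u v k
    using ti[OF that(1)] that by (auto simp: thread_inv_def Let_def)
  have vN: "v < ?N" "v \<noteq> 0" "K v = k'" using Tlt[OF t v(2)] by auto
  have vt: "v \<noteq> t" using tmd run by auto
  let ?c = "flush (exec P t c)"
  have pe: "pending (exec P t c) = []" using st p by (simp add: exec_def Let_def set_thread_def emit_def)
  have c: "?c = c\<lparr>threads := (threads c)[t := (threads c ! t)\<lparr>pc := Suc (pc (threads c ! t)),
            deps := {length (dag c)}\<rparr>],
          dag := dag c @ [\<lparr>weight = 1, preds = deps (threads c ! t) \<union> deps (threads c ! v)\<rparr>]\<rparr>"
    using st p pe v by (simp add: flush_no_pending) (simp add: exec_def Let_def set_thread_def emit_def set_reg_def)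
  define e where "e = max (d t) (D k') + 1"
  define \<delta>' where "\<delta>' = \<delta>(length (dag c) := e)"
  define s' where "s' = s(t := s t ++ s v, v := Map.empty)"
  define T' where "T' = T(t := (T t)(v := None) ++ T v, v := Map.empty)"
  define w' where "w' = w(t := w t - 1 + w v, v := 0)"
  define d' where "d' = d(t := e)"
  note defs = \<delta>'_def s'_def T'_def w'_def d'_def
  have dtv: "dom (s t) \<inter> dom (s v) = {}" "dom (T t) \<inter> dom (T v) = {}" using dj[of t v] t vN vt by auto
  have \<Psi>v: "\<Psi> k' (regs (threads c ! v)) (s v) (T v) (w v)"
    using ps[OF vN(1) tmd] v t vN by auto
  have dv: "d v \<le> D k'" using ti[OF vN(1)] tmd vN by (auto simp: thread_inv_def Let_def)
  have oth: "thread_inv ?c K s' T' w' d' \<delta>' u" if u: "u < ?N" "u \<noteq> t" "u \<noteq> v" for u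
    by (rule thread_inv_frame[OF ti[OF u(1)] u(1)])
       (use u ti[OF u(1)] in \<open>auto simp: c nth_append thread_inv_def Let_def defs\<close>)
  have self: "thread_inv ?c K s' T' w' d' \<delta>' t"
    using ti[OF t] t run vt ok[OF \<Psi>v dtv] Tlt[OF t] Tlt[OF vN(1)] ti[OF vN(1)] unfolding thread_inv_def Let_def c
    by (auto simp: defs sat_def e_def split: if_splits)
  have "\<forall>j \<in> deps (threads c ! v). j < length (dag c) \<and> \<delta> j \<le> d v" "D k' \<le> S"
    using ti[OF vN(1)] vN(3) by (auto simp: thread_inv_def Let_def)
  then have vv: "thread_inv ?c K s' T' w' d' \<delta>' v"
    unfolding thread_inv_def Let_def c using vt tmd dv vN(3) by (auto simp: defs sat_def)
  have dk: "dag_ok (dag ?c) \<delta>' d' ?N"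
  proof -
    have "dag_ok (dag c @ [\<lparr>weight = 1, preds = deps (threads c ! t) \<union> deps (threads c ! v)\<rparr>]) \<delta>' d' ?N"
      unfolding \<delta>'_def
      by (rule dag_ok_emit[OF dg, where t = t])
         (use ti[OF t] t ti[OF vN(1)] dv in \<open>force simp: thread_inv_def Let_def less_Suc_eq_le d'_def e_def\<close>)+
    then show ?thesis by (simp add: c)
  qed
  have "(\<Sum>u<?N. w' u) + 1 = (\<Sum>u<?N. w u)"
  proof -
    have fin: "finite {..<?N}" "t \<in> {..<?N}" "v \<in> {..<?N} - {t}" using t vN vt by auto
    have "sum x {..<?N} = x t + (x v + sum x ({..<?N} - {t} - {v}))" for x :: "nat \<Rightarrow> nat"
      using fin by (simp add: sum.remove)
    from this[of w'] this[of w] show ?thesis using w vt by (simp add: w'_def)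
  qed
  then have WW: "length (dag ?c) + (\<Sum>u<?N. w' u) \<le> W" using W unfolding c by simp
  have N: "length (threads ?c) = ?N" by (simp add: c)
  have "config_inv ?c K s' T' w' d' \<delta>'"
    unfolding config_inv_def Let_def N
  proof (intro conjI allI impI)
    fix u assume "u < ?N"
    then have un: "u < ?N" .
    show "thread_inv ?c K s' T' w' d' \<delta>' u"
    proof (cases "u = t")
      case True
      show ?thesis unfolding True by (rule self)
    next
      case ut: False
      show ?thesis
      proof (cases "u = v")
        case True
        show ?thesis unfolding True by (rule vv)
      next
        case False
        show ?thesis using un ut False by (rule oth)
      qed
    qed
  next
    fix u assume u: "u < ?N" "status (threads ?c ! u) = Terminated" "u = 0 \<or> (\<exists>x < ?N. u \<in> dom (T' x))"
    have ut: "u \<noteq> t" using u(2) t run by (auto simp: c nth_append)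
    \<comment> \<open>The right to join \<open>v\<close> was held by \<open>t\<close> alone and is
      consumed here. It cannot return among the rights inherited from \<open>v\<close>, which are
      disjoint from those of \<open>t\<close>.\<close>
    have "u \<noteq> v"
    proof
      assume uv: "u = v"
      with u(3) vN obtain x where x: "x < ?N" "v \<in> dom (T' x)" by auto
      then have "x \<noteq> t" using vt dtv(2) v(2) unfolding T'_def by (auto split: if_splits)
      with x have "x \<noteq> v" "v \<in> dom (T x)" unfolding T'_def by (auto split: if_splits)
      with dj[of x t] x t \<open>x \<noteq> t\<close> v(2) show False by auto
    qed
    moreover have "u = 0 \<or> (\<exists>x < ?N. u \<in> dom (T x))" using u(3) t vN
      unfolding T'_def by (auto split: if_splits)
    ultimately show "\<Psi> (K u) (regs (threads ?c ! u)) (s' u) (T' u) (w' u)"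
      using u ps[of u] ut by (auto simp: c defs)
  next
    fix x y assume xy: "x < ?N" "y < ?N" "x \<noteq> y"
    have dS: "\<And>x y. x < ?N \<Longrightarrow> y < ?N \<Longrightarrow> x \<noteq> y \<Longrightarrow> dom (s x) \<inter> dom (s y) = {}"
      and dT: "\<And>x y. x < ?N \<Longrightarrow> y < ?N \<Longrightarrow> x \<noteq> y \<Longrightarrow> dom (T x) \<inter> dom (T y) = {}"
      using dj by simp_all
    have "dom (s' z) \<subseteq> (if z = t then dom (s t) \<union> dom (s v) else if z = v then {} else dom (s z))" for z
      unfolding s'_def by simp
    from disjoint_move[of ?N "\<lambda>z. dom (s z)" t v "\<lambda>z. dom (s' z)", OF dS t vN(1) vt this xy]
    show "dom (s' x) \<inter> dom (s' y) = {}" by simp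
    have "dom (T' z) \<subseteq> (if z = t then dom (T t) \<union> dom (T v) else if z = v then {} else dom (T z))" for z
      unfolding T'_def by (simp, blast)
    from disjoint_move[of ?N "\<lambda>z. dom (T z)" t v "\<lambda>z. dom (T' z)", OF dT t vN(1) vt this xy]
    show "dom (T' x) \<inter> dom (T' y) = {}" by simp
  next
    show "dag_ok (dag ?c) \<delta>' d' ?N" using dk by simp
  next
    show "length (dag ?c) + (\<Sum>u<?N. w' u) \<le> W" using WW by simp
  qed (use k0 in \<open>auto\<close>)
  moreover have "preserved c ?c s s' t" unfolding preserved_def using tmd by (auto simp: c s'_def)
  ultimately show ?thesis using pe by (intro exI conjI; (assumption)?) auto
qed

lemma config_inv_exec:
  assumes g: "config_inv c K s T w d \<delta>" and rd: "ready P c t"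
  shows "simple_instr (P ! pc (threads c ! t)) \<and> (\<exists>K' s' T' w' d' \<delta>'. config_inv (flush (exec P t c)) K' s' T' w' d' \<delta>' \<and>
     (\<forall>r \<in> set (pending (exec P t c)). req_cell r \<in> dom (s t) \<and> dom (s t) \<subseteq> dom (s' t) \<and> status (threads (flush (exec P t c)) ! t) = Running) \<and>
     preserved c (flush (exec P t c)) s s' t)"
proof -
  have t: "t < length (threads c)" and run: "status (threads c ! t) = Running" 
    using rd by (auto simp: ready_def Let_def)
  have "ok P \<Psi> D S (K t) (pc (threads c ! t)) (regs (threads c ! t)) (s t) (T t) (w t) (d t)"
    using g t run by (auto simp: config_inv_def thread_inv_def Let_def)
  then show ?thesis
  proof cases
    case (local p' R' s')
    then show ?thesis using config_inv_local[OF g t run local(2,1,3,4)] local_step_simple[OF local(3)] by blast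
  next
    case (fork r l w1 w2 k' X Y)
    then show ?thesis using config_inv_fork[OF g t run fork(2,3,4,5,6)] by (auto simp: simple_instr_def)
  next
    case (join r u k')
    have "status (threads c ! u) = Terminated" using rd join by (auto simp: ready_def Let_def)
    from config_inv_join[OF g t run join(2,3,4,5) this join(7)]
    have "\<exists>K' s' T' w' d' \<delta>'. config_inv (flush (exec P t c)) K' s' T' w' d' \<delta>' \<and>
     (\<forall>r \<in> set (pending (exec P t c)). req_cell r \<in> dom (s t) \<and> dom (s t) \<subseteq> dom (s' t) \<and> status (threads (flush (exec P t c)) ! t) = Running) \<and>
     preserved c (flush (exec P t c)) s s' t" .
    moreover have "simple_instr (P ! pc (threads c ! t))" by (simp add: simple_instr_def join(2))
    ultimately show ?thesis by blast
  next
    case terminate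
    then show ?thesis using config_inv_terminate[OF g t run terminate(3,2,4,5)] by (auto simp: simple_instr_def)
  qed
qed

section \<open>Serialization of a time step\<close>

text \<open>Readiness is tested at the beginning of a step, but the instructions are executed one
  after another. Only a \<open>Join\<close> looks at the state of another thread; that thread has
  terminated, so it is not \<open>t\<close>, which is running.\<close>

lemma ready_preserved:
  assumes "ready P c u" "u \<noteq> t" "preserved c c' s s' t" "ready P c t"
  shows "ready P c' u"
proof -
  have p: "length (heap c') = length (heap c)" "length (threads c) \<le> length (threads c')"
     "\<And>u. u < length (threads c) \<Longrightarrow> u \<noteq> t \<Longrightarrow> threads c' ! u = threads c ! u"
    using assms(3) by (auto simp: preserved_def)
  have t: "status (threads c ! t) \<noteq> Terminated" using assms(4) by (auto simp: ready_def Let_def)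
  have u: "u < length (threads c)" using assms(1) by (auto simp: ready_def)
  show ?thesis
  proof (cases "P ! pc (threads c ! u)")
    case (Join r)
    let ?v = "the_tid (regs (threads c ! u) r)"
    have v: "?v < length (threads c)" "status (threads c ! ?v) = Terminated"
      using assms(1) Join by (auto simp: ready_def Let_def)
    then have "?v \<noteq> t" using t by auto
    then show ?thesis using assms(1) Join p(1,2) p(3)[OF u assms(2)] p(3)[OF v(1)] u
      by (auto simp: ready_def Let_def)
  qed (use assms(1) p(1,2) p(3)[OF u assms(2)] u in \<open>auto simp: ready_def Let_def\<close>)
qed

text \<open>The invariant speaks about \<open>flush c\<close>, as if each request were served
  immediately, while the real configuration \<open>c\<close> still holds the requests of this step;
  \<open>flush_exec\<close> allows the next instruction to be run on either. Requests stay on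
  distinct cells because each cell is owned by its issuer and the issuers are different
  threads.\<close>

lemma config_inv_fold_exec:
  assumes "config_inv (flush c) K s T w d \<delta>" "reqs_ok c" "distinct (map req_cell (pending c))"
    "\<forall>r \<in> set (pending c). req_cell r \<in> dom (s (req_thread r)) \<and> status (threads (flush c) ! req_thread r) = Running"
    "distinct ts" "\<forall>t \<in> set ts. ready P (flush c) t \<and> t \<notin> req_thread ` set (pending c)"
  shows "\<exists>K' s' T' w' d' \<delta>'. config_inv (flush (fold (exec P) ts c)) K' s' T' w' d' \<delta>' \<and>
    distinct (map req_cell (pending (fold (exec P) ts c))) \<and> length (dag (fold (exec P) ts c)) = length (dag c) + length ts"
  using assms
proof (induction ts arbitrary: c K s T w d \<delta>)
  case Nil
  then show ?case by simp blast
next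
  case (Cons t ts)
  note g = Cons.prems(1) and rq = Cons.prems(2) and dc = Cons.prems(3) and ow = Cons.prems(4)
  let ?c = "exec P t c"
  have rd: "ready P (flush c) t" and tn: "t \<notin> req_thread ` set (pending c)" using Cons.prems(6) by auto
  have tht: "threads (flush c) ! t = threads c ! t" using tn by (rule flush_threads_other)
  from config_inv_exec[OF g rd] obtain K' s' T' w' d' \<delta>' where simp': "simple_instr (P ! pc (threads c ! t))"
    and g': "config_inv (flush (exec P t (flush c))) K' s' T' w' d' \<delta>'"
    and own': "\<forall>r \<in> set (pending (exec P t (flush c))). req_cell r \<in> dom (s t) \<and> dom (s t) \<subseteq> dom (s' t) \<and>
        status (threads (flush (exec P t (flush c))) ! t) = Running"
    and pr: "preserved (flush c) (flush (exec P t (flush c))) s s' t" unfolding tht by blast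
  have fe: "flush ?c = flush (exec P t (flush c))" using flush_exec[OF tn simp' rq] .
  let ?n = "new_reqs P t c"
  have pe: "pending ?c = pending c @ ?n" by (rule pending_exec[OF simp'])
  have nn: "pending (exec P t (flush c)) = ?n"
  proof -
    have "pending (exec P t (flush c)) = new_reqs P t (flush c)" using pending_exec[of P "flush c" t] simp' tht by simp
    also have "\<dots> = ?n" unfolding new_reqs_def by (rule pending_exec_cong) (simp_all add: tht)
    finally show ?thesis .
  qed
  have lt: "t < length (threads c)" using rd by (auto simp: ready_def)
  have len: "length (threads c) \<le> length (threads ?c)" "length (dag ?c) = Suc (length (dag c))"
    using pr fe flush_simps(2,3)[of "?c"] by (auto simp: preserved_def)
  have nreq: "req_thread r = t" "req_node r = length (dag c)" if "r \<in> set ?n" for r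
    using new_reqs_cases[of P t c] that by auto
  have rq': "reqs_ok ?c" unfolding reqs_ok_def pe using rq len lt nreq by (fastforce simp: reqs_ok_def)
  have keep: "threads (flush ?c) ! u = threads (flush c) ! u" "dom (s u) \<subseteq> dom (s' u)"
    if "u < length (threads c)" "u \<noteq> t" "status (threads (flush c) ! u) = Running" for u
    using pr that unfolding fe by (auto simp: preserved_def)
  have rlt: "req_thread r < length (threads c)" "req_thread r \<noteq> t" if "r \<in> set (pending c)" for r
    using rq that tn by (auto simp: reqs_ok_def)
  have ow': "\<forall>r \<in> set (pending ?c). req_cell r \<in> dom (s' (req_thread r)) \<and> status (threads (flush ?c) ! req_thread r) = Running"
  proof
    fix r assume "r \<in> set (pending ?c)"
    then consider "r \<in> set (pending c)" | "r \<in> set ?n" by (auto simp: pe)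
    then show "req_cell r \<in> dom (s' (req_thread r)) \<and> status (threads (flush ?c) ! req_thread r) = Running"
    proof cases
      case 1
      have "req_cell r \<in> dom (s (req_thread r))" "status (threads (flush c) ! req_thread r) = Running"
        using ow 1 by blast+
      then show ?thesis using keep[OF rlt[OF 1]] by (metis subsetD)
    next
      case 2
      then show ?thesis using own' nreq[OF 2] unfolding nn fe by auto
    qed
  qed
  have dj: "dom (s u) \<inter> dom (s t) = {}" if "u < length (threads c)" "u \<noteq> t" for u
    using g that lt by (auto simp: config_inv_def Let_def)
  have dc': "distinct (map req_cell (pending ?c))"
  proof -
    have "req_cell r \<noteq> req_cell q" if "r \<in> set (pending c)" "q \<in> set ?n" for r q
    proof -
      have "req_cell r \<in> dom (s (req_thread r))" "req_cell q \<in> dom (s t)" using ow own' nn that by auto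
      with dj[OF rlt[OF that(1)]] show ?thesis by (metis disjoint_iff)
    qed
    then have "req_cell ` set (pending c) \<inter> req_cell ` set ?n = {}" by blast
    moreover have "distinct (map req_cell ?n)" using new_reqs_cases[of P t c] by auto
    ultimately show ?thesis using dc by (simp add: pe)
  qed
  have rest: "\<forall>u \<in> set ts. ready P (flush ?c) u \<and> u \<notin> req_thread ` set (pending ?c)"
  proof
    fix u assume u: "u \<in> set ts"
    then have "u \<noteq> t" "ready P (flush c) u" "u \<notin> req_thread ` set (pending c)" using Cons.prems(5,6) by auto
    then show "ready P (flush ?c) u \<and> u \<notin> req_thread ` set (pending ?c)"
      using ready_preserved[OF _ _ pr rd, of u] nreq unfolding fe pe by auto
  qed
  have "distinct ts" using Cons.prems(5) by simp
  from Cons.IH[OF g'[folded fe] rq' dc' ow' this rest] show ?case using len by simp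
qed

text \<open>No request survives a step, so every step must select some thread and lengthen the DAG.
  As the invariant bounds the length of the DAG by \<open>W\<close>, this yields
  termination.\<close>

lemma config_inv_step:
  assumes "config_inv c K s T w d \<delta>" "step P c c'"
  shows "\<exists>K' s' T' w' d' \<delta>'. config_inv c' K' s' T' w' d' \<delta>' \<and> length (dag c) < length (dag c')"
proof -
  have p: "pending c = []" using assms(1) by (simp add: config_inv_def Let_def)
  from assms(2) p obtain ts where ts: "distinct ts" "\<forall>t \<in> set ts. ready P c t" "ts \<noteq> []" "c' = serve (fold (exec P) ts c)"
    by (auto simp: step_def)
  have "\<exists>K' s' T' w' d' \<delta>'. config_inv (flush (fold (exec P) ts c)) K' s' T' w' d' \<delta>' \<and>
    distinct (map req_cell (pending (fold (exec P) ts c))) \<and> length (dag (fold (exec P) ts c)) = length (dag c) + length ts"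
    by (rule config_inv_fold_exec[where K = K and s = s and T = T and w = w and d = d and \<delta> = \<delta>])
       (use assms(1) p ts in \<open>auto simp: flush_no_pending reqs_ok_def\<close>)
  then show ?thesis using ts(3,4) by (force simp: serve_eq_flush)
qed

section \<open>Progress, span and work of complete executions\<close>

lemma config_inv_progress:
  assumes g: "config_inv c K s T w d \<delta>" and fin: "final P c" and t: "t < length (threads c)"
  shows "status (threads c ! t) = Terminated"
  using t
proof (induction "D (K t)" arbitrary: t rule: less_induct)
  case less
  show ?case
  proof (rule ccontr)
    assume "status (threads c ! t) \<noteq> Terminated"
    then have run: "status (threads c ! t) = Running" and
      ok: "ok P \<Psi> D S (K t) (pc (threads c ! t)) (regs (threads c ! t)) (s t) (T t) (w t) (d t)"
      and sat: "sat (s t) (heap c)" and tk: "\<And>u k. T t u = Some k \<Longrightarrow> u < length (threads c) \<and> K u = k"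
      using g less.prems by (auto simp: config_inv_def thread_inv_def Let_def)
    have "ready P c t"
      using ok
    proof cases
      case (local p' R' s')
      show ?thesis
      proof (cases "P ! pc (threads c ! t)")
        case (Rmw e f r i)
        then show ?thesis using local sat run less.prems
          by (cases f) (auto simp: ready_def Let_def sat_def split: val.splits)
      qed (use local run less.prems in \<open>auto simp: ready_def Let_def split: val.splits\<close>)
    next
      case (fork r l w1 w2 k' X Y)
      then show ?thesis using run less.prems by (auto simp: ready_def Let_def)
    next
      case (join r u k')
      then show ?thesis using run less.prems less.hyps[of u] tk[of u k'] by (auto simp: ready_def Let_def)
    next
      case terminate
      then show ?thesis using run less.prems by (auto simp: ready_def Let_def)
    qed
    then have "step P c (serve (fold (exec P) [t] c))"
      unfolding step_def by (intro exI[of _ "[t]"]) auto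
    with fin show False by (auto simp: final_def)
  qed
qed

lemma path_weight:
  assumes "dag_ok G \<delta> d N" "dag_path G p" "p \<noteq> []"
  shows "(\<Sum>i\<leftarrow>p. weight (G ! i)) \<le> \<delta> (last p)"
  using assms(2,3)
proof (induction p rule: rev_induct)
  case (snoc j p)
  have j: "j < length G" using snoc.prems by (auto simp: dag_path_def)
  show ?case
  proof (cases "p = []")
    case True
    then show ?thesis using assms(1) j by (auto simp: dag_ok_def)
  next
    case False
    have "dag_path G p" "last p \<in> preds (G ! j)"
      using snoc.prems(1) False by (auto simp: dag_path_def successively_append_iff)
    with snoc.IH False have "(\<Sum>i\<leftarrow>p. weight (G ! i)) \<le> \<delta> (last p)" by blast
    also have "\<delta> (last p) < \<delta> j" using assms(1) j \<open>last p \<in> preds (G ! j)\<close> by (auto simp: dag_ok_def)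
    finally show ?thesis using assms(1) j by (auto simp: dag_ok_def)
  qed
qed simp

lemma span_le:
  assumes "dag_ok G \<delta> d N" "\<forall>j < length G. \<delta> j \<le> B"
  shows "span G \<le> B"
proof -
  let ?X = "{\<Sum>i\<leftarrow>p. weight (G ! i) | p. dag_path G p}"
  have le: "x \<le> B" if "x \<in> ?X" for x
  proof -
    from that obtain p where p: "dag_path G p" "x = (\<Sum>i\<leftarrow>p. weight (G ! i))" by blast
    show ?thesis
    proof (cases "p = []")
      case False
      then have "last p < length G" using p(1) last_in_set[OF False] unfolding dag_path_def by blast
      then show ?thesis using path_weight[OF assms(1) p(1) False] assms(2) p(2) by (meson order_trans)
    qed (use p in simp)
  qed
  then have "finite ?X" by (intro finite_subset[of ?X "{..B}"]) auto
  moreover have "0 \<in> ?X" by (intro CollectI exI[of _ "[]"]) (auto simp: dag_path_def)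
  ultimately show ?thesis unfolding span_def using le by (subst Max_le_iff) auto
qed

lemma config_inv_final:
  assumes g: "config_inv c K s T w d \<delta>" and fin: "final P c"
  shows "returned c" "work (dag c) \<le> W" "span (dag c) \<le> S"
proof -
  have t: "status (threads c ! t) = Terminated" if "t < length (threads c)" for t
    using config_inv_progress[OF g fin that] .
  show "returned c" using t[of 0] g by (auto simp: returned_def config_inv_def Let_def)
  have dg: "dag_ok (dag c) \<delta> d (length (threads c))" using g by (simp add: config_inv_def Let_def)
  have "\<delta> j \<le> S" if j: "j < length (dag c)" for j
  proof -
    from dg j obtain u where u: "u < length (threads c)" "\<delta> j \<le> d u" by (auto simp: dag_ok_def)
    moreover have "d u \<le> D (K u)" "D (K u) \<le> S" using g t[OF u(1)] u(1) by (auto simp: config_inv_def thread_inv_def Let_def)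
    ultimately show ?thesis by linarith
  qed
  then show "span (dag c) \<le> S" using span_le[OF dg] by blast
  have "work (dag c) = (\<Sum>x\<leftarrow>dag c. 1)" unfolding work_def
    by (rule arg_cong[of _ _ sum_list], rule map_cong[OF refl]) (use dg in \<open>auto simp: dag_ok_def in_set_conv_nth\<close>)
  then show "work (dag c) \<le> W" using g by (auto simp: config_inv_def Let_def sum_list_triv)
qed

theorem runs_within_certified:
  assumes ok: "ok P \<Psi> D S k0 0 ((\<lambda>_. Null)(0 := v)) s0 Map.empty W 0"
    and s0: "sat s0 h" and k0: "D k0 \<le> S"
    and post: "\<And>R s T w h'. \<Psi> k0 R s T w \<Longrightarrow> sat s h' \<Longrightarrow> post h' (R 0)"
  shows "runs_within P h v post (real W) (real S)"
proof -
  \<comment> \<open>The ghost values count only for existing threads, and at this moment thread 0 is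
    the only one; hence constant functions do.\<close>
  have init: "config_inv (init h v) (\<lambda>_. k0) (\<lambda>_. s0) (\<lambda>_. Map.empty) (\<lambda>_. W) (\<lambda>_. 0) (\<lambda>_. 0)"
    unfolding config_inv_def thread_inv_def Let_def using ok s0 k0 by (auto simp: init_def dag_ok_def)
  have reach: "\<exists>K s T w d \<delta>. config_inv c K s T w d \<delta>" if "(step P)\<^sup>*\<^sup>* (init h v) c" for c
    using that
  proof induction
    case base
    show ?case using init by blast
  next
    case (step c c')
    then show ?case using config_inv_step by meson
  qed
  have bound: "length (dag c) \<le> W" if "config_inv c K s T w d \<delta>" for c K s T w d \<delta>
    using that by (auto simp: config_inv_def Let_def)
  have "\<nexists>e. e 0 = init h v \<and> (\<forall>i. step P (e i) (e (Suc i)))"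
  proof
    assume "\<exists>e. e 0 = init h v \<and> (\<forall>i. step P (e i) (e (Suc i)))"
    then obtain e where e: "e 0 = init h v" "\<And>i. step P (e i) (e (Suc i))" by blast
    have "\<exists>K s T w d \<delta>. config_inv (e i) K s T w d \<delta> \<and> i \<le> length (dag (e i))" for i
    proof (induction i)
      case 0
      show ?case unfolding e(1) using init le0 by blast
    next
      case (Suc i)
      then show ?case using config_inv_step[OF _ e(2)[of i]] by (meson Suc_leI order_le_less_trans)
    qed
    from this[of "Suc W"] bound show False by fastforce
  qed
  moreover have "returned c \<longrightarrow> post (heap c) (result c)" if "reachable P h v c" for c
  proof
    assume r: "returned c"
    from reach that obtain K s T w d \<delta> where g: "config_inv c K s T w d \<delta>" unfolding reachable_def by blast
    have "\<Psi> k0 (regs (threads c ! 0)) (s 0) (T 0) (w 0)" "sat (s 0) (heap c)"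
      using g r by (auto simp: config_inv_def thread_inv_def Let_def returned_def)
    then show "post (heap c) (result c)" unfolding result_def by (rule post)
  qed
  moreover have "final P c \<longrightarrow> returned c \<and> real (work (dag c)) \<le> real W \<and> real (span (dag c)) \<le> real S"
    if "reachable P h v c" for c
    using reach that config_inv_final unfolding reachable_def by (metis of_nat_le_iff)
  ultimately show ?thesis unfolding runs_within_def by blast
qed

end

section \<open>Trees in memory and the program\<close>

fun local_run :: "program \<Rightarrow> nat \<Rightarrow> lstate \<Rightarrow> lstate option" where
  "local_run P 0 st = Some st"
| "local_run P (Suc n) (p, R, s) =
    (if p < length P then Option.bind (local_step (P ! p) (p, R, s)) (local_run P n) else None)"

lemma local_run_numeral[simp]:
  "local_run P (numeral k) (p, R, s) =
    (if p < length P then Option.bind (local_step (P ! p) (p, R, s)) (local_run P (pred_numeral k)) else None)"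
  by (simp only: numeral_eq_Suc local_run.simps)

text \<open>Symbolic execution: with a concrete label and count, the simplifier evaluates
  \<open>n\<close> consecutive local instructions, and the obligation moves to the state after
  them.\<close>

lemma ok_run:
  assumes "case local_run P n (p, R, s) of None \<Rightarrow> False
      | Some (p', R', s') \<Rightarrow> ok P \<Psi> D S k p' R' s' T (w - n) (d + n)" "n \<le> w"
  shows "ok P \<Psi> D S k p R s T w d"
  using assms
proof (induction n arbitrary: p R s w d)
  case (Suc n)
  have pl: "p < length P" using Suc.prems(1) by (cases "p < length P") auto
  obtain p1 R1 s1 where st: "local_step (P ! p) (p, R, s) = Some (p1, R1, s1)"
    using Suc.prems(1) pl by (cases "local_step (P ! p) (p, R, s)") auto
  have "ok P \<Psi> D S k p1 R1 s1 T (w - 1) (d + 1)"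
    by (rule Suc.IH) (use Suc.prems st pl in \<open>auto split: option.splits\<close>)
  with Suc.prems(2) show ?case by (intro ok.local[OF pl _ st]) linarith+
qed simp

section \<open>Trees and their representation in owned cells\<close>

datatype 'a tree = Lf addr 'a | Nd addr "'a tree" "'a tree"

fun root :: "'a tree \<Rightarrow> addr" where
  "root (Lf a x) = a"
| "root (Nd a l r) = a"

fun addrs :: "'a tree \<Rightarrow> addr set" where
  "addrs (Lf a x) = {a}"
| "addrs (Nd a l r) = insert a (addrs l \<union> addrs r)"

fun elems :: "'a tree \<Rightarrow> 'a list" where
  "elems (Lf a x) = [x]"
| "elems (Nd a l r) = elems l @ elems r"

fun ht :: "'a tree \<Rightarrow> nat" where
  "ht (Lf a x) = 0"
| "ht (Nd a l r) = Suc (max (ht l) (ht r))"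

fun sep :: "'a tree \<Rightarrow> bool" where
  "sep (Lf a x) = True"
| "sep (Nd a l r) = (a \<notin> addrs l \<union> addrs r \<and> addrs l \<inter> addrs r = {} \<and> sep l \<and> sep r)"

lemma root_in_addrs[simp]: "root t \<in> addrs t" by (cases t) auto
lemma elems_nonempty[simp]: "elems t \<noteq> []" by (induction t) auto
lemma length_elems_pos[simp]: "0 < length (elems t)" using elems_nonempty by blast

fun leaf_cells :: "store \<Rightarrow> addr \<Rightarrow> val \<Rightarrow> bool" where
  "leaf_cells s a x \<longleftrightarrow> s (a, 0) = Some Null \<and> s (a, 1) = Some Null \<and> s (a, 2) = Some (Num 0) \<and>
     s (a, 3) = Some (Num 1) \<and> s (a, 4) = Some x \<and> s (a, 5) = Some x"

text \<open>A tree before rebalancing. Heights and end elements stored in inner nodes may be wrong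
  after splicing, so only children and sizes are recorded, together with ownership of eight cells,
  because every inner node will be recycled as a gap. Cells 6 and 7 lie beyond the BBT format and
  are scratch space: cell 6 holds the result of splicing and later a thread handle, cell 7 the gap
  that follows a final block.\<close>

fun full :: "store \<Rightarrow> val tree \<Rightarrow> bool" where
  "full s (Lf a x) = leaf_cells s a x"
| "full s (Nd a l r) = (s (a, 0) = Some (Ptr (root l)) \<and> s (a, 1) = Some (Ptr (root r)) \<and>
     s (a, 3) = Some (Num (int (length (elems l @ elems r)))) \<and> (\<forall>i < 8. (a, i) \<in> dom s) \<and>
     full s l \<and> full s r)"

fun bal :: "store \<Rightarrow> val tree \<Rightarrow> bool" where
  "bal s (Lf a x) = leaf_cells s a x"
| "bal s (Nd a l r) = (s (a, 0) = Some (Ptr (root l)) \<and> s (a, 1) = Some (Ptr (root r)) \<and>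
     s (a, 2) = Some (Num (int (Suc (max (ht l) (ht r))))) \<and>
     s (a, 3) = Some (Num (int (length (elems l @ elems r)))) \<and>
     s (a, 4) = Some (hd (elems l)) \<and> s (a, 5) = Some (last (elems r)) \<and>
     ht l \<le> ht r + 1 \<and> ht r \<le> ht l + 1 \<and> bal s l \<and> bal s r)"

lemma full_mono:
  "full s t \<Longrightarrow> (\<And>a i v. a \<in> addrs t \<Longrightarrow> s (a, i) = Some v \<Longrightarrow> s' (a, i) = Some v) \<Longrightarrow> full s' t"
proof (induction t)
  case (Nd a l r)
  have "full s' l" "full s' r" using Nd by auto
  moreover have "(a, i) \<in> dom s'" if "i < 8" for i
    using Nd.prems(1) Nd.prems(2)[of a i] that by (auto simp: dom_def)
  ultimately show ?case using Nd.prems by simp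
qed auto

lemma bal_mono:
  "bal s t \<Longrightarrow> (\<And>a i v. a \<in> addrs t \<Longrightarrow> s (a, i) = Some v \<Longrightarrow> s' (a, i) = Some v) \<Longrightarrow> bal s' t"
  by (induction t) auto

lemma le_5_cases: "i \<le> 5 \<longleftrightarrow> i = 0 \<or> i = 1 \<or> i = 2 \<or> i = 3 \<or> i = 4 \<or> i = (5::nat)"
  by linarith

text \<open>Trees represented in disjoint stores have disjoint addresses. Together with
  \<open>bal_dom\<close> this turns the separation obtained at a join into disjointness of
  trees.\<close>

lemma full_dom: "full s t \<Longrightarrow> a \<in> addrs t \<Longrightarrow> i \<le> 5 \<Longrightarrow> (a, i) \<in> dom s"
proof (induction t)
  case (Lf b x)
  then show ?case unfolding le_5_cases by (elim disjE) (simp_all add: domI)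
next
  case (Nd b l r)
  consider "a = b" | "a \<in> addrs l" | "a \<in> addrs r" using Nd.prems(2) by auto
  then show ?case
  proof cases
    case 1
    have "i < 8" using Nd.prems(3) by simp
    then show ?thesis using Nd.prems(1) 1 by simp
  qed (use Nd in simp_all)
qed

lemma bal_dom: "bal s t \<Longrightarrow> a \<in> addrs t \<Longrightarrow> i \<le> 5 \<Longrightarrow> (a, i) \<in> dom s"
proof (induction t)
  case (Lf b x)
  then show ?case unfolding le_5_cases by (elim disjE) (simp_all add: domI)
next
  case (Nd b l r)
  consider "a = b" | "a \<in> addrs l" | "a \<in> addrs r" using Nd.prems(2) by auto
  then show ?case
  proof cases
    case 1
    then show ?thesis using Nd.prems(1,3) unfolding le_5_cases by (elim disjE) (simp_all add: domI)
  qed (use Nd in simp_all)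
qed

lemma root_cells:
  assumes "bal s t"
  shows "s (root t, 2) = Some (Num (int (ht t)))" "s (root t, 3) = Some (Num (int (length (elems t))))"
    "s (root t, 4) = Some (hd (elems t))" "s (root t, 5) = Some (last (elems t))"
  using assms by (cases t; simp)+

lemma full_size: "full s t \<Longrightarrow> s (root t, 3) = Some (Num (int (length (elems t))))"
  by (cases t) auto

lemma restrict_map_UNIV: "m |` UNIV = m"
  by (simp add: restrict_map_def)

lemma map_add_leftI: "s x = Some v \<Longrightarrow> dom s \<inter> dom s' = {} \<Longrightarrow> (s ++ s') x = Some v"
  by (metis disjoint_iff domI map_add_dom_app_simps(3))

text \<open>Register 1 is never written and serves as the constant \<open>Null\<close>; registers
  18, 21 and 17 hold 0, 1 and 2. Register 14 receives the unwanted old contents of written cells.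
  During the descent registers 3, 5 and 6 hold \<open>n\<close>, \<open>2 ^ Q0\<close> and
  \<open>m\<close>, and forked threads inherit all of these.\<close>

definition concat_program :: program where
  "concat_program = [
    JumpEq 0 1 65,
    Fork 2 66,
    Join 2,
    Rmw 0 Read 0 6,
    JumpEq 0 1 65,
    Rmw 3 Read 0 3,
    Const 18 0,
    Const 21 1,
    Const 17 2,
    Const 4 1,
    Arith Add 5 4 4,
    JumpLess 3 5 14,
    Move 4 5,
    Jump 10,
    Arith Add 6 3 3,
    Arith Sub 6 6 5,
    Move 7 18,
    \<comment> \<open>label 17: descend from the node in register 0; 7: index of its first leaf; 8, 9: gaps to the right and left\<close>
    Rmw 10 Read 0 0,
    JumpEq 10 1 30,
    Rmw 11 Read 0 1,
    Rmw 12 Read 10 3,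
    Fork 13 26,
    Rmw 14 (Write 13) 0 6,
    Move 8 0,
    Move 0 10,
    Jump 17,
    Move 9 0,
    Move 0 11,
    Arith Add 7 7 12,
    Jump 17,
    JumpLess 7 6 35,
    Arith Add 7 7 7,
    Arith Sub 7 7 6,
    Const 15 2,
    Jump 36,
    Const 15 1,
    \<comment> \<open>label 36: grow the block with root in register 0; 7: its first position; 15: number of its positions; 5: \<open>2^Q0\<close>\<close>
    JumpEq 15 5 65,
    Arith Div 16 7 15,
    Arith Mod 16 16 17,
    JumpEq 16 18 43,
    Rmw 14 (Write 0) 9 1,
    Rmw 14 (Write 8) 9 7,
    Terminate,
    Rmw 13 Read 8 6,
    Join 13,
    Rmw 11 Read 8 1,
    Rmw 14 (Write 0) 8 0,
    Rmw 19 Read 0 2,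
    Rmw 20 Read 11 2,
    JumpLess 19 20 51,
    Move 20 19,
    Arith Add 20 20 21,
    Rmw 14 (Write 20) 8 2,
    Rmw 19 Read 0 3,
    Rmw 20 Read 11 3,
    Arith Add 20 19 20,
    Rmw 14 (Write 20) 8 3,
    Rmw 19 Read 0 4,
    Rmw 14 (Write 19) 8 4,
    Rmw 19 Read 11 5,
    Rmw 14 (Write 19) 8 5,
    Move 0 8,
    Rmw 8 Read 0 7,
    Arith Add 15 15 15,
    Jump 36,
    Terminate,
    \<comment> \<open>label 66: splice the batches below the node in register 0, with the result in its cell 6\<close>
    Rmw 3 Read 0 0,
    JumpEq 3 1 91,
    Rmw 4 Read 0 1,
    Move 5 0,
    Move 0 3,
    Fork 6 66,
    Move 0 4,
    Fork 7 66,
    Join 6,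
    Join 7,
    Rmw 3 Read 3 6,
    Rmw 4 Read 4 6,
    JumpEq 4 1 87,
    JumpEq 3 1 89,
    Rmw 14 (Write 3) 5 0,
    Rmw 14 (Write 4) 5 1,
    Rmw 6 Read 3 3,
    Rmw 7 Read 4 3,
    Arith Add 6 6 7,
    Rmw 14 (Write 6) 5 3,
    Move 3 5,
    Rmw 14 (Write 3) 5 6,
    Terminate,
    Move 3 4,
    Jump 87,
    Rmw 3 Read 0 4,
    Move 5 0,
    Jump 87]"

lemma length_concat_program[simp]: "length concat_program = 94"
  by (simp add: concat_program_def)

lemma concat_program_nth[simp]:
  "concat_program ! 0 = JumpEq 0 1 65"
  "concat_program ! Suc 0 = Fork 2 66"
  "concat_program ! 2 = Join 2"
  "concat_program ! 3 = Rmw 0 Read 0 6"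
  "concat_program ! 4 = JumpEq 0 1 65"
  "concat_program ! 5 = Rmw 3 Read 0 3"
  "concat_program ! 6 = Const 18 0"
  "concat_program ! 7 = Const 21 1"
  "concat_program ! 8 = Const 17 2"
  "concat_program ! 9 = Const 4 1"
  "concat_program ! 10 = Arith Add 5 4 4"
  "concat_program ! 11 = JumpLess 3 5 14"
  "concat_program ! 12 = Move 4 5"
  "concat_program ! 13 = Jump 10"
  "concat_program ! 14 = Arith Add 6 3 3"
  "concat_program ! 15 = Arith Sub 6 6 5"
  "concat_program ! 16 = Move 7 18"
  "concat_program ! 17 = Rmw 10 Read 0 0"
  "concat_program ! 18 = JumpEq 10 1 30"
  "concat_program ! 19 = Rmw 11 Read 0 1"
  "concat_program ! 20 = Rmw 12 Read 10 3"
  "concat_program ! 21 = Fork 13 26"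
  "concat_program ! 22 = Rmw 14 (Write 13) 0 6"
  "concat_program ! 23 = Move 8 0"
  "concat_program ! 24 = Move 0 10"
  "concat_program ! 25 = Jump 17"
  "concat_program ! 26 = Move 9 0"
  "concat_program ! 27 = Move 0 11"
  "concat_program ! 28 = Arith Add 7 7 12"
  "concat_program ! 29 = Jump 17"
  "concat_program ! 30 = JumpLess 7 6 35"
  "concat_program ! 31 = Arith Add 7 7 7"
  "concat_program ! 32 = Arith Sub 7 7 6"
  "concat_program ! 33 = Const 15 2"
  "concat_program ! 34 = Jump 36"
  "concat_program ! 35 = Const 15 1"
  "concat_program ! 36 = JumpEq 15 5 65"
  "concat_program ! 37 = Arith Div 16 7 15"
  "concat_program ! 38 = Arith Mod 16 16 17"
  "concat_program ! 39 = JumpEq 16 18 43"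
  "concat_program ! 40 = Rmw 14 (Write 0) 9 1"
  "concat_program ! 41 = Rmw 14 (Write 8) 9 7"
  "concat_program ! 42 = Terminate"
  "concat_program ! 43 = Rmw 13 Read 8 6"
  "concat_program ! 44 = Join 13"
  "concat_program ! 45 = Rmw 11 Read 8 1"
  "concat_program ! 46 = Rmw 14 (Write 0) 8 0"
  "concat_program ! 47 = Rmw 19 Read 0 2"
  "concat_program ! 48 = Rmw 20 Read 11 2"
  "concat_program ! 49 = JumpLess 19 20 51"
  "concat_program ! 50 = Move 20 19"
  "concat_program ! 51 = Arith Add 20 20 21"
  "concat_program ! 52 = Rmw 14 (Write 20) 8 2"
  "concat_program ! 53 = Rmw 19 Read 0 3"
  "concat_program ! 54 = Rmw 20 Read 11 3"
  "concat_program ! 55 = Arith Add 20 19 20"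
  "concat_program ! 56 = Rmw 14 (Write 20) 8 3"
  "concat_program ! 57 = Rmw 19 Read 0 4"
  "concat_program ! 58 = Rmw 14 (Write 19) 8 4"
  "concat_program ! 59 = Rmw 19 Read 11 5"
  "concat_program ! 60 = Rmw 14 (Write 19) 8 5"
  "concat_program ! 61 = Move 0 8"
  "concat_program ! 62 = Rmw 8 Read 0 7"
  "concat_program ! 63 = Arith Add 15 15 15"
  "concat_program ! 64 = Jump 36"
  "concat_program ! 65 = Terminate"
  "concat_program ! 66 = Rmw 3 Read 0 0"
  "concat_program ! 67 = JumpEq 3 1 91"
  "concat_program ! 68 = Rmw 4 Read 0 1"
  "concat_program ! 69 = Move 5 0"
  "concat_program ! 70 = Move 0 3"
  "concat_program ! 71 = Fork 6 66"
  "concat_program ! 72 = Move 0 4"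
  "concat_program ! 73 = Fork 7 66"
  "concat_program ! 74 = Join 6"
  "concat_program ! 75 = Join 7"
  "concat_program ! 76 = Rmw 3 Read 3 6"
  "concat_program ! 77 = Rmw 4 Read 4 6"
  "concat_program ! 78 = JumpEq 4 1 87"
  "concat_program ! 79 = JumpEq 3 1 89"
  "concat_program ! 80 = Rmw 14 (Write 3) 5 0"
  "concat_program ! 81 = Rmw 14 (Write 4) 5 1"
  "concat_program ! 82 = Rmw 6 Read 3 3"
  "concat_program ! 83 = Rmw 7 Read 4 3"
  "concat_program ! 84 = Arith Add 6 6 7"
  "concat_program ! 85 = Rmw 14 (Write 6) 5 3"
  "concat_program ! 86 = Move 3 5"
  "concat_program ! 87 = Rmw 14 (Write 3) 5 6"
  "concat_program ! 88 = Terminate"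
  "concat_program ! 89 = Move 3 4"
  "concat_program ! 90 = Jump 87"
  "concat_program ! 91 = Rmw 3 Read 0 4"
  "concat_program ! 92 = Move 5 0"
  "concat_program ! 93 = Jump 87"
  by (simp_all add: concat_program_def)

section \<open>Positions and aligned blocks\<close>

definition pos :: "nat \<Rightarrow> nat \<Rightarrow> nat" where
  "pos m i = (if i < m then i else 2 * i - m)"

lemma pos_strict_mono: "i < j \<Longrightarrow> pos m i < pos m j"
  by (auto simp: pos_def)

lemma pos_0[simp]: "pos m 0 = 0"
  by (simp add: pos_def)

lemma even_block_dvd: "2 ^ l dvd p \<Longrightarrow> even (p div 2 ^ l) \<Longrightarrow> 2 ^ Suc l dvd (p::nat)"
  by (metis dvd_div_iff_mult mult.commute power_Suc power_not_zero zero_neq_numeral)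

text \<open>The level of an odd aligned block at \<open>p\<close> is the 2-adic valuation of
  \<open>p\<close>. Used in both directions, this identifies the level promised in a role with the
  level reached; used once, it compares the deadlines of two threads.\<close>

lemma odd_block_le:
  fixes p :: nat
  assumes "2 ^ l dvd p" "odd (p div 2 ^ l')"
  shows "l \<le> l'"
proof (rule ccontr)
  assume "\<not> l \<le> l'"
  then have "2 ^ Suc l' dvd p" using assms(1) by (meson dvd_trans le_imp_power_dvd not_less_eq_eq)
  then have "even (p div 2 ^ l')" by (auto elim!: dvdE)
  with assms(2) show False by simp
qed

lemma exists_odd_block:
  assumes "0 < (p::nat)" obtains l where "2 ^ l dvd p" "odd (p div 2 ^ l)"
proof -
  have "\<exists>l. 2 ^ l dvd p \<and> odd (p div 2 ^ l)" using assms
  proof (induction p rule: less_induct)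
    case (less p)
    show ?case
    proof (cases "even p")
      case True
      then obtain q where q: "p = 2 * q" by blast
      with less obtain l where "2 ^ l dvd q" "odd (q div 2 ^ l)" by (metis nat_0_less_mult_iff less_add_same_cancel1 mult_2)
      then show ?thesis using q by (intro exI[of _ "Suc l"]) (auto simp: dvd_def)
    qed (auto intro: exI[of _ 0])
  qed
  with that show ?thesis by blast
qed

fun batch_val :: "val tree option \<Rightarrow> val" where
  "batch_val None = Null"
| "batch_val (Some t) = Ptr (root t)"

fun batch_elems :: "val tree option \<Rightarrow> val list" where
  "batch_elems None = []"
| "batch_elems (Some t) = elems t"

fun batch_addrs :: "val tree option \<Rightarrow> addr set" where
  "batch_addrs None = {}"
| "batch_addrs (Some t) = addrs t"

fun all_addrs :: "val tree option tree \<Rightarrow> addr set" where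
  "all_addrs (Lf a b) = insert a (batch_addrs b)"
| "all_addrs (Nd a l r) = insert a (all_addrs l \<union> all_addrs r)"

fun splice_in :: "nat \<Rightarrow> store \<Rightarrow> val tree option tree \<Rightarrow> bool" where
  "splice_in H s (Lf a b) \<longleftrightarrow> s (a, 0) = Some Null \<and> s (a, 4) = Some (batch_val b) \<and> (a, 6) \<in> dom s \<and>
     a \<notin> batch_addrs b \<and> (\<forall>t. b = Some t \<longrightarrow> full s t \<and> sep t \<and> ht t \<le> H)"
| "splice_in H s (Nd a l r) \<longleftrightarrow> s (a, 0) = Some (Ptr (root l)) \<and> s (a, 1) = Some (Ptr (root r)) \<and>
     (\<forall>j < 8. (a, j) \<in> dom s) \<and> a \<notin> all_addrs l \<union> all_addrs r \<and> all_addrs l \<inter> all_addrs r = {} \<and>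
     splice_in H s l \<and> splice_in H s r"

lemma splice_in_mono:
  "splice_in H s bt \<Longrightarrow> (\<And>a i v. a \<in> all_addrs bt \<Longrightarrow> s (a, i) = Some v \<Longrightarrow> s' (a, i) = Some v) \<Longrightarrow> splice_in H s' bt"
proof (induction bt)
  case (Lf a b)
  have "full s' t" if "b = Some t" for t
    by (rule full_mono[of s]) (use Lf that in auto)
  then show ?case using Lf by (auto simp: dom_def)
next
  case (Nd a l r)
  have "splice_in H s' l" "splice_in H s' r" using Nd by auto
  moreover have "(a, i) \<in> dom s'" if "i < 8" for i
    using Nd.prems(1) Nd.prems(2)[of a i] that by (auto simp: dom_def)
  ultimately show ?case using Nd.prems by simp
qed

text \<open>
  \<open>Splice bt dl\<close> splices the batches below \<open>bt\<close> by the deadline \<open>dl\<close>; \<open>Descend c x l\<close> is the thread of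
  leaf \<open>c\<close>, forked at the gap \<open>x\<close>, with a final block of \<open>2^l\<close> positions.
\<close>

datatype role = Main | Splice "val tree option tree" nat | Descend nat addr nat

definition segment :: "'a list \<Rightarrow> nat \<Rightarrow> nat \<Rightarrow> 'a list" where
  "segment xs i j = take (j - i) (drop i xs)"

lemma segment_append: "i \<le> j \<Longrightarrow> j \<le> k \<Longrightarrow> segment xs i j @ segment xs j k = segment xs i k"
  by (auto dest!: le_Suc_ex simp: segment_def take_add add.commute add.assoc)

lemma length_segment[simp]: "i \<le> j \<Longrightarrow> j \<le> length xs \<Longrightarrow> length (segment xs i j) = j - i"
  by (simp add: segment_def)

section \<open>Correctness of the program\<close>

text \<open>\<open>Dd\<close> is the depth by which every thread has arrived at its leaf; each
  doubling of a block is allotted 60 more. \<open>H\<close> bounds the heights of the given batches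
  of items. \<open>Q0\<close> is constrained only for nonempty \<open>xs\<close>, as no power of two
  is at most 0.\<close>

locale concat_run =
  fixes xs :: "val list" and Q0 Dd H S :: nat
  assumes Q0: "xs \<noteq> [] \<Longrightarrow> 2 ^ Q0 \<le> 2 * length xs \<and> length xs < 2 ^ Q0"
    and S: "Dd + 60 * (Q0 + 2) \<le> S"
begin

abbreviation "n \<equiv> length xs"
definition "m2 = 2 * n - 2 ^ Q0"
abbreviation "ps \<equiv> pos m2"

fun deadline :: "role \<Rightarrow> nat" where
  "deadline Main = S"
| "deadline (Splice t dl) = dl"
| "deadline (Descend c x l) = Dd + 60 * (l + 1)"

text \<open>
  The gap \<open>g\<close> in front of leaf \<open>e\<close>, with the right to join the thread of that leaf; cells 1 and 7 of the
  gap are still with that thread. The work for merging at the gap is \<open>credit e\<close>.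
\<close>

definition right_ctx :: "nat \<Rightarrow> val \<Rightarrow> store \<Rightarrow> (tid \<rightharpoonup> role) \<Rightarrow> bool" where
  "right_ctx e g s T \<longleftrightarrow> (if e = n then g = Null else
     \<exists>x u l. g = Ptr x \<and> (\<forall>i \<in> {0, 2, 3, 4, 5}. (x, i) \<in> dom s) \<and> s (x, 6) = Some (Thr u) \<and>
       T u = Some (Descend e x l) \<and> 2 ^ l dvd ps e \<and> odd (ps e div 2 ^ l))"

definition credit :: "nat \<Rightarrow> nat" where
  "credit e = (if e = n then 0 else 40)"

text \<open>\<open>t\<close> holds the items with indices from \<open>i\<close> to below \<open>e\<close>, a block of \<open>2^l\<close> positions.\<close>

definition block :: "store \<Rightarrow> val tree \<Rightarrow> nat \<Rightarrow> nat \<Rightarrow> nat \<Rightarrow> bool" where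
  "block s t i e l \<longleftrightarrow> bal s t \<and> sep t \<and> elems t = segment xs i e \<and> ht t \<le> l \<and> l \<le> ht t + 1 \<and>
     i < e \<and> e \<le> n \<and> ps e = ps i + 2 ^ l"

text \<open>A \<open>Descend\<close> thread returns through its gap \<open>x\<close> the root of its
  final block (cell 1) and the next gap (cell 7), along with the right to join the thread behind
  that gap and the credit for merging there. This is exactly what the joining thread needs to go on
  growing.\<close>

fun post :: "role \<Rightarrow> (reg \<Rightarrow> val) \<Rightarrow> store \<Rightarrow> (tid \<rightharpoonup> role) \<Rightarrow> nat \<Rightarrow> bool" where
  "post Main R s T w \<longleftrightarrow> (R 0 = Null \<and> xs = []) \<or> (\<exists>t. R 0 = Ptr (root t) \<and> bal s t \<and> sep t \<and> elems t = xs)"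
| "post (Splice bt dl) R s T w \<longleftrightarrow> (\<exists>v. s (root bt, 6) = Some v \<and>
     ((v = Null \<and> concat (map batch_elems (elems bt)) = []) \<or>
      (\<exists>t. v = Ptr (root t) \<and> full s t \<and> sep t \<and> elems t = concat (map batch_elems (elems bt)) \<and> ht t \<le> ht bt + H)))"
| "post (Descend c x l) R s T w \<longleftrightarrow> (\<exists>t e g. s (x, 1) = Some (Ptr (root t)) \<and> s (x, 7) = Some g \<and>
     block s t c e l \<and> right_ctx e g s T \<and> credit e \<le> w \<and> (\<forall>y. g = Ptr y \<longrightarrow> y \<notin> addrs t))"

abbreviation "okc \<equiv> ok concat_program post deadline S"

text \<open>Of the gap to its left a thread owns only the two cells in which it will leave its
  block. \<open>A\<close> is the set of addresses of its current tree, which those writes must not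
  damage.\<close>

definition role_ok :: "role \<Rightarrow> nat \<Rightarrow> val \<Rightarrow> store \<Rightarrow> addr set \<Rightarrow> bool" where
  "role_ok k i v s A \<longleftrightarrow> (k = Main \<and> i = 0) \<or>
     (\<exists>x l. k = Descend i x l \<and> 0 < i \<and> v = Ptr x \<and> (x, 1) \<in> dom s \<and> (x, 7) \<in> dom s \<and> x \<notin> A \<and>
       2 ^ l dvd ps i \<and> odd (ps i div 2 ^ l))"

lemma ps_n: "xs \<noteq> [] \<Longrightarrow> ps n = 2 ^ Q0"
  using Q0 by (auto simp: pos_def m2_def)

lemma ps_le: "e \<le> n \<Longrightarrow> xs \<noteq> [] \<Longrightarrow> ps e \<le> 2 ^ Q0"
  using pos_strict_mono[of e n m2] ps_n by (cases "e = n") auto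

section \<open>Growing and merging blocks\<close>

text \<open>Both blocks have height \<open>l - 1\<close> or \<open>l\<close>, so the balance
  condition holds at their new root \<open>x\<close>, and the height of the result is
  \<open>l\<close> or \<open>l + 1\<close>, as level \<open>Suc l\<close> demands. \<open>IH\<close>
  is the claim of \<open>loop\<close> for that level, assumed here so that this straight-line code
  can be treated outside the induction. At most 20 of the 30 units are spent.\<close>

lemma merge_step:
  assumes IH: "\<And>t e R s T w d. block s t i e (Suc l) \<Longrightarrow> 2 ^ Suc l dvd ps i \<Longrightarrow> role_ok k i (R 9) s (addrs t) \<Longrightarrow>
      R 0 = Ptr (root t) \<Longrightarrow> R 1 = Null \<Longrightarrow> R 5 = Num (2 ^ Q0) \<Longrightarrow> R 7 = Num (int (ps i)) \<Longrightarrow> R 15 = Num (2 ^ Suc l) \<Longrightarrow>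
      R 17 = Num 2 \<Longrightarrow> R 18 = Num 0 \<Longrightarrow> R 21 = Num 1 \<Longrightarrow>
      right_ctx e (R 8) s T \<Longrightarrow> (\<forall>y. R 8 = Ptr y \<longrightarrow> y \<notin> addrs t) \<Longrightarrow> 10 + credit e \<le> w \<Longrightarrow>
      d \<le> Dd + 60 * Suc l + 40 \<Longrightarrow> okc k 36 R s T w d"
    and b1: "block s t1 i e l" and b2: "block s t2 e e2 l" and dv: "2 ^ Suc l dvd ps i"
    and k: "role_ok k i (R 9) s (insert x (addrs t1 \<union> addrs t2))"
    and R: "R 0 = Ptr (root t1)" "R 1 = Null" "R 5 = Num (2 ^ Q0)" "R 7 = Num (int (ps i))" "R 8 = Ptr x"
      "R 15 = Num (2 ^ l)" "R 17 = Num 2" "R 18 = Num 0" "R 21 = Num 1"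
    and x: "x \<notin> addrs t1" "x \<notin> addrs t2" "addrs t1 \<inter> addrs t2 = {}" "\<forall>i \<in> {0, 2, 3, 4, 5}. (x, i) \<in> dom s"
      "s (x, 1) = Some (Ptr (root t2))" "s (x, 7) = Some g"
    and g: "right_ctx e2 g s T" "\<forall>y. g = Ptr y \<longrightarrow> y \<notin> insert x (addrs t1 \<union> addrs t2)"
    and w: "30 + credit e2 \<le> w" and d: "d \<le> Dd + 60 * Suc l + 10"
  shows "okc k 45 R s T w d"
proof -
  let ?h = "max (ht t1) (ht t2)"
  obtain v0 v2 v3 v4 v5 where xd: "s (x, 0) = Some v0" "s (x, 2) = Some v2" "s (x, 3) = Some v3" "s (x, 4) = Some v4" "s (x, 5) = Some v5"
    using x(4) by auto
  have bal: "bal s t1" "bal s t2" using b1 b2 by (auto simp: block_def)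
  note rc = root_cells[OF bal(1)] root_cells[OF bal(2)]
  have rx: "root t1 \<noteq> x" "root t2 \<noteq> x" "x \<noteq> root t1" "x \<noteq> root t2" using x(1,2) root_in_addrs by metis+
  \<comment> \<open>Both branches of the comparison of heights meet at label 51 with the larger
    height in register 20.\<close>
  have tail: "okc k 51 R1 (s((x, 0) \<mapsto> Ptr (root t1))) T w1 d1"
    if R1: "R1 0 = Ptr (root t1)" "R1 1 = Null" "R1 5 = Num (2 ^ Q0)" "R1 7 = Num (int (ps i))" "R1 8 = Ptr x"
      "R1 9 = R 9" "R1 11 = Ptr (root t2)" "R1 15 = Num (2 ^ l)" "R1 17 = Num 2" "R1 18 = Num 0" "R1 20 = Num (int ?h)" "R1 21 = Num 1"
      and w1: "24 + credit e2 \<le> w1" and d1: "d1 \<le> Dd + 60 * Suc l + 16" for R1 w1 d1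
  proof (rule ok_run[where n = 14])
    define s1 where "s1 = s((x, 0) \<mapsto> Ptr (root t1), (x, 2) \<mapsto> Num (int ?h + 1),
      (x, 3) \<mapsto> Num (int (length (elems t1)) + int (length (elems t2))), (x, 4) \<mapsto> hd (elems t1), (x, 5) \<mapsto> last (elems t2))"
    have keep: "s1 (a, j) = s (a, j)" if "a \<noteq> x \<or> j \<in> {1, 6, 7}" for a j using that by (auto simp: s1_def)
    have "bal s1 t1" by (rule bal_mono[OF bal(1)]) (use x(1) in \<open>metis keep\<close>)
    moreover have "bal s1 t2" by (rule bal_mono[OF bal(2)]) (use x(2) in \<open>metis keep\<close>)
    ultimately have blk: "block s1 (Nd x t1 t2) i e2 (Suc l)"
      using b1 b2 x(1,2,3,5) keep[of x 1] segment_append[of i e e2 xs] by (auto simp: block_def s1_def)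
    have rc1: "right_ctx e2 g s1 T"
      using g(1) keep unfolding right_ctx_def by (auto simp: s1_def split: if_splits)
    have k1: "role_ok k i (R 9) s1 (addrs (Nd x t1 t2))" using k keep unfolding role_ok_def by (auto simp: s1_def)
    show "case local_run concat_program 14 (51, R1, s((x, 0) \<mapsto> Ptr (root t1))) of None \<Rightarrow> False
      | Some (p', R', s') \<Rightarrow> okc k p' R' s' T (w1 - 14) (d1 + 14)"
      using IH[OF blk dv] k1 R1 rc1 g(2) w1 d1 keep[of x 7]
      by (simp add: xd rc rx x(6) flip: s1_def)
  qed (use w1 in simp)
  show ?thesis
  proof (cases "ht t1 < ht t2")
    case True
    then have m: "?h = ht t2" by simp
    show ?thesis
    proof (rule ok_run[where n = 5])
      show "case local_run concat_program 5 (45, R, s) of None \<Rightarrow> False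
        | Some (p', R', s') \<Rightarrow> okc k p' R' s' T (w - 5) (d + 5)"
        using True by (simp add: R xd rc rx x(5)[unfolded One_nat_def] x(6)) (rule tail; use R m w d in simp)
    qed (use w in simp)
  next
    case False
    then have m: "?h = ht t1" by simp
    show ?thesis
    proof (rule ok_run[where n = 6])
      show "case local_run concat_program 6 (45, R, s) of None \<Rightarrow> False
        | Some (p', R', s') \<Rightarrow> okc k p' R' s' T (w - 6) (d + 6)"
        using False by (simp add: R xd rc rx x(5)[unfolded One_nat_def] x(6)) (rule tail; use R m w d in simp)
    qed (use w in simp)
  qed
qed

lemma right_ctx_mono:
  "right_ctx e g s T \<Longrightarrow>  (\<And>y i v. g = Ptr y \<Longrightarrow> i \<in> {0, 2, 3, 4, 5, 6} \<Longrightarrow> s (y, i) = Some v \<Longrightarrow> s' (y, i) = Some v) \<Longrightarrow>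
   (\<And>u k. T u = Some k \<Longrightarrow> T' u = Some k) \<Longrightarrow> right_ctx e g s' T'"
  unfolding right_ctx_def by (auto simp: dom_def)

text \<open>Induction on the number of doublings still possible. The 10 units beyond
  \<open>credit e\<close> pay for the exit, and the 40 units of a gap pay for one merge.\<close>

lemma loop:
  assumes "block s t i e l" "2 ^ l dvd ps i" "role_ok k i (R 9) s (addrs t)"
      "R 0 = Ptr (root t)" "R 1 = Null" "R 5 = Num (2 ^ Q0)" "R 7 = Num (int (ps i))" "R 15 = Num (2 ^ l)"
      "R 17 = Num 2" "R 18 = Num 0" "R 21 = Num 1"
      "right_ctx e (R 8) s T" "\<forall>y. R 8 = Ptr y \<longrightarrow> y \<notin> addrs t" "10 + credit e \<le> w" "d \<le> Dd + 60 * l + 40"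
  shows "okc k 36 R s T w d"
  using assms
proof (induction "Q0 - l" arbitrary: t e l R s T w d rule: less_induct)
  case less
  note b = less.prems(1) and dv = less.prems(2) and k = less.prems(3) and R = less.prems(4-11)
    and rc = less.prems(12) and gt = less.prems(13) and w = less.prems(14) and d = less.prems(15)
  have ie: "i < e" "e \<le> n" "ps e = ps i + 2 ^ l" and bal: "bal s t" using b by (auto simp: block_def)
  then have ne: "xs \<noteq> []" by auto
  have le: "ps e \<le> 2 ^ Q0" using ps_le[OF ie(2) ne] .
  then have "(2::nat) ^ l \<le> 2 ^ Q0" using ie(3) by linarith
  then have lQ: "l \<le> Q0" by simp
  have lt: "i < n" using ie by simp
  have psi: "ps i < 2 ^ Q0" using ie le pos_strict_mono[OF ie(1), of m2] by linarith
  show ?case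
  proof (cases "l = Q0")
    case True
    \<comment> \<open>A position below \<open>2 ^ Q0\<close> and divisible by it is 0, whereas a
      forked thread has a positive leaf index and hence a positive position.\<close>
    have k0: "k = Main" "i = 0"
      using k psi pos_strict_mono[of 0 i m2] dv unfolding role_ok_def True by (auto dest: dvd_imp_le)
    have "e = n"
    proof (rule ccontr)
      assume "e \<noteq> n"
      then have "ps e < ps n" using ie by (intro pos_strict_mono) simp
      then show False using ps_n[OF ne] ie k0 True by simp
    qed
    then have el: "elems t = xs" using b k0 by (simp add: block_def segment_def)
    show ?thesis
    proof (rule ok_run[where n = "Suc 0"])
      show "case local_run concat_program (Suc 0) (36, R, s) of None \<Rightarrow> False
        | Some (p', R', s') \<Rightarrow> okc k p' R' s' T (w - Suc 0) (d + Suc 0)"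
      proof (simp add: R True, rule ok.terminate)
        show "post k R s T (w - Suc 0 - 1)" using b el R k0 by (auto simp: block_def)
        show "Suc d + 1 \<le> deadline k" using S d True k0 by simp
      qed (use w in simp_all)
    qed (use w in simp)
  next
    case False
    then have l: "l < Q0" using lQ by simp
    have neq: "(2::int) ^ l \<noteq> 2 ^ Q0" using l by simp
    have dvi: "int (ps i) div 2 ^ l = int (ps i div 2 ^ l)" by (simp add: zdiv_int)
    show ?thesis
    proof (cases "odd (ps i div 2 ^ l)")
      case True
      have md: "int (ps i) div 2 ^ l mod 2 = 1" unfolding dvi using True by presburger
      have "i \<noteq> 0" using True by (auto intro: ccontr)
      then obtain x l' where x: "k = Descend i x l'" "R 9 = Ptr x" "(x, 1) \<in> dom s" "(x, 7) \<in> dom s" "x \<notin> addrs t"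
        "2 ^ l' dvd ps i" "odd (ps i div 2 ^ l')" using k unfolding role_ok_def by auto
      \<comment> \<open>The first odd block has the level that the role fixed at the fork.\<close>
      have "l' = l" using odd_block_le[OF x(6) True] odd_block_le[OF dv x(7)] by simp
      obtain v1 v7 where v: "s (x, Suc 0) = Some v1" "s (x, 7) = Some v7" using x(3,4) by auto
      define s1 where "s1 = s((x, Suc 0) \<mapsto> Ptr (root t), (x, 7) \<mapsto> R 8)"
      have keep: "s1 (a, j) = s (a, j)" if "a \<noteq> x \<or> j \<noteq> 1 \<and> j \<noteq> 7" for a j using that by (auto simp: s1_def)
      have "bal s1 t" by (rule bal_mono[OF bal]) (use x(5) in \<open>metis keep\<close>)
      then have blk: "block s1 t i e l" using b by (simp add: block_def)
      have rc1: "right_ctx e (R 8) s1 T" using rc keep unfolding right_ctx_def by (auto simp: s1_def)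
      show ?thesis
      proof (rule ok_run[where n = 6])
        show "case local_run concat_program 6 (36, R, s) of None \<Rightarrow> False
          | Some (p', R', s') \<Rightarrow> okc k p' R' s' T (w - 6) (d + 6)"
        proof (simp add: R x(2) v neq md flip: s1_def, rule ok.terminate)
          show "post k (R(16 := Num 1, 14 := v7)) s1 T (w - 6 - 1)"
            unfolding x(1) post.simps using blk rc1 gt w \<open>l' = l\<close>
            by (intro exI[of _ t] exI[of _ e] exI[of _ "R 8"]) (auto simp: s1_def)
          show "d + 6 + 1 \<le> deadline k" using d x(1) \<open>l' = l\<close> by simp
        qed (use w in simp_all)
      qed (use w in simp)
    next
      case even: False
      have md: "int (ps i) div 2 ^ l mod 2 = 0" unfolding dvi using even by presburger
      have dv1: "2 ^ Suc l dvd ps i" using even_block_dvd[OF dv] even by simp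
      \<comment> \<open>An even block does not reach the end of the range: otherwise
        \<open>2 ^ Suc l\<close>, which divides \<open>ps i\<close> and \<open>2 ^ Q0\<close>, would
        divide their difference \<open>2 ^ l\<close>. So a gap follows.\<close>
      have "e \<noteq> n"
      proof
        assume "e = n"
        then have "2 ^ Q0 = ps i + 2 ^ l" using ie(3) ps_n[OF ne] by simp
        moreover have "(2::nat) ^ Suc l dvd 2 ^ Q0" using l by (intro le_imp_power_dvd) simp
        ultimately have "(2::nat) ^ Suc l dvd 2 ^ l" using dv1 by (metis dvd_add_right_iff)
        then show False by (auto dest: dvd_imp_le)
      qed
      then obtain x u l2 where x: "R 8 = Ptr x" "\<forall>i \<in> {0, 2, 3, 4, 5}. (x, i) \<in> dom s" "s (x, 6) = Some (Thr u)"
          "T u = Some (Descend e x l2)" "2 ^ l2 dvd ps e" "odd (ps e div 2 ^ l2)"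
        using rc unfolding right_ctx_def by auto
      \<comment> \<open>The partner begins at an odd multiple of \<open>2 ^ l\<close>, so its final
        block has the same size.\<close>
      have pe: "2 ^ l dvd ps e" "odd (ps e div 2 ^ l)" using ie(3) dv even by auto
      have l2: "l2 = l" using odd_block_le[OF x(5) pe(2)] odd_block_le[OF pe(1) x(6)] by simp
      have xt: "x \<notin> addrs t" using gt x(1) by simp
      \<comment> \<open>A forked thread whose current block is even has a final level above
        \<open>l\<close>; the deadline \<open>S\<close> of \<open>Main\<close> lies beyond those of
        all levels below \<open>Q0\<close>.\<close>
      have dk: "deadline (Descend e x l) < deadline k"
        using k unfolding role_ok_def
      proof (elim disjE exE conjE)
        assume "k = Main"
        then show ?thesis using S l by simp
      next
        fix y l' assume "k = Descend i y l'" "odd (ps i div 2 ^ l')"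
        then show ?thesis using odd_block_le[OF dv1] by fastforce
      qed
      have s44: "Suc 44 = 45" by simp
      have w50: "50 \<le> w" using w \<open>e \<noteq> n\<close> by (simp add: credit_def)
      have "okc k 44 (R(16 := Num 0, 13 := Thr u)) s T (w - 5) (d + 5)"
      proof (rule ok.join[where r = 13 and u = u and k' = "Descend e x l"])
        fix R' s' T' w'
        assume p: "post (Descend e x l) R' s' T' w'" and ds: "dom s \<inter> dom s' = {}" "dom T \<inter> dom T' = {}"
        then obtain t2 e2 g where q: "s' (x, 1) = Some (Ptr (root t2))" "s' (x, 7) = Some g" "block s' t2 e e2 l"
          "right_ctx e2 g s' T'" "credit e2 \<le> w'" "\<forall>y. g = Ptr y \<longrightarrow> y \<notin> addrs t2" by auto
        let ?s = "s ++ s'" let ?T = "T(u := None) ++ T'"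
        have L: "?s c = Some v" if "s c = Some v" for c v using map_add_leftI[OF that ds(1)] .
        have Rr: "?s c = Some v" if "s' c = Some v" for c v using that by simp
        have "bal ?s t" by (rule bal_mono[OF bal L])
        then have b1: "block ?s t i e l" using b by (simp add: block_def)
        have bal2: "bal s' t2" using q(3) by (simp add: block_def)
        have "bal ?s t2" by (rule bal_mono[OF bal2 Rr])
        then have b2: "block ?s t2 e e2 l" using q(3) by (simp add: block_def)
        have rc2: "right_ctx e2 g ?s ?T" using q(4) by (rule right_ctx_mono) auto
        \<comment> \<open>The tree received at the join lies in cells that were not owned before;
          all address inequalities for the merge follow from this.\<close>
        have own2: "(y, j) \<notin> dom s" if "y \<in> addrs t2" "j \<le> 5" for y j using bal_dom[OF bal2 that] ds(1) by auto
        have xt2: "x \<notin> addrs t2" using own2[of x 0] x(2) by auto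
        have tt: "addrs t \<inter> addrs t2 = {}" using own2 bal_dom[OF bal] by (metis disjoint_iff le0)
        have gx: "\<forall>y. g = Ptr y \<longrightarrow> y \<notin> insert x (addrs t \<union> addrs t2)"
        proof (intro allI impI)
          fix y assume y: "g = Ptr y"
          then have "(y, 0) \<in> dom s'" using q(4) unfolding right_ctx_def by (auto split: if_splits)
          then have "(y, 0) \<notin> dom s" using ds(1) by auto
          then show "y \<notin> insert x (addrs t \<union> addrs t2)" using q(6) y x(2) bal_dom[OF bal, of y 0] by auto
        qed
        have k2: "role_ok k i (R 9) ?s (insert x (addrs t \<union> addrs t2))"
          using k unfolding role_ok_def
        proof (elim disjE exE conjE)
          fix y l' assume y: "k = Descend i y l'" "(y, 1) \<in> dom s" "(y, 7) \<in> dom s" "y \<notin> addrs t"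
            "0 < i" "R 9 = Ptr y" "2 ^ l' dvd ps i" "odd (ps i div 2 ^ l')"
          have "y \<notin> addrs t2" using own2[of y 1] y(2) by auto
          moreover have "y \<noteq> x" using q(1) y(2) ds(1) by auto
          ultimately show "k = Main \<and> i = 0 \<or>
            (\<exists>xa l. k = Descend i xa l \<and> 0 < i \<and> R 9 = Ptr xa \<and> (xa, 1) \<in> dom ?s \<and> (xa, 7) \<in> dom ?s \<and>
              xa \<notin> insert x (addrs t \<union> addrs t2) \<and> 2 ^ l dvd ps i \<and> odd (ps i div 2 ^ l))"
            using y by (intro disjI2 exI[of _ y] exI[of _ l']) auto
        qed simp
        show "okc k (Suc 44) (R(16 := Num 0, 13 := Thr u)) ?s ?T (w - 5 - 1 + w') (max (d + 5) (deadline (Descend e x l)) + 1)"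
          unfolding s44
        proof (rule merge_step[where ?t1.0 = t and ?t2.0 = t2 and e = e and ?e2.0 = e2 and l = l and i = i and x = x and g = g])
          show "\<forall>j \<in> {0, 2, 3, 4, 5}. (x, j) \<in> dom ?s" using x(2) by auto
          fix t e w d and R :: "reg \<Rightarrow> val" and s :: store and T :: "tid \<rightharpoonup> role"
          assume A: "block s t i e (Suc l)" "2 ^ Suc l dvd ps i" "role_ok k i (R 9) s (addrs t)"
            "R 0 = Ptr (root t)" "R 1 = Null" "R 5 = Num (2 ^ Q0)" "R 7 = Num (int (ps i))" "R 15 = Num (2 ^ Suc l)"
            "R 17 = Num 2" "R 18 = Num 0" "R 21 = Num 1"
            "right_ctx e (R 8) s T" "\<forall>y. R 8 = Ptr y \<longrightarrow> y \<notin> addrs t" "10 + credit e \<le> w" "d \<le> Dd + 60 * Suc l + 40"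
          show "okc k 36 R s T w d" by (rule less.hyps[OF _ A]) (use l in simp)
        qed (use b1 b2 dv1 k2 R x xt xt2 tt Rr q rc2 gx w50 d in \<open>simp_all\<close>)
      qed (use x l2 w50 dk in simp_all)
      then show ?thesis using w50 neq md R x
        by (intro ok_run[where n = 5 and p = 36]) (simp_all)
    qed
  qed
qed

section \<open>Descending from the root to the leaves\<close>

text \<open>The valuation of the position of leaf \<open>c\<close> is below \<open>Q0\<close>
  because the position is positive and less than \<open>2 ^ Q0\<close>; so the role of the thread to
  be forked respects the global deadline.\<close>

lemma descend_right_role:
  assumes "0 < c" "c < n" obtains l where "2 ^ l dvd ps c" "odd (ps c div 2 ^ l)" "Dd + 60 * (l + 1) \<le> S"
proof -
  have p: "0 < ps c" using pos_strict_mono[OF assms(1), of m2] by simp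
  obtain l where l: "2 ^ l dvd ps c" "odd (ps c div 2 ^ l)" using exists_odd_block[OF p] by blast
  have "2 ^ l \<le> ps c" using l(1) p by (rule dvd_imp_le)
  also have "ps c < 2 ^ Q0" using pos_strict_mono[OF assms(2), of m2] ps_n assms by fastforce
  finally have "l < Q0" by simp
  then show ?thesis using that l S by simp
qed

text \<open>A full binary tree with \<open>j - i\<close> leaves has \<open>2 * (j - i) - 1\<close>
  nodes, with 60 units each; up to 40 units of an inner node become the credit of its gap. One level
  advances the clock by 9, for which 20 are reserved.\<close>

lemma descend:
  assumes "full s t" "sep t" "elems t = segment xs i j" "i < j" "j \<le> n" "role_ok k i (R 9) s (addrs t)"
    "R 0 = Ptr (root t)" "R 1 = Null" "R 5 = Num (2 ^ Q0)" "R 6 = Num (int m2)" "R 7 = Num (int i)"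
    "R 17 = Num 2" "R 18 = Num 0" "R 21 = Num 1"
    "right_ctx j (R 8) s T" "\<forall>y. R 8 = Ptr y \<longrightarrow> y \<notin> addrs t"
    "60 * (2 * (j - i) - 1) + credit j \<le> w" "d + 20 * ht t \<le> Dd"
  shows "okc k 17 R s T w d"
  using assms
proof (induction t arbitrary: i j k R s T w d)
  case (Lf a x)
  note R = Lf.prems(7-14)
  have c: "leaf_cells s a x" using Lf.prems(1) by simp
  have ne: "xs \<noteq> []" using Lf.prems(4,5) by auto
  have "length (segment xs i j) = 1" using Lf.prems(3) by (metis elems.simps(1) length_Cons list.size(3) One_nat_def)
  then have j: "j = Suc i" using Lf.prems(4,5) by simp
  \<comment> \<open>Since \<open>2 ^ Q0\<close> exceeds \<open>n\<close> and \<open>n\<close> is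
    positive, \<open>Q0\<close> is at least 1 and \<open>m2\<close> is even. Hence a leaf that
    occupies two places begins at an even position and is an aligned block of level 1.\<close>
  have "Q0 \<noteq> 0" using Q0[OF ne] ne by (intro notI) auto
  then have evm: "even m2" unfolding m2_def by simp
  have blk: "block s (Lf a x) i j l" if "ps (Suc i) = ps i + 2 ^ l" "l \<le> 1" for l
    using that Lf.prems(1-5) j by (auto simp: block_def)
  have lp: "okc k 36 R' s T w' d'" if "ps (Suc i) = ps i + 2 ^ l" "l \<le> 1" "2 ^ l dvd ps i" "R' 7 = Num (int (ps i))" "R' 15 = Num (2 ^ l)"
      "\<And>r. r \<notin> {7, 10, 15} \<Longrightarrow> R' r = R r" "w \<le> w' + 10" "d' \<le> d + 10" for R' l w' d'
    by (rule loop[OF blk[OF that(1,2)] that(3)])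
       (use R that(4-8) Lf.prems(6,15-18) j in simp_all)
  show ?case
  proof (cases "i < m2")
    case True
    have 1: "ps i = i" "ps (Suc i) = ps i + 2 ^ 0" using True evm by (auto simp: pos_def)
    have "okc k 36 (R(10 := Null, 15 := Num 1)) s T (w - 4) (d + 4)"
      by (rule lp[OF 1(2)]) (use 1(1) R in simp_all)
    then show ?thesis
      by (intro ok_run[where n = 4 and p = 17]) (use R c True Lf.prems(4,17) in simp_all)
  next
    case False
    have 1: "int (ps i) = int i + int i - int m2" "ps (Suc i) = ps i + 2 ^ 1" "2 ^ 1 dvd ps i" using False evm by (auto simp: pos_def)
    have "okc k 36 (R(10 := Null, 7 := Num (int (ps i)), 15 := Num 2)) s T (w - 7) (d + 7)"
      by (rule lp[OF 1(2) _ 1(3)]) (use R in simp_all)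
    then show ?thesis
      by (intro ok_run[where n = 7 and p = 17]) (use R c False 1(1) Lf.prems(4,17) in simp_all)
  qed
next
  case (Nd a lt rt)
  note R = Nd.prems(7-14) and i = Nd.prems(4,5) and rc = Nd.prems(15) and gt = Nd.prems(16) and w = Nd.prems(17) and d = Nd.prems(18)
  have f: "s (a, 0) = Some (Ptr (root lt))" "s (a, 1) = Some (Ptr (root rt))" "\<And>j. j < 8 \<Longrightarrow> (a, j) \<in> dom s"
    "full s lt" "full s rt" using Nd.prems(1) by auto
  have sp: "a \<notin> addrs lt" "a \<notin> addrs rt" "addrs lt \<inter> addrs rt = {}" "sep lt" "sep rt" using Nd.prems(2) by auto
  define c where "c = i + length (elems lt)"
  have len: "length (elems lt) + length (elems rt) = j - i"
    using arg_cong[OF Nd.prems(3), of length] i by simp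
  have ic: "i < c" "c < j" using len i length_elems_pos[of lt] length_elems_pos[of rt] unfolding c_def by linarith+
  have cn: "c \<noteq> n" "0 < c" "c < n" using ic i by simp_all
  have "elems lt @ elems rt = segment xs i c @ segment xs c j"
    using Nd.prems(3) segment_append[of i c j xs] ic by simp
  moreover have "length (elems lt) = length (segment xs i c)" using ic i by (simp add: c_def)
  ultimately have el: "elems lt = segment xs i c" "elems rt = segment xs c j" by simp_all
  obtain l where l: "2 ^ l dvd ps c" "odd (ps c div 2 ^ l)" "Dd + 60 * (l + 1) \<le> S"
    using descend_right_role[OF cn(2,3)] by blast
  obtain v6 where v6: "s (a, 6) = Some v6" using f(3)[of 6] by auto
  \<comment> \<open>The forked thread receives the right subtree, cells 1 and 7 of the new gap
    \<open>a\<close>, and, through \<open>G\<close>, what is owned of the gap after the whole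
    subtree. The right to join behind that gap must travel with it, so all old rights are passed on
    below (\<open>Y = UNIV\<close>) and the current thread keeps only the right to join the new
    thread.\<close>
  define G where "G = {(y, q) | y q. R 8 = Ptr y \<and> q \<in> {0, 2, 3, 4, 5, 6 :: nat}}"
  define X where "X = addrs rt \<times> UNIV \<union> {(a, 1), (a, 7)} \<union> G"
  have Gl: "(b, q) \<notin> X" if "b \<in> addrs lt" for b q using that sp gt unfolding X_def G_def by auto
  have Ga: "(a, q) \<notin> X" if "q \<notin> {1, 7}" for q using that sp gt unfolding X_def G_def by auto
  let ?R = "R(10 := Ptr (root lt), 11 := Ptr (root rt), 12 := Num (int (length (elems lt))))"
  let ?k = "Descend c a l"
  define w1 where "w1 = 60 * (2 * (j - c) - 1) + credit j + 4"
  define w2 where "w2 = 60 * (2 * (c - i) - 1) + credit c + 4"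
  have cr: "credit c \<le> 40" by (simp add: credit_def)
  have wlt: "w1 + w2 + 5 \<le> w" "4 \<le> w1" "4 \<le> w2"
    using w cr ic i len unfolding w1_def w2_def c_def by linarith+
  have "okc k 21 ?R s T (w - 4) (d + 4)"
  proof (rule ok.fork[where r = 13 and l = 26 and ?w1.0 = w1 and ?w2.0 = w2 and k' = ?k and X = X and Y = UNIV])
    show "okc ?k 26 ?R (s |` X) (T |` UNIV) w1 (d + 4 + 1)"
    proof (rule ok_run[where n = 4])
      have "okc ?k 17 (?R(9 := Ptr a, 0 := Ptr (root rt), 7 := Num (int c))) (s |` X) T (w1 - 4) (d + 9)"
      proof (rule Nd.IH(2)[of _ c j])
        show "full (s |` X) rt" by (rule full_mono[OF f(5)]) (simp add: X_def)
        have "(s |` X) (y, q) = s (y, q)" if "R 8 = Ptr y" "q \<in> {0, 2, 3, 4, 5, 6}" for y q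
          using that by (simp add: X_def G_def)
        then have "right_ctx j (R 8) (s |` X) T" by (intro right_ctx_mono[OF rc]) auto
        then show "right_ctx j ((?R(9 := Ptr a, 0 := Ptr (root rt), 7 := Num (int c))) 8) (s |` X) T" by simp
        show "role_ok ?k c ((?R(9 := Ptr a, 0 := Ptr (root rt), 7 := Num (int c))) 9) (s |` X) (addrs rt)"
          using l sp cn f(3)[of 1] f(3)[of 7] by (simp add: role_ok_def X_def)
      qed (use el ic i R sp gt d w1_def in simp_all)
      then show "case local_run concat_program 4 (26, ?R, s |` X) of None \<Rightarrow> False
          | Some (p', R', s') \<Rightarrow> okc ?k p' R' s' (T |` UNIV) (w1 - 4) (d + 4 + 1 + 4)"
        using R by (simp add: c_def restrict_map_def add.commute)
    qed (use wlt in simp)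
    fix u assume u: "u \<notin> dom T"
    let ?s = "(s |` (- X))((a, 6) \<mapsto> Thr u)" and ?T = "[u \<mapsto> ?k]"
    have s21: "Suc 21 = 22" by simp
    have "okc k 17 (?R(13 := Thr u, 14 := v6, 8 := Ptr a, 0 := Ptr (root lt))) ?s ?T (w2 - 4) (d + 9)"
    proof (rule Nd.IH(1)[of _ i c])
      show "full ?s lt" by (rule full_mono[OF f(4)]) (use Gl sp in auto)
      show "right_ctx c ((?R(13 := Thr u, 14 := v6, 8 := Ptr a, 0 := Ptr (root lt))) 8) ?s ?T"
        using cn l f(3) Ga by (simp add: right_ctx_def)
      show "role_ok k i ((?R(13 := Thr u, 14 := v6, 8 := Ptr a, 0 := Ptr (root lt))) 9) ?s (addrs lt)"
      proof -
        have "(x, q) \<notin> X" if "x \<notin> addrs (Nd a lt rt)" "q \<in> {1, 7}" for x q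
          using that unfolding X_def G_def by auto
        then show ?thesis using Nd.prems(6) unfolding role_ok_def by auto
      qed
    qed (use el ic i R sp d w2_def in simp_all)
    then show "okc k (Suc 21) (?R(13 := Thr u)) (s |` (- X)) ((T |` (- UNIV))(u \<mapsto> ?k)) w2 (d + 4 + 1)"
      unfolding s21 using R v6 Ga wlt
      by (intro ok_run[where n = 4 and p = 22]) (simp_all add: add.commute)
  qed (use wlt l in simp_all)
  then show ?case using R f full_size[OF f(4)] wlt
    by (intro ok_run[where n = 4 and p = 17]) simp_all
qed

section \<open>Splicing the batches into one tree\<close>

definition spliced :: "store \<Rightarrow> val tree option tree \<Rightarrow> val \<Rightarrow> bool" where
  "spliced s bt v \<longleftrightarrow> (v = Null \<and> concat (map batch_elems (elems bt)) = []) \<or>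
     (\<exists>t. v = Ptr (root t) \<and> full s t \<and> sep t \<and> elems t = concat (map batch_elems (elems bt)) \<and> ht t \<le> ht bt + H)"

lemma post_Splice: "post (Splice bt dl) R s T w \<longleftrightarrow> (\<exists>v. s (root bt, 6) = Some v \<and> spliced s bt v)"
  by (simp add: spliced_def)

lemma spliced_mono: "spliced s bt v \<Longrightarrow> (\<And>x v. s x = Some v \<Longrightarrow> s' x = Some v) \<Longrightarrow> spliced s' bt v"
proof -
  assume sp: "spliced s bt v" and m: "\<And>x v. s x = Some v \<Longrightarrow> s' x = Some v"
  have "full s' t" if "full s t" for t by (rule full_mono[OF that m])
  with sp show ?thesis unfolding spliced_def by blast
qed

text \<open>\<open>full\<close> never inspects the content of cell 6. So the result can be stored
  there even if the node is itself part of the spliced tree, in particular its root.\<close>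

lemma spliced_write:
  assumes "spliced s bt v" "(a, 6) \<in> dom s"
  shows "spliced (s((a, 6) \<mapsto> x)) bt v"
proof -
  have "full (s((a, 6) \<mapsto> x)) t" if "full s t" for t using that
  proof (induction t)
    case (Nd b l r)
    then show ?case by auto
  qed auto
  with assms(1) show ?thesis unfolding spliced_def by blast
qed

text \<open>With 30 units per node of a full binary tree with \<open>p + q\<close> leaves, the root
  retains 30 after both subtrees have been paid for.\<close>

lemma split_work: "0 < p \<Longrightarrow> 0 < q \<Longrightarrow> 30 * (2 * (p + q) - 1) \<le> w \<Longrightarrow> 30 * (2 * p - 1) + 30 * (2 * q - 1) + 30 \<le> w"
  for p q w :: nat
  by (cases p; cases q) auto

lemma splice_return:
  assumes "spliced s bt (R 3)" "(root bt, 6) \<in> dom s" "R 5 = Ptr (root bt)" "2 \<le> w" "d + 2 \<le> dl"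
  shows "okc (Splice bt dl) 87 R s T w d"
proof -
  obtain v where v: "s (root bt, 6) = Some v" using assms(2) by auto
  have "okc (Splice bt dl) 88 (R(14 := v)) (s((root bt, 6) \<mapsto> R 3)) T (w - 1) (d + 1)"
    by (rule ok.terminate) (use assms spliced_write[OF assms(1,2), of "R 3"] in \<open>simp_all only: post_Splice, auto\<close>)
  then show ?thesis using assms v by (intro ok_run[where n = "Suc 0" and p = 87]) simp_all
qed

text \<open>A node with items on both sides is reused to link the two spliced trees; otherwise the
  result of one side is passed up unchanged. The height is therefore at most that of the outer tree
  plus the bound \<open>H\<close> for a single batch.\<close>

lemma splice:
  assumes "splice_in H s bt" "R 0 = Ptr (root bt)" "R 1 = Null" "30 * (2 * length (elems bt) - 1) \<le> w"
    "d + 30 * (ht bt + 1) \<le> dl" "dl \<le> S"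
  shows "okc (Splice bt dl) 66 R s T w d"
  using assms
proof (induction bt arbitrary: R s T w d dl)
  case (Lf a b)
  have c: "s (a, 0) = Some Null" "s (a, 4) = Some (batch_val b)" "(a, 6) \<in> dom s" using Lf.prems(1) by auto
  have "spliced s (Lf a b) (batch_val b)" using Lf.prems(1) by (cases b) (auto simp: spliced_def)
  then have "okc (Splice (Lf a b) dl) 87 (R(3 := batch_val b, 5 := Ptr a)) s T (w - 5) (d + 5)"
    by (intro splice_return) (use c Lf.prems in simp_all)
  then show ?case using Lf.prems(2-5) c
    by (intro ok_run[where n = 5 and p = 66]) simp_all
next
  case (Nd a lt rt)
  note R = Nd.prems(2,3) and w = Nd.prems(4) and d = Nd.prems(5) and dl = Nd.prems(6)
  have f: "s (a, 0) = Some (Ptr (root lt))" "s (a, 1) = Some (Ptr (root rt))" "\<And>j. j < 8 \<Longrightarrow> (a, j) \<in> dom s"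
    "splice_in H s lt" "splice_in H s rt" "a \<notin> all_addrs lt" "a \<notin> all_addrs rt" "all_addrs lt \<inter> all_addrs rt = {}"
    using Nd.prems(1) by auto
  define w1 where "w1 = 30 * (2 * length (elems lt) - 1)"
  define w2 where "w2 = 30 * (2 * length (elems rt) - 1)"
  have wlt: "w1 + w2 + 30 \<le> w"
    unfolding w1_def w2_def
    by (rule split_work) (use w in simp_all)
  \<comment> \<open>Of the 30 clock units of a level, 20 are kept for the joins and the instructions
    after them; the code up to the joins takes 8.\<close>
  define dl' where "dl' = dl - 20"
  have dl': "d + 8 + 30 * (ht lt + 1) \<le> dl'" "d + 8 + 30 * (ht rt + 1) \<le> dl'" "dl' + 20 = dl" "dl' \<le> S"
    using d dl unfolding dl'_def by auto
  let ?k = "Splice (Nd a lt rt) dl"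
  let ?R = "R(3 := Ptr (root lt), 4 := Ptr (root rt), 5 := Ptr a, 0 := Ptr (root lt))"
  let ?s1 = "s |` (- (all_addrs lt \<times> UNIV))"
  let ?s2 = "?s1 |` (- (all_addrs rt \<times> UNIV))"
  have s2a: "?s2 (a, j) = s (a, j)" for j using f(6,7) by (simp add: restrict_map_def)
  have "okc ?k 71 ?R s T (w - 5) (d + 5)"
  proof (rule ok.fork[where r = 6 and l = 66 and ?w1.0 = w1 and ?w2.0 = "w - w1 - 6" and k' = "Splice lt dl'" and X = "all_addrs lt \<times> UNIV" and Y = "{}"])
    show "okc (Splice lt dl') 66 ?R (s |` (all_addrs lt \<times> UNIV)) (T |` {}) w1 (d + 5 + 1)"
    proof (rule Nd.IH(1))
      show "splice_in H (s |` (all_addrs lt \<times> UNIV)) lt" by (rule splice_in_mono[OF f(4)]) simp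
    qed (use R dl' w1_def in simp_all)
    fix u1 assume u1: "u1 \<notin> dom T"
    let ?T1 = "T(u1 \<mapsto> Splice lt dl')"
    have "okc ?k 73 (?R(6 := Thr u1, 0 := Ptr (root rt))) ?s1 ?T1 (w - w1 - 7) (d + 7)"
    proof (rule ok.fork[where r = 7 and l = 66 and ?w1.0 = w2 and ?w2.0 = "w - w1 - w2 - 8" and k' = "Splice rt dl'" and X = "all_addrs rt \<times> UNIV" and Y = "{}"])
      show "okc (Splice rt dl') 66 (?R(6 := Thr u1, 0 := Ptr (root rt))) (?s1 |` (all_addrs rt \<times> UNIV)) (?T1 |` {}) w2 (d + 7 + 1)"
      proof (rule Nd.IH(2))
        show "splice_in H (?s1 |` (all_addrs rt \<times> UNIV)) rt"
          by (rule splice_in_mono[OF f(5)]) (use f(8) in \<open>auto simp: restrict_map_def\<close>)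
      qed (use R dl' w2_def in simp_all)
      fix u2 assume u2: "u2 \<notin> dom ?T1"
      then have uu: "u2 \<noteq> u1" by auto
      let ?T2 = "?T1(u2 \<mapsto> Splice rt dl')"
      let ?R2 = "?R(6 := Thr u1, 0 := Ptr (root rt), 7 := Thr u2)"
      have "okc ?k 74 ?R2 ?s2 ?T2 (w - w1 - w2 - 8) (d + 8)"
      proof (rule ok.join[where r = 6 and u = u1 and k' = "Splice lt dl'"])
        fix R1 s1' T1' w1'
        assume p1: "post (Splice lt dl') R1 s1' T1' w1'" and ds1: "dom ?s2 \<inter> dom s1' = {}" and dT1: "dom ?T2 \<inter> dom T1' = {}"
        from p1 obtain v1 where v1: "s1' (root lt, 6) = Some v1" "spliced s1' lt v1" unfolding post_Splice by blast
        let ?s3 = "?s2 ++ s1'" and ?T3 = "?T2(u1 := None) ++ T1'"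
        let ?d3 = "max (d + 8) (deadline (Splice lt dl')) + 1"
        have T3: "?T3 u2 = Some (Splice rt dl')" by (rule map_add_leftI) (use uu dT1 in auto)
        have "okc ?k 75 ?R2 ?s3 ?T3 (w - w1 - w2 - 8 - 1 + w1') ?d3"
        proof (rule ok.join[where r = 7 and u = u2 and k' = "Splice rt dl'"])
          fix R4 s2' T2' w2'
          assume p2: "post (Splice rt dl') R4 s2' T2' w2'" and ds2: "dom ?s3 \<inter> dom s2' = {}"
          from p2 obtain v2 where v2: "s2' (root rt, 6) = Some v2" "spliced s2' rt v2" unfolding post_Splice by blast
          let ?s4 = "?s3 ++ s2'" and ?T4 = "?T3(u2 := None) ++ T2'"
          have M2: "?s4 c = Some v" if "?s2 c = Some v" for c v
            by (rule map_add_leftI[OF map_add_leftI[OF that ds1] ds2])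
          have Ml: "?s4 c = Some v" if "s1' c = Some v" for c v
            by (rule map_add_leftI[OF _ ds2]) (use that in simp)
          have Mr: "?s4 c = Some v" if "s2' c = Some v" for c v using that by simp
          have sl: "spliced ?s4 lt v1" using v1(2) Ml by (rule spliced_mono)
          have sr: "spliced ?s4 rt v2" using v2(2) Mr by (rule spliced_mono)
          have r6: "?s4 (root lt, 6) = Some v1" "?s4 (root rt, 6) = Some v2" using Ml[OF v1(1)] Mr[OF v2(1)] by auto
          have ad: "(a, j) \<in> dom ?s4" if "j < 8" for j
          proof -
            from f(3)[OF that] obtain v where "s (a, j) = Some v" by auto
            then show ?thesis using M2[of "(a, j)" v] s2a[of j] by auto
          qed
          have s75: "Suc 75 = 76" by simp
          define s4 where "s4 = ?s4"
          define w4 where "w4 = w - w1 - w2 - 8 - 1 + w1' - 1 + w2'"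
          define d4 where "d4 = max ?d3 (deadline (Splice rt dl')) + 1"
          have w4: "20 \<le> w4" and d4: "d4 + 18 \<le> dl" using wlt dl' unfolding w4_def d4_def by auto
          have M: "s2' c = Some v \<Longrightarrow> s4 c = Some v" "s1' c = Some v \<Longrightarrow> s4 c = Some v" for c v
            unfolding s4_def using Mr Ml by blast+
          note sl = sl[folded s4_def] and sr = sr[folded s4_def] and r6 = r6[folded s4_def] and ad = ad[folded s4_def]
          obtain x0 x1 x3 x6 where x: "s4 (a, 0) = Some x0" "s4 (a, Suc 0) = Some x1" "s4 (a, 3) = Some x3" "s4 (a, 6) = Some x6"
            using ad[of 0] ad[of 1] ad[of 3] ad[of 6] by auto
          have a6: "(root (Nd a lt rt), 6) \<in> dom s4" using ad[of 6] by simp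
          have "okc ?k 76 ?R2 s4 ?T4 w4 d4"
          proof (cases "v2 = Null")
            case True
            have "spliced s4 (Nd a lt rt) v1" using sl sr True unfolding spliced_def by auto
            then have "okc ?k 87 (?R2(3 := v1, 4 := v2)) s4 ?T4 (w4 - 3) (d4 + 3)"
              by (intro splice_return) (use a6 w4 d4 in simp_all)
            then show ?thesis using R r6 w4 True
              by (intro ok_run[where n = 3 and p = 76]) simp_all
          next
            case n2: False
            show ?thesis
            proof (cases "v1 = Null")
              case True
              have "spliced s4 (Nd a lt rt) v2" using sl sr True unfolding spliced_def by auto
              then have "okc ?k 87 (?R2(4 := v2, 3 := v2)) s4 ?T4 (w4 - 6) (d4 + 6)"
                by (intro splice_return) (use a6 w4 d4 in simp_all)
              then show ?thesis using R r6 w4 True n2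
                by (intro ok_run[where n = 6 and p = 76]) simp_all
            next
              case n1: False
              from n1 v1(2) obtain t1 where t1: "v1 = Ptr (root t1)" "full s1' t1" "sep t1"
                "elems t1 = concat (map batch_elems (elems lt))" "ht t1 \<le> ht lt + H" unfolding spliced_def by auto
              from n2 v2(2) obtain t2 where t2: "v2 = Ptr (root t2)" "full s2' t2" "sep t2"
                "elems t2 = concat (map batch_elems (elems rt))" "ht t2 \<le> ht rt + H" unfolding spliced_def by auto
              \<comment> \<open>Node \<open>a\<close> stayed with this thread, while the two
                subtrees lie in the cells returned by the two joins. Separation of these three
                stores makes \<open>Nd a t1 t2\<close> a proper tree.\<close>
              have a0: "(a, 0) \<in> dom ?s2" using s2a[of 0] f(1) by auto
              have o1: "(y, 0) \<in> dom s1'" if "y \<in> addrs t1" for y using full_dom[OF t1(2) that] by simp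
              have o2: "(y, 0) \<in> dom s2'" if "y \<in> addrs t2" for y using full_dom[OF t2(2) that] by simp
              have a1: "a \<notin> addrs t1" using o1 a0 ds1 by (meson disjoint_iff)
              have "(a, 0) \<in> dom ?s3" using a0 by auto
              then have a2: "a \<notin> addrs t2" using o2 ds2 by (meson disjoint_iff)
              have "(y, 0) \<in> dom ?s3" if "y \<in> addrs t1" for y using o1[OF that] by auto
              then have a12: "addrs t1 \<inter> addrs t2 = {}" using o2 ds2 by (meson disjoint_iff)
              have ra: "root t1 \<noteq> a" "root t2 \<noteq> a" "a \<noteq> root t1" "a \<noteq> root t2" using a1 a2 root_in_addrs by metis+
              have z: "s4 (root t1, 3) = Some (Num (int (length (elems t1))))" "s4 (root t2, 3) = Some (Num (int (length (elems t2))))"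
                using M full_size[OF t1(2)] full_size[OF t2(2)] by auto
              define s5 where "s5 = s4((a, 0) \<mapsto> Ptr (root t1), (a, Suc 0) \<mapsto> Ptr (root t2),
                 (a, 3) \<mapsto> Num (int (length (elems t1)) + int (length (elems t2))))"
              have f1: "full s5 t1" by (rule full_mono[OF t1(2)]) (use M a1 in \<open>auto simp: s5_def\<close>)
              have f2: "full s5 t2" by (rule full_mono[OF t2(2)]) (use M a2 in \<open>auto simp: s5_def\<close>)
              have "(a, j) \<in> dom s5" if "j < 8" for j using ad[OF that] by (simp add: s5_def)
              then have "full s5 (Nd a t1 t2)" using f1 f2 by (simp add: s5_def)
              then have "spliced s5 (Nd a lt rt) (Ptr a)" unfolding spliced_def using t1 t2 a1 a2 a12
                by (intro disjI2 exI[of _ "Nd a t1 t2"]) auto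
              then have "okc ?k 87 (?R2(4 := v2, 14 := x1, 7 := Num (int (length (elems t2))), 6 := Num (int (length (elems t1)) + int (length (elems t2))), 14 := x3, 3 := Ptr a)) s5 ?T4 (w4 - 11) (d4 + 11)"
                by (intro splice_return) (use a6 w4 d4 in \<open>simp_all add: s5_def\<close>)
              then show ?thesis using R r6 w4 t1(1) t2(1) x z ra unfolding s5_def
                by (intro ok_run[where n = 11 and p = 76]) (simp_all add: fun_upd_twist)
            qed
          qed
          then show "okc ?k (Suc 75) ?R2 ?s4 ?T4 (w - w1 - w2 - 8 - 1 + w1' - 1 + w2') (max ?d3 (deadline (Splice rt dl')) + 1)"
            unfolding s75 s4_def w4_def d4_def .
        qed (use wlt dl' T3 in simp_all)
        then show "okc ?k (Suc 74) ?R2 ?s3 ?T3 (w - w1 - w2 - 8 - 1 + w1') ?d3" by simp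
      qed (use wlt dl' uu in simp_all)
      then show "okc ?k (Suc 73) (?R(6 := Thr u1, 0 := Ptr (root rt), 7 := Thr u2)) ?s2
         ((?T1 |` (- {}))(u2 \<mapsto> Splice rt dl')) (w - w1 - w2 - 8) (d + 7 + 1)" by (simp add: restrict_map_UNIV add.commute)
    qed (use wlt dl' in simp_all)
    then show "okc ?k (Suc 71) (?R(6 := Thr u1)) ?s1 ((T |` (- {}))(u1 \<mapsto> Splice lt dl')) (w - w1 - 6) (d + 5 + 1)"
      using wlt by (intro ok_run[where n = "Suc 0" and p = "Suc 71"]) (simp_all add: restrict_map_UNIV add.commute)
  qed (use wlt dl' in simp_all)
  then show ?case using R f wlt
    by (intro ok_run[where n = 5 and p = 66]) simp_all
qed

section \<open>The initial thread\<close>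

text \<open>\<open>ok\<close> speaks about the whole remaining execution, so the effect of the loop
  is stated with a continuation \<open>cont\<close> at its exit label. The loop stops at
  \<open>Q0\<close> since \<open>2 ^ (Q0 - 1)\<close> is still at most \<open>n\<close>.\<close>

lemma power_loop:
  assumes "R 3 = Num (int n)" "R 4 = Num (2 ^ j)" "j < Q0" "xs \<noteq> []" "4 * (Q0 - j) \<le> w"
    and cont: "\<And>R' w' d'. (\<And>r. r \<notin> {4, 5} \<Longrightarrow> R' r = R r) \<Longrightarrow> R' 5 = Num (2 ^ Q0) \<Longrightarrow>
      w \<le> w' + 4 * (Q0 - j) \<Longrightarrow> d' \<le> d + 4 * (Q0 - j) \<Longrightarrow> ok concat_program post deadline S k 14 R' s T w' d'"
  shows "okc k 10 R s T w d"
  using assms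
proof (induction "Q0 - j" arbitrary: j R w d)
  case (Suc m)
  have q: "2 ^ Q0 \<le> 2 * n" "n < 2 ^ Q0" using Q0 Suc.prems(4) by auto
  have pw: "(2::int) ^ j + 2 ^ j = 2 ^ Suc j" by simp
  show ?case
  proof (cases "Suc j = Q0")
    case True
    have 1: "int n < 2 ^ j + 2 ^ j" using q(2) unfolding pw True by (metis of_nat_less_iff of_nat_numeral of_nat_power)
    have "okc k 14 (R(5 := Num (2 ^ Q0))) s T (w - 2) (d + 2)"
      by (rule Suc.prems(6)) (use Suc.prems(5) True in auto)
    then show ?thesis using Suc.prems(1-5) 1 True[symmetric]
      by (intro ok_run[where n = 2 and p = 10]) (simp_all add: pw)
  next
    case False
    then have "Suc j \<le> Q0 - 1" using Suc.prems(3) by simp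
    then have "(2::nat) ^ Suc j \<le> 2 ^ (Q0 - 1)" by (rule power_increasing) simp
    moreover have "(2::nat) * 2 ^ (Q0 - 1) = 2 ^ Q0" using Suc.prems(3) by (simp flip: power_Suc)
    ultimately have "2 ^ Suc j \<le> n" using q(1) by linarith
    then have 1: "\<not> int n < 2 ^ j + 2 ^ j" unfolding pw by (metis not_less of_nat_le_iff of_nat_numeral of_nat_power)
    have "okc k 10 (R(5 := Num (2 ^ Suc j), 4 := Num (2 ^ Suc j))) s T (w - 4) (d + 4)"
    proof (rule Suc.hyps(1)[of "Suc j"])
      fix R' w' d'
      assume "\<And>r. r \<notin> {4, 5} \<Longrightarrow> R' r = (R(5 := Num (2 ^ Suc j), 4 := Num (2 ^ Suc j))) r" "R' 5 = Num (2 ^ Q0)"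
        "w - 4 \<le> w' + 4 * (Q0 - Suc j)" "d' \<le> d + 4 + 4 * (Q0 - Suc j)"
      then show "okc k 14 R' s T w' d'"
        using Suc.prems(3,5) by (intro Suc.prems(6)) auto
    qed (use Suc.hyps(2) Suc.prems False in auto)
    then show ?thesis using Suc.prems(1-5) 1
      by (intro ok_run[where n = 4 and p = 10]) (simp_all add: pw)
  qed
qed simp

lemma main_empty:
  assumes "xs = []" "10 \<le> w"
  shows "okc Main 0 (\<lambda>_. Null) s T w 0"
proof -
  have p: "post Main (\<lambda>_. Null) s T (w - 1 - 1)" using assms(1) unfolding post.simps by blast
  have "okc Main 65 (\<lambda>_. Null) s T (w - 1) 1"
  proof (rule ok.terminate)
    show "post Main (\<lambda>_. Null) s T (w - 1 - 1)" by (rule p)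
  qed (use assms(2) S in simp_all)
  then show ?thesis using assms(2)
    by (intro ok_run[where n = "Suc 0" and p = 0]) simp_all
qed

lemma main_nonempty:
  assumes bt: "splice_in H s bt" and xs: "xs = concat (map batch_elems (elems bt))"
    and dep: "30 * (ht bt + 1) + 4 * Q0 + 20 * (ht bt + H) + 50 \<le> Dd"
    and w: "60 * length (elems bt) + 4 * Q0 + 120 * n + 50 \<le> w"
  shows "okc Main 0 ((\<lambda>_. Null)(0 := Ptr (root bt))) s Map.empty w 0"
proof -
  let ?R = "(\<lambda>_. Null)(0 := Ptr (root bt))"
  define dl where "dl = 30 * (ht bt + 1) + 2"
  define w1 where "w1 = 30 * (2 * length (elems bt) - 1)"
  have w1: "w1 + 4 * Q0 + 120 * n + 50 \<le> w" using w unfolding w1_def by linarith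
  have dl: "dl + 4 * Q0 + 20 * (ht bt + H) + 45 \<le> Dd" "dl + 100 \<le> S" using dep S unfolding dl_def by auto
  have "okc Main 1 ?R s Map.empty (w - 1) 1"
  \<comment> \<open>The initial thread gives all its cells to the splicing thread and retains only
    the right to join it.\<close>
  proof (rule ok.fork[where r = 2 and l = 66 and ?w1.0 = w1 and ?w2.0 = "w - w1 - 2" and k' = "Splice bt dl" and X = UNIV and Y = UNIV])
    show "okc (Splice bt dl) 66 ?R (s |` UNIV) (Map.empty |` UNIV) w1 (1 + 1)"
      by (rule splice) (use bt dl in \<open>simp_all add: w1_def dl_def restrict_map_def\<close>)
    fix u :: nat
    have "okc Main 2 (?R(2 := Thr u)) Map.empty [u \<mapsto> Splice bt dl] (w - w1 - 2) 2"
    proof (rule ok.join[where r = 2 and u = u and k' = "Splice bt dl"])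
      fix R' s' T' w'
      assume "post (Splice bt dl) R' s' T' w'"
      then obtain v where v: "s' (root bt, 6) = Some v" "spliced s' bt v" unfolding post_Splice by blast
      define w3 where "w3 = w - w1 - 3 + w'"
      have w3: "4 * Q0 + 120 * n + 40 \<le> w3" using w1 unfolding w3_def by linarith
      have "okc Main 3 (?R(2 := Thr u)) s' T' w3 (dl + 1)"
      proof (cases "v = Null")
        case True
        then have "xs = []" using v(2) xs unfolding spliced_def by auto
        then have p: "post Main (?R(2 := Thr u, 0 := Null)) s' T' (w3 - 2 - 1)" unfolding post.simps by simp
        have "okc Main 65 (?R(2 := Thr u, 0 := Null)) s' T' (w3 - 2) (Suc (Suc (Suc dl)))"
        proof (rule ok.terminate)
          show "post Main (?R(2 := Thr u, 0 := Null)) s' T' (w3 - 2 - 1)" by (rule p)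
        qed (use dl w3 in simp_all)
        then show ?thesis using True w3 v(1)
          by (intro ok_run[where n = 2 and p = 3]) simp_all
      next
        case False
        then obtain t where t: "v = Ptr (root t)" "full s' t" "sep t" "elems t = xs" "ht t \<le> ht bt + H"
          using v(2) xs unfolding spliced_def by auto
        have ne: "xs \<noteq> []" using t(4) elems_nonempty by metis
        \<comment> \<open>The search compares \<open>n\<close> with 2 first, so it could not find
          the exponent 0.\<close>
        have Qp: "0 < Q0" using Q0[OF ne] ne by (cases Q0) auto
        let ?R3 = "?R(2 := Thr u, 0 := Ptr (root t), 3 := Num (int n), 18 := Num 0, 21 := Num 1, 17 := Num 2, 4 := Num 1)"
        have "okc Main 10 ?R3 s' T' (w3 - 7) (dl + 8)"
        proof (rule power_loop[where j = 0])
          fix R' :: "reg \<Rightarrow> val" and w' d'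
          assume R': "\<And>r. r \<notin> {4, 5} \<Longrightarrow> R' r = ?R3 r" "R' 5 = Num (2 ^ Q0)"
            "w3 - 7 \<le> w' + 4 * (Q0 - 0)" "d' \<le> dl + 8 + 4 * (Q0 - 0)"
          have RR: "R' 0 = Ptr (root t)" "R' (Suc 0) = Null" "R' 3 = Num (int n)" "R' 8 = Null" "R' 9 = Null" "R' 17 = Num 2" "R' 18 = Num 0" "R' 21 = Num 1"
            using R'(1) by simp_all
          have m: "int n + int n - 2 ^ Q0 = int m2" using Q0[OF ne] unfolding m2_def by (simp add: of_nat_diff)
          \<comment> \<open>Register 8 is still \<open>Null\<close> in this thread, which is what
            \<open>right_ctx\<close> requires where no gap follows; accordingly
            \<open>credit n\<close> is 0.\<close>
          have "okc Main 17 (R'(6 := Num (int m2), 7 := Num 0)) s' T' (w' - 3) (d' + 3)"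
          proof (rule descend[of s' t 0 n])
            show "elems t = segment xs 0 n" by (simp add: segment_def t)
            show "60 * (2 * (n - 0) - 1) + credit n \<le> w' - 3" using R'(3) w3 by (simp add: credit_def)
          qed (use t ne RR R'(2,4) dl in \<open>simp_all add: role_ok_def right_ctx_def\<close>)
          moreover have "3 \<le> w'" using R'(3) w3 by simp
          ultimately show "okc Main 14 R' s' T' w' d'"
            using RR R'(2) m by (intro ok_run[where n = 3 and p = 14]) simp_all
        qed (use ne Qp w3 in simp_all)
        then show ?thesis using v(1) t(1) full_size[OF t(2)] t(4) w3
          by (intro ok_run[where n = 7 and p = 3]) (simp_all add: add.commute)
      qed
      then show "okc Main (Suc 2) (?R(2 := Thr u)) (Map.empty ++ s') ((Map.empty(u \<mapsto> Splice bt dl))(u := None) ++ T')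
         (w - w1 - 2 - 1 + w') (max 2 (deadline (Splice bt dl)) + 1)"
        by (simp add: w3_def dl_def numeral_3_eq_3)
    qed (use w1 dl in simp_all)
    then show "okc Main (Suc 1) (?R(2 := Thr u)) (s |` (- UNIV)) ((Map.empty |` (- UNIV))(u \<mapsto> Splice bt dl)) (w - w1 - 2) (1 + 1)"
      by (simp add: numeral_2_eq_2)
  qed (use w1 dl in simp_all)
  then show ?thesis using w
    by (intro ok_run[where n = "Suc 0" and p = 0]) simp_all
qed

end

section \<open>Inputs and bounds\<close>

lemma satD: "sat s h \<Longrightarrow> s (a, i) = Some v \<Longrightarrow> a < length h \<and> (h ! a) i = v"
  by (simp add: sat_def)

lemma bbt_of_bal:
  assumes "bal s t" "sep t" "sat s h"
  shows "bbt h (root t) (ht t) (elems t) (addrs t)"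
  using assms(1,2)
proof (induction t)
  case (Lf a x)
  then have c: "s (a, 0) = Some Null" "s (a, 1) = Some Null" "s (a, 2) = Some (Num 0)" "s (a, 3) = Some (Num 1)"
    "s (a, 4) = Some x" "s (a, 5) = Some x" by simp_all
  note sd = c[THEN satD[OF assms(3)]]
  have "bbt h a 0 [x] {a}" by (rule bbt.leaf) (use sd in simp_all)
  then show ?case by simp
next
  case (Nd a l r)
  then have c: "s (a, 0) = Some (Ptr (root l))" "s (a, 1) = Some (Ptr (root r))"
     "s (a, 2) = Some (Num (int (Suc (max (ht l) (ht r)))))"
     "s (a, 3) = Some (Num (int (length (elems l @ elems r))))"
     "s (a, 4) = Some (hd (elems l))" "s (a, 5) = Some (last (elems r))"
     "ht l \<le> ht r + 1" "ht r \<le> ht l + 1" by auto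
  note sd = c(1-6)[THEN satD[OF assms(3)]]
  have "bbt h a (Suc (max (ht l) (ht r))) (elems l @ elems r) ({a} \<union> addrs l \<union> addrs r)"
    by (rule bbt.node[where l = "root l" and r = "root r"]) (use Nd c(7,8) sd in simp_all)
  then show ?case by simp
qed

fun in_heap :: "heap \<Rightarrow> val tree \<Rightarrow> bool" where
  "in_heap h (Lf a x) \<longleftrightarrow> a < length h \<and> (h ! a) 0 = Null \<and> (h ! a) 1 = Null \<and> (h ! a) 2 = Num 0 \<and> (h ! a) 3 = Num 1 \<and>
     (h ! a) 4 = x \<and> (h ! a) 5 = x"
| "in_heap h (Nd a l r) \<longleftrightarrow> a < length h \<and> (h ! a) 0 = Ptr (root l) \<and> (h ! a) 1 = Ptr (root r) \<and>
     (h ! a) 3 = Num (int (length (elems l @ elems r))) \<and> in_heap h l \<and> in_heap h r"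

lemma tree_of_bbt:
  "bbt h a k ys A \<Longrightarrow> \<exists>t. root t = a \<and> ht t = k \<and> elems t = ys \<and> addrs t = A \<and> sep t \<and> in_heap h t"
proof (induction rule: bbt.induct)
  case (leaf a x)
  then show ?case by (intro exI[of _ "Lf a x"]) auto
next
  case (node l m xs A r n ys B a)
  then obtain tl tr where "root tl = l \<and> ht tl = m \<and> elems tl = xs \<and> addrs tl = A \<and> sep tl \<and> in_heap h tl"
    "root tr = r \<and> ht tr = n \<and> elems tr = ys \<and> addrs tr = B \<and> sep tr \<and> in_heap h tr" by blast
  with node show ?case by (intro exI[of _ "Nd a tl tr"]) auto
qed

lemma in_heap_lt: "in_heap h t \<Longrightarrow> a \<in> addrs t \<Longrightarrow> a < length h"
  by (induction t) auto

text \<open>Both subtrees of a tree of height \<open>k\<close> have height at least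
  \<open>k - 2\<close>, so the number of leaves at least doubles every two levels. This is weaker
  than the Fibonacci bound but suffices for logarithmic height.\<close>

lemma bbt_height: "bbt h a k ys A \<Longrightarrow> 2 ^ (k div 2) \<le> length ys"
proof (induction rule: bbt.induct)
  case (node l m xs A r n ys B a)
  have "Suc (max m n) div 2 \<le> Suc (min m n div 2)" using node by linarith
  then have "(2::nat) ^ (Suc (max m n) div 2) \<le> 2 ^ Suc (min m n div 2)" by (intro power_increasing) auto
  also have "\<dots> = 2 ^ (min m n div 2) + 2 ^ (min m n div 2)" by simp
  also have "\<dots> \<le> 2 ^ (m div 2) + 2 ^ (n div 2)" by (intro add_mono power_increasing div_le_mono) auto
  also have "\<dots> \<le> length (xs @ ys)" using node by simp
  finally show ?case .
qed simp

definition owned :: "heap \<Rightarrow> addr set \<Rightarrow> store" where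
  "owned h X = (\<lambda>(a, i). if a \<in> X \<and> i < 8 then Some ((h ! a) i) else None)"

lemma full_owned: "in_heap h t \<Longrightarrow> addrs t \<subseteq> X \<Longrightarrow> full (owned h X) t"
  by (induction t) (auto simp: owned_def)

lemma splice_in_exists:
  assumes "in_heap h t" "sep t" "elems t = map batch_val us" "addrs t \<subseteq> X"
    "sorted_wrt (\<lambda>u v. batch_addrs u \<inter> batch_addrs v = {}) us"
    "\<forall>u \<in> set us. batch_addrs u \<inter> addrs t = {} \<and> (\<forall>t. u = Some t \<longrightarrow> full (owned h X) t \<and> sep t \<and> ht t \<le> H)"
  shows "\<exists>bt. root bt = root t \<and> ht bt = ht t \<and> elems bt = us \<and> splice_in H (owned h X) bt \<and>
    all_addrs bt = addrs t \<union> \<Union> (batch_addrs ` set us)"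
  using assms
proof (induction t arbitrary: us)
  case (Lf a x)
  then obtain u where u: "us = [u]" "x = batch_val u" by (cases us) auto
  then show ?case using Lf
    by (intro exI[of _ "Lf a u"]) (auto simp: owned_def)
next
  case (Nd a l r)
  then obtain us1 us2 where us: "us = us1 @ us2" "elems l = map batch_val us1" "elems r = map batch_val us2"
    by (auto simp: append_eq_map_conv)
  have dj: "\<forall>u \<in> set us1. \<forall>v \<in> set us2. batch_addrs u \<inter> batch_addrs v = {}" using Nd.prems(5) us(1) by (simp add: sorted_wrt_append)
  have "\<exists>bt. root bt = root l \<and> ht bt = ht l \<and> elems bt = us1 \<and> splice_in H (owned h X) bt \<and>
    all_addrs bt = addrs l \<union> \<Union> (batch_addrs ` set us1)"
    by (rule Nd.IH(1)) (use Nd.prems us in \<open>auto simp: sorted_wrt_append\<close>)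
  then obtain bl where bl: "root bl = root l" "ht bl = ht l" "elems bl = us1" "splice_in H (owned h X) bl"
    "all_addrs bl = addrs l \<union> \<Union> (batch_addrs ` set us1)" by blast
  have "\<exists>bt. root bt = root r \<and> ht bt = ht r \<and> elems bt = us2 \<and> splice_in H (owned h X) bt \<and>
    all_addrs bt = addrs r \<union> \<Union> (batch_addrs ` set us2)"
    by (rule Nd.IH(2)) (use Nd.prems us in \<open>auto simp: sorted_wrt_append\<close>)
  then obtain br where br: "root br = root r" "ht br = ht r" "elems br = us2" "splice_in H (owned h X) br"
    "all_addrs br = addrs r \<union> \<Union> (batch_addrs ` set us2)" by blast
  have d6: "\<forall>u \<in> set us1 \<union> set us2. batch_addrs u \<inter> insert a (addrs l \<union> addrs r) = {}" using Nd.prems(6) us(1) by auto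
  have 1: "a \<notin> all_addrs bl \<union> all_addrs br" unfolding bl(5) br(5) using d6 Nd.prems(2) by auto
  have "(addrs l \<union> \<Union> (batch_addrs ` set us1)) \<inter> (addrs r \<union> \<Union> (batch_addrs ` set us2)) = {}"
    using d6 dj Nd.prems(2) by (simp add: Int_Un_distrib Int_Un_distrib2) blast
  then have 2: "all_addrs bl \<inter> all_addrs br = {}" unfolding bl(5) br(5) .
  have "\<forall>j < 8. (a, j) \<in> dom (owned h X)" using Nd.prems(4) by (auto simp: owned_def)
  moreover have "owned h X (a, 0) = Some (Ptr (root bl))" "owned h X (a, 1) = Some (Ptr (root br))"
    using Nd.prems(1,4) bl(1) br(1) by (auto simp: owned_def)
  ultimately show ?case using bl br 1 2 us(1)
    by (intro exI[of _ "Nd a bl br"]) (auto)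
qed

text \<open>The length of the binary representation. For positive \<open>m\<close>,
  \<open>2 ^ lg m\<close> is the power of two above \<open>m\<close> and at most
  \<open>2 * m\<close>, which is how \<open>Q0\<close> is instantiated.\<close>

definition lg :: "nat \<Rightarrow> nat" where
  "lg m = (LEAST k. m < 2 ^ k)"

lemma less_lg: "m < 2 ^ lg m"
  unfolding lg_def by (rule LeastI[of _ m]) (rule less_exp)

lemma lg_le: "m < 2 ^ k \<Longrightarrow> lg m \<le> k"
  unfolding lg_def by (rule Least_le)

lemma lg_le_self: "lg m \<le> m"
  by (rule lg_le) (rule less_exp)

lemma pow_lg: "0 < m \<Longrightarrow> 2 ^ lg m \<le> 2 * m"
proof (cases "lg m")
  case (Suc k)
  assume "0 < m"
  have "\<not> m < 2 ^ k" using lg_le[of m k] Suc by linarith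
  then show ?thesis using Suc by simp
qed simp

lemma ln_2_ge: "1 / 2 \<le> ln (2::real)"
  using ln_le_minus_one[of "1 / 2 :: real"] by (simp add: ln_div)

text \<open>The factor 2 replaces \<open>1 / ln 2\<close>, by \<open>ln_2_ge\<close>. At 0 the bound
  uses the convention \<open>ln 0 = 0\<close>.\<close>

lemma lg_real: "real (lg m) \<le> 1 + 2 * ln (real m)"
proof (cases "m = 0")
  case True
  have "lg 0 \<le> 0" by (rule lg_le) simp
  then show ?thesis using True by simp
next
  case False
  then have "(2::real) ^ lg m \<le> 2 * real m" using pow_lg[of m] by (metis gr0I of_nat_le_iff of_nat_mult of_nat_numeral of_nat_power)
  then have "ln ((2::real) ^ lg m) \<le> ln (2 * real m)" using False by (subst ln_le_cancel_iff) auto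
  then have "real (lg m) * ln 2 \<le> ln 2 + ln (real m)" using False by (simp add: ln_realpow ln_mult)
  moreover have l2: "(1/2::real) \<le> ln 2" by (rule ln_2_ge)
  moreover have "0 \<le> ln (real m)" using False by simp
  ultimately have "(real (lg m) - 1) * ln 2 \<le> ln (real m)" "0 \<le> ln (real m)" by (auto simp: algebra_simps)
  moreover have "(real (lg m) - 1) * (1/2) \<le> (real (lg m) - 1) * ln 2" if "1 \<le> real (lg m)"
    using l2 that by (intro mult_left_mono) auto
  ultimately show ?thesis by (cases "1 \<le> real (lg m)") auto
qed

theorem concat_batches_runs_within:
  assumes "batch_of_batches h v xss"
  shows "runs_within concat_program h v (\<lambda>h' v'. \<exists>A. batch h' v' (concat xss) A)
    (real (60 * length xss + 124 * length (concat xss) + 50))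
    (real (100 * lg (length xss) + 104 * lg (length (concat xss)) + 200))"
proof -
  define xs where "xs = concat xss"
  let ?b = "length xss" and ?n = "length xs"
  \<comment> \<open>The height of a BBT is at most twice \<open>lg\<close> of the number of its
    elements. Inserting \<open>2 * lg ?b\<close> for the outer tree and \<open>H\<close> for the
    inner ones into the depth condition of \<open>main_nonempty\<close> gives exactly
    \<open>Dd\<close>, and \<open>S\<close> is \<open>Dd + 60 * (lg ?n + 2)\<close>. In
    \<open>W\<close> the summand \<open>4 * lg ?n\<close> has been absorbed into
    \<open>4 * ?n\<close>.\<close>
  define H where "H = 2 * lg ?n"
  define Dd where "Dd = 100 * lg ?b + 44 * lg ?n + 80"
  define S where "S = 100 * lg ?b + 104 * lg ?n + 200"
  define W where "W = 60 * ?b + 124 * ?n + 50"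
  interpret concat_run xs "lg ?n" Dd H S
    by unfold_locales (use less_lg[of ?n] pow_lg[of ?n] in \<open>auto simp: Dd_def S_def\<close>)
  have result: "\<exists>A. batch h' (R 0) xs A" if p: "post Main R s T w" and st: "sat s h'" for R s T w h'
    using p unfolding post.simps
  proof (elim disjE conjE exE)
    assume "R 0 = Null" "xs = []"
    then show ?thesis using batch.empty[of h'] by auto
  next
    fix t assume "R 0 = Ptr (root t)" "bal s t" "sep t" "elems t = xs"
    then show ?thesis using batch.nonempty[OF bbt_of_bal[OF _ _ st]] by metis
  qed
  from assms obtain vs A B where v: "batch h v vs A" and len: "length vs = length xss"
    and bs: "\<And>i. i < length xss \<Longrightarrow> batch h (vs ! i) (xss ! i) (B i) \<and> A \<inter> B i = {}"
    and dj: "\<And>i j. i < length xss \<Longrightarrow> j < i \<Longrightarrow> B i \<inter> B j = {}"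
    unfolding batch_of_batches_def by metis
  have "\<exists>s. sat s h \<and> okc Main 0 ((\<lambda>_. Null)(0 := v)) s Map.empty W 0"
    using v
  proof cases
    case empty
    then have "xs = []" using len by (simp add: xs_def)
    then have "okc Main 0 (\<lambda>_. Null) Map.empty Map.empty W 0" by (rule main_empty) (simp add: W_def)
    moreover have "((\<lambda>_. Null)(0 := v) :: reg \<Rightarrow> val) = (\<lambda>_. Null)" using empty by auto
    ultimately have "okc Main 0 ((\<lambda>_. Null)(0 := v)) Map.empty Map.empty W 0" by (simp only:)
    moreover have "sat Map.empty h" by (simp add: sat_def)
    ultimately show ?thesis by blast
  next
    case (nonempty a k)
    obtain t where t: "root t = a" "ht t = k" "elems t = vs" "addrs t = A" "sep t" "in_heap h t"
      using tree_of_bbt[OF nonempty(2)] by blast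
    have "\<exists>u. batch_val u = vs ! i \<and> batch_elems u = xss ! i \<and> batch_addrs u = B i \<and>
        (\<forall>t. u = Some t \<longrightarrow> in_heap h t \<and> sep t \<and> 2 ^ (ht t div 2) \<le> length (elems t))" if i: "i < length xss" for i
      using conjunct1[OF bs[OF i]]
    proof cases
      case empty
      then show ?thesis by (intro exI[of _ None]) auto
    next
      case (nonempty a k)
      then show ?thesis using tree_of_bbt[OF nonempty(2)] bbt_height[OF nonempty(2)] by (metis batch_addrs.simps(2) batch_elems.simps(2) batch_val.simps(2) option.inject)
    qed
    then obtain f where f: "\<And>i. i < length xss \<Longrightarrow> batch_val (f i) = vs ! i \<and> batch_elems (f i) = xss ! i \<and> batch_addrs (f i) = B i \<and>
        (\<forall>t. f i = Some t \<longrightarrow> in_heap h t \<and> sep t \<and> 2 ^ (ht t div 2) \<le> length (elems t))" by metis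
    define us where "us = map f [0..<length xss]"
    define X where "X = A \<union> (\<Union>i<length xss. B i)"
    have vs: "vs = map batch_val us" unfolding us_def by (rule nth_equalityI) (use len f in auto)
    have xss: "map batch_elems us = xss" unfolding us_def by (rule nth_equalityI) (use f in auto)
    have srt: "sorted_wrt (\<lambda>u v. batch_addrs u \<inter> batch_addrs v = {}) us"
      unfolding sorted_wrt_iff_nth_less
    proof (intro allI impI)
      fix i j assume ij: "i < j" "j < length us"
      then have "batch_addrs (us ! i) = B i" "batch_addrs (us ! j) = B j" using f by (simp_all add: us_def)
      then show "batch_addrs (us ! i) \<inter> batch_addrs (us ! j) = {}" using dj[of j i] ij by (simp add: us_def Int_commute)
    qed
    have ub: "batch_addrs u \<inter> addrs t = {} \<and> (\<forall>t. u = Some t \<longrightarrow> full (owned h X) t \<and> sep t \<and> ht t \<le> H)" if u: "u \<in> set us" for u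
    proof -
      from u obtain i where i: "i < length xss" "u = f i" unfolding us_def by auto
      have "full (owned h X) t' \<and> sep t' \<and> ht t' \<le> H" if t': "u = Some t'" for t'
      proof -
        have a: "addrs t' = B i" "elems t' = xss ! i" "in_heap h t'" "sep t'" "2 ^ (ht t' div 2) \<le> length (elems t')"
          using f[OF i(1)] t' i(2) by auto
        have "full (owned h X) t'" by (rule full_owned[OF a(3)]) (use a(1) i in \<open>auto simp: X_def\<close>)
        moreover have "length (xss ! i) \<le> ?n" unfolding xs_def length_concat
          by (rule member_le_sum_list) (use i in auto)
        then have "2 ^ (ht t' div 2) < (2::nat) ^ lg ?n" using a(2,5) less_lg[of ?n] by (metis le_less_trans)
        then have "ht t' div 2 < lg ?n" by simp
        then have "ht t' \<le> H" unfolding H_def by linarith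
        ultimately show ?thesis using a(4) by simp
      qed
      moreover have "batch_addrs u \<inter> addrs t = {}" using f[OF i(1)] bs[OF i(1)] i(2) t(4) by auto
      ultimately show ?thesis by blast
    qed
    from splice_in_exists[OF t(6,5), of us X H] obtain bt where
      bt: "root bt = a" "ht bt = k" "elems bt = us" "splice_in H (owned h X) bt"
      using t(1-4) vs srt ub by (auto simp: X_def)
    have "2 ^ (k div 2) < (2::nat) ^ lg ?b" using bbt_height[OF nonempty(2)] len less_lg[of ?b] by (metis le_less_trans)
    then have "k div 2 < lg ?b" by simp
    then have k: "k \<le> 2 * lg ?b" by linarith
    have "okc Main 0 ((\<lambda>_. Null)(0 := Ptr (root bt))) (owned h X) Map.empty W 0"
    proof (rule main_nonempty[OF bt(4)])
      show "xs = concat (map batch_elems (elems bt))" using xss bt(3) by (simp add: xs_def)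
      show "30 * (ht bt + 1) + 4 * lg ?n + 20 * (ht bt + H) + 50 \<le> Dd" using k bt(2) unfolding Dd_def H_def by simp
      have "length (elems bt) = ?b" using bt(3) by (simp add: us_def)
      then show "60 * length (elems bt) + 4 * lg ?n + 120 * ?n + 50 \<le> W" using lg_le_self[of ?n] unfolding W_def by linarith
    qed
    moreover have "sat (owned h X) h"
    proof -
      have "b < length h" if b: "b \<in> X" for b
      proof -
        from b consider "b \<in> A" | i where "i < length xss" "b \<in> B i" unfolding X_def by auto
        then show ?thesis
        proof cases
          case 2
          then obtain t' where "f i = Some t'" "b \<in> addrs t'" using f[OF 2(1)] by (cases "f i") auto
          then show ?thesis using f[OF 2(1)] in_heap_lt by metis
        qed (use t in_heap_lt in metis)
      qed
      then show ?thesis by (auto simp: sat_def owned_def split: if_splits)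
    qed
    ultimately show ?thesis using nonempty(1) bt(1) by auto
  qed
  then obtain s where s: "sat s h" "okc Main 0 ((\<lambda>_. Null)(0 := v)) s Map.empty W 0" by blast
  have "runs_within concat_program h v (\<lambda>h' v'. \<exists>A. batch h' v' xs A) (real W) (real S)"
    by (rule certified.runs_within_certified[OF s(2,1)]) (use result in auto)
  then show ?thesis unfolding W_def S_def xs_def .
qed

section \<open>Asymptotic bounds\<close>

text \<open>The pair (0, 0), where the right-hand side vanishes, is the only possible exception;
  elsewhere the constant 50 is at most \<open>50 * (b + n)\<close>.\<close>

lemma work_bound: "(\<lambda>(b, n). real (60 * b + 124 * n + 50)) \<in> O[cofinite](\<lambda>(b, n). real b + real n)"
proof (rule bigoI[of _ 300])
  have "{x. \<not> norm (case x of (b, n) \<Rightarrow> real (60 * b + 124 * n + 50)) \<le> 300 * norm (case x of (b, n) \<Rightarrow> real b + real n)} \<subseteq> {(0, 0)}"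
    by (auto simp: not_le)
  then show "\<forall>\<^sub>F x in cofinite. norm (case x of (b, n) \<Rightarrow> real (60 * b + 124 * n + 50)) \<le> 300 * norm (case x of (b, n) \<Rightarrow> real b + real n)"
    unfolding eventually_cofinite by (rule finite_subset) simp
qed

text \<open>When both parameters are at most 1, the two logarithms vanish, also at 0 by the
  convention \<open>ln 0 = 0\<close>; these four pairs are set aside. Otherwise the sum of the
  logarithms is at least 1/2, so the additive constant 404 is at most 808 times the sum, and 808 +
  208 is below 1100.\<close>

lemma span_bound:
  "(\<lambda>(b, n). real (100 * lg b + 104 * lg n + 200)) \<in> O[cofinite](\<lambda>(b, n). ln (real b) + ln (real n))"
proof (rule bigoI[of _ 1100])
  have bnd: "real (100 * lg b + 104 * lg n + 200) \<le> 1100 * (ln (real b) + ln (real n))" if "2 \<le> b \<or> 2 \<le> n" for b n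
  proof -
    have 0: "0 \<le> ln (real m)" for m by (cases "m = 0") auto
    have "1 / 2 \<le> ln (real m)" if "2 \<le> m" for m
    proof -
      have "ln 2 \<le> ln (real m)" using that by simp
      with ln_2_ge show ?thesis by linarith
    qed
    with that have "1 / 2 \<le> ln (real b) \<or> 1 / 2 \<le> ln (real n)" by blast
    then have "1 / 2 \<le> ln (real b) + ln (real n)" using 0[of b] 0[of n] by linarith
    moreover have "real (100 * lg b + 104 * lg n + 200) \<le> 404 + 200 * ln (real b) + 208 * ln (real n)"
      using lg_real[of b] lg_real[of n] by simp
    ultimately show ?thesis using 0[of b] 0[of n] by argo
  qed
  have "{x. \<not> norm (case x of (b, n) \<Rightarrow> real (100 * lg b + 104 * lg n + 200)) \<le> 1100 * norm (case x of (b, n) \<Rightarrow> ln (real b) + ln (real n))}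
    \<subseteq> {..1} \<times> {..1}"
  proof (rule subsetI, rule ccontr)
    fix x :: "nat \<times> nat"
    assume x: "x \<in> {x. \<not> norm (case x of (b, n) \<Rightarrow> real (100 * lg b + 104 * lg n + 200)) \<le> 1100 * norm (case x of (b, n) \<Rightarrow> ln (real b) + ln (real n))}"
      and nx: "x \<notin> {..1} \<times> {..1}"
    obtain b n where bn: "x = (b, n)" by force
    have "2 \<le> b \<or> 2 \<le> n" using nx unfolding bn by auto
    note bd = bnd[OF this]
    have "0 \<le> ln (real b) + ln (real n)" using order_trans[OF of_nat_0_le_iff bd] by simp
    then have "norm (real (100 * lg b + 104 * lg n + 200)) \<le> 1100 * norm (ln (real b) + ln (real n))"
      using bd by (simp only: real_norm_def abs_of_nat abs_of_nonneg)
    then show False using x unfolding bn by simp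
  qed
  then show "\<forall>\<^sub>F x in cofinite. norm (case x of (b, n) \<Rightarrow> real (100 * lg b + 104 * lg n + 200)) \<le> 1100 * norm (case x of (b, n) \<Rightarrow> ln (real b) + ln (real n))"
    unfolding eventually_cofinite by (rule finite_subset) simp
qed

theorem mainTheorem9:
  shows "\<exists>(P :: program) (W :: nat \<times> nat \<Rightarrow> real) (S :: nat \<times> nat \<Rightarrow> real).
    W \<in> O[cofinite](\<lambda>(b, n). real b + real n) \<and>
    S \<in> O[cofinite](\<lambda>(b, n). ln (real b) + ln (real n)) \<and>
    (\<forall>h v xss b n.
       batch_of_batches h v xss \<longrightarrow> b = length xss \<longrightarrow> n = length (concat xss) \<longrightarrow>
       runs_within P h v (\<lambda>h' v'. \<exists>A. batch h' v' (concat xss) A) (W (b, n)) (S (b, n)))"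
  using work_bound span_bound concat_batches_runs_within
  by (intro exI[of _ concat_program] exI[of _ "\<lambda>(b, n). real (60 * b + 124 * n + 50)"]
      exI[of _ "\<lambda>(b, n). real (100 * lg b + 104 * lg n + 200)"]) auto

end
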